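(* Let $0<p\le\infty$ and $\alpha>0$. A set $\Lambda\subset\mathbb{C}_0$ is complete interpolating for the one-sided small Fock space $\mathcal{F}^p_{\alpha+}$ if and only if the following three conditions are satisfied: (i) $\Lambda$ is $d_{\log_+}$-separated; and $\Lambda$ can be enumerated (by its distinct elements) as $\Lambda=(\lambda_k)_{k\ge 0}$ with $|\lambda_k|\le|\lambda_{k+1}|$ for all $k\ge 0$, in such a way that, writing $$\lambda_k=e^{\frac{k+2/p+\delta_k}{2\alpha}}e^{i\theta_k},\qquad \delta_k,\theta_k\in\mathbb{R},$$ one has (ii) $(\delta_k)_{k\ge 0}\in\ell^\infty(\mathbb{N}_0)$; (iii) there exist $N\in\mathbb{N}$ and $\varepsilon>0$ such that $$\sup_{n\ge 0}\left|\frac1N\sum_{k=n}^{n+N-1}\delta_k\right|\le\frac12-\varepsilon .$$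
   Context: Notation: $\mathbb{C}_0=\mathbb{C}\setminus\{0\}$, $\mathbb{N}_0=\{0,1,2,\dots\}$, $\mathbb{N}=\{1,2,\dots\}$, $\log_+ t=\max(\log t,0)$ (with $\log_+0=0$), and $2/p=0$ when $p=\infty$. $dA$ is two-dimensional Lebesgue measure. One-sided small Fock space: for $\alpha>0$ and $0<p\le\infty$, $\mathcal{F}^p_{\alpha+}$ is the space of entire functions $f$ with $\|f\|_{\mathcal{F}^p_{\alpha+}}<\infty$, where $\|f\|^p_{\mathcal{F}^p_{\alpha+}}=\int_{\mathbb{C}}|f(z)|^pe^{-p\alpha\log_+^2|z|}\,dA(z)$ for $p<\infty$ and $\|f\|_{\mathcal{F}^\infty_{\alpha+}}=\sup_{z\in\mathbb{C}}|f(z)|e^{-\alpha\log_+^2|z|}$ for $p=\infty$. Complete interpolating: for a set $\Lambda\subset\mathbb{C}$ consider the restriction operator $R_\Lambda: f\mapsto\big(f(\lambda)(1+|\lambda|)^{2/p}e^{-\alpha\log_+^2|\lambda|}\big)_{\lambda\in\Lambda}$ on $\mathcal{F}^p_{\alpha+}$. The set $\Lambda$ is complete interpolating for $\mathcal{F}^p_{\alpha+}$ if $R_\Lambda$ is an isomorphism (bounded linear bijection with bounded inverse) between $\mathcal{F}^p_{\alpha+}$ and $\ell^p(\Lambda)$. Separation: for $z,w\in\mathbb{C}_0$ let $d_{\log}(z,w)=\big|\log|z|-\log|w|\big|+\left|\frac{z}{|z|}-\frac{w}{|w|}\right|$. A set $\Lambda\subset\mathbb{C}_0$ is $d_{\log}$-separated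 if there is $d_\Lambda>0$ such that $d_{\log}(\lambda,\lambda')\ge d_\Lambda$ for all distinct $\lambda,\lambda'\in\Lambda$. A set $\Lambda\subset\mathbb{C}$ is $d_{\log_+}$-separated if, for every disc centered at $0$, the part of $\Lambda$ outside the disc is $d_{\log}$-separated and the part of $\Lambda$ inside the disc is Euclidean separated (i.e. the distances $|\lambda-\lambda'|$ between distinct points are bounded below by a positive constant). *)

theory Defs
  imports "HOL-Analysis.Analysis"
begin

definition log_plus :: "real \<Rightarrow> real" where
  "log_plus t = (if t > 0 then max (ln t) 0 else 0)"

text \<open>
  Exponents \<open>p\<close> with \<open>0 < p \<le> \<infinity>\<close> are extended nonnegative reals; \<open>enn2real (2 / p)\<close> is the
  real number \<open>2 / p\<close>, with value \<open>0\<close> for \<open>p = \<infinity>\<close>.  For \<open>p < 1\<close> the norms below are only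
  quasi-norms.  The integral and supremum in \<open>fock_norm\<close> are real-valued, hence meaningful on
  members of \<open>fock_space\<close> only.
\<close>

definition fock_space :: "ennreal \<Rightarrow> real \<Rightarrow> (complex \<Rightarrow> complex) set" where
  "fock_space p \<alpha> = {f. f holomorphic_on UNIV \<and>
     (if p = \<infinity> then bdd_above (range (\<lambda>z. cmod (f z) * exp (- \<alpha> * (log_plus (cmod z))\<^sup>2)))
      else integrable lborel
        (\<lambda>z. cmod (f z) powr enn2real p * exp (- enn2real p * \<alpha> * (log_plus (cmod z))\<^sup>2)))}"

definition fock_norm :: "ennreal \<Rightarrow> real \<Rightarrow> (complex \<Rightarrow> complex) \<Rightarrow> real" where
  "fock_norm p \<alpha> f =
     (if p = \<infinity> then (SUP z. cmod (f z) * exp (- \<alpha> * (log_plus (cmod z))\<^sup>2))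
      else (LINT z|lborel. cmod (f z) powr enn2real p *
              exp (- enn2real p * \<alpha> * (log_plus (cmod z))\<^sup>2)) powr (1 / enn2real p))"

text \<open>
  Families indexed by a set \<open>I\<close> are represented by functions vanishing off \<open>I\<close>.  The \<open>0\<close> inserted
  into the supremum only matters for \<open>I = {}\<close>.
\<close>

definition lp_space :: "ennreal \<Rightarrow> 'a set \<Rightarrow> ('a \<Rightarrow> complex) set" where
  "lp_space p I = {c. (\<forall>x. x \<notin> I \<longrightarrow> c x = 0) \<and>
     (if p = \<infinity> then bdd_above ((\<lambda>x. cmod (c x)) ` I)
      else (\<lambda>x. cmod (c x) powr enn2real p) summable_on I)}"

definition lp_norm :: "ennreal \<Rightarrow> 'a set \<Rightarrow> ('a \<Rightarrow> complex) \<Rightarrow> real" where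
  "lp_norm p I c =
     (if p = \<infinity> then Sup (insert 0 ((\<lambda>x. cmod (c x)) ` I))
      else (\<Sum>\<^sub>\<infinity>x\<in>I. cmod (c x) powr enn2real p) powr (1 / enn2real p))"

definition restriction_op ::
  "ennreal \<Rightarrow> real \<Rightarrow> complex set \<Rightarrow> (complex \<Rightarrow> complex) \<Rightarrow> complex \<Rightarrow> complex" where
  "restriction_op p \<alpha> \<Lambda> f = (\<lambda>l. if l \<in> \<Lambda>
     then f l * of_real ((1 + cmod l) powr enn2real (2 / p) * exp (- \<alpha> * (log_plus (cmod l))\<^sup>2))
     else 0)"

definition bounded_iso ::
  "('a \<Rightarrow> complex) set \<Rightarrow> (('a \<Rightarrow> complex) \<Rightarrow> real) \<Rightarrow>
   ('b \<Rightarrow> complex) set \<Rightarrow> (('b \<Rightarrow> complex) \<Rightarrow> real) \<Rightarrow>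
   (('a \<Rightarrow> complex) \<Rightarrow> 'b \<Rightarrow> complex) \<Rightarrow> bool" where
  "bounded_iso V nV W nW T \<longleftrightarrow>
     (\<forall>f\<in>V. \<forall>g\<in>V. T (\<lambda>x. f x + g x) = (\<lambda>y. T f y + T g y)) \<and>
     (\<forall>a. \<forall>f\<in>V. T (\<lambda>x. a * f x) = (\<lambda>y. a * T f y)) \<and>
     bij_betw T V W \<and>
     (\<exists>C. \<forall>f\<in>V. nW (T f) \<le> C * nV f) \<and>
     (\<exists>C. \<forall>c\<in>W. nV (inv_into V T c) \<le> C * nW c)"

definition complete_interpolating :: "ennreal \<Rightarrow> real \<Rightarrow> complex set \<Rightarrow> bool" where
  "complete_interpolating p \<alpha> \<Lambda> \<longleftrightarrow>
     bounded_iso (fock_space p \<alpha>) (fock_norm p \<alpha>) (lp_space p \<Lambda>) (lp_norm p \<Lambda>)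
       (restriction_op p \<alpha> \<Lambda>)"

definition d_log :: "complex \<Rightarrow> complex \<Rightarrow> real" where
  "d_log z w = \<bar>ln (cmod z) - ln (cmod w)\<bar> +
     cmod (z / of_real (cmod z) - w / of_real (cmod w))"

definition separated_wrt :: "('a \<Rightarrow> 'a \<Rightarrow> real) \<Rightarrow> 'a set \<Rightarrow> bool" where
  "separated_wrt d S \<longleftrightarrow> (\<exists>\<epsilon>>0. \<forall>x\<in>S. \<forall>y\<in>S. x \<noteq> y \<longrightarrow> \<epsilon> \<le> d x y)"

definition d_log_plus_separated :: "complex set \<Rightarrow> bool" where
  "d_log_plus_separated \<Lambda> \<longleftrightarrow>
     (\<forall>r>0. separated_wrt d_log (\<Lambda> - ball 0 r) \<and> separated_wrt dist (\<Lambda> \<inter> ball 0 r))"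

end

theory Submission
  imports Defs "HOL-Complex_Analysis.Complex_Analysis" "HOL-Real_Asymp.Real_Asymp"
begin

text \<open>
  The monomial \<open>z\<^sup>l\<close> lives, in every $\mathcal{F}^p_{\alpha+}$, near
  $\log |z| = (l + 2/p)/(2\alpha)$. Normalising Taylor coefficients accordingly,
  $b_l = a_l e^{(l + 2/p)^2/(4\alpha)}$, identifies $\mathcal{F}^p_{\alpha+}$ with
  $\ell^p(\mathbf{N}_0)$ for all $p$ at once, and up to bounded row factors the restriction operator
  becomes a matrix whose entries have modulus $e^{-(l - \tau_k)^2/(4\alpha)}$, where
  $\tau_k = 2\alpha \log|\lambda_k| - 2/p = k + \delta_k$. Exponential off-diagonal decay makes
  everything else independent of $p$.

  Sufficiency: the inverse of a finite section consists of the normalised coefficients of Lagrange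
  polynomials. A Cauchy estimate on $\log|z| = j/(2\alpha)$ bounds the entry $(j,k)$ by the
  exponential of $-|j-k|$ plus or minus $2\sum\delta_i$ over the indices between $j$ and $k$ (times
  $1/(4\alpha)$), and condition (iii) makes this decay exponentially, uniformly in the section.

  Necessity: the functions dual to the nodes have uniformly bounded coefficients, which forces
  separation. Conjugating with exponential weights shows that these coefficients even decay
  exponentially away from $\tau_k$. Counting dimensions then gives $\delta \in \ell^\infty$. The upper
  bound for the averages comes from expanding $\prod_{i<m}(z - \lambda_i)$ in the dual system, the
  lower one from dividing a dual function by such a product; both use the maximum principle.
\<close>

section \<open>Bounds in sequence spaces\<close>

text \<open>For p < 1 the spaces are only quasi-normed, so duality and interpolation of operators
  are not at hand. Every operator is instead bounded entrywise by a kernel exp (- s |x k - y l|),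
  and \<open>lp_bound_exp_kernel\<close> turns that into l^p bounds for all p. The constants come
  from completing a square: with \<beta> = 1 / (4\<alpha>) and q = 2/p, the weighted monomial z^l at
  log |z| = 2\<beta>(x + q) is exp (- \<beta> (l - x)^2) up to factors independent of l. The 1/2 in
  (iii) is the gap between a sum and an integral: 2 (0 + ... + (m - 1)) is m^2 - m, and the linear
  term is all the room that the sums of \<delta> may use. The strict margin \<epsilon> and the decay
  rate of the inverse matrix produce each other: a margin \<epsilon> gives decay at rate 2 \<beta>
  \<epsilon>, and a decay rate of the dual functions returns, divided by a multiple of \<beta>, as a
  margin for the averages. Conditions on windows of length N and on sums over all intervals are
  traded for each other at the cost of an additive constant or of half the margin.\<close>

definition lp_bound :: "ennreal \<Rightarrow> real \<Rightarrow> (nat \<Rightarrow> real) \<Rightarrow> bool" where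
  "lp_bound p M u \<longleftrightarrow> (if p = \<infinity> then \<forall>k. u k \<le> M
     else \<forall>n. (\<Sum>k<n. u k powr enn2real p) \<le> M powr enn2real p)"

lemma enn2real_pos:
  assumes "0 < p" "p \<noteq> (\<infinity>::ennreal)"
  shows "0 < enn2real p"
  using assms by (simp add: enn2real_positive_iff less_top)

text \<open>Membership and norm bound are merged into one inequality between partial sums. No
  convergence has to be tracked then, and monotonicity, scaling and kernel estimates treat p < 1 and
  p >= 1 alike.\<close>

lemma lp_bound_iff:
  fixes c :: "nat \<Rightarrow> complex"
  assumes "0 < p" "0 \<le> M"
  shows "c \<in> lp_space p UNIV \<and> lp_norm p UNIV c \<le> M \<longleftrightarrow> lp_bound p M (\<lambda>k. cmod (c k))"
proof (cases "p = \<infinity>")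
  case True
  have "c \<in> lp_space p UNIV \<and> lp_norm p UNIV c \<le> M \<longleftrightarrow>
      bdd_above (insert 0 (range (\<lambda>x. cmod (c x)))) \<and> Sup (insert 0 (range (\<lambda>x. cmod (c x)))) \<le> M"
    unfolding lp_space_def lp_norm_def using True by simp
  also have "\<dots> \<longleftrightarrow> (\<forall>k. cmod (c k) \<le> M)"
  proof
    assume *: "bdd_above (insert 0 (range (\<lambda>x. cmod (c x)))) \<and> Sup (insert 0 (range (\<lambda>x. cmod (c x)))) \<le> M"
    show "\<forall>k. cmod (c k) \<le> M"
    proof
      fix k
      have "cmod (c k) \<le> Sup (insert 0 (range (\<lambda>x. cmod (c x))))"
        using * by (intro cSup_upper) auto
      then show "cmod (c k) \<le> M" using * by linarith
    qed
  next
    assume *: "\<forall>k. cmod (c k) \<le> M"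
    then have "bdd_above (insert 0 (range (\<lambda>x. cmod (c x))))" by (intro bdd_aboveI[of _ M]) (auto simp: assms)
    moreover have "Sup (insert 0 (range (\<lambda>x. cmod (c x)))) \<le> M"
      using * assms by (intro cSup_least) auto
    ultimately show "bdd_above (insert 0 (range (\<lambda>x. cmod (c x)))) \<and> Sup (insert 0 (range (\<lambda>x. cmod (c x)))) \<le> M" by simp
  qed
  finally show ?thesis using True by (simp add: lp_bound_def)
next
  case False
  define P where "P = enn2real p"
  have P: "P > 0" unfolding P_def using enn2real_pos[OF assms(1) False] .
  let ?u = "\<lambda>k. cmod (c k) powr P"
  have 1: "c \<in> lp_space p UNIV \<longleftrightarrow> summable ?u"
    using False by (simp add: lp_space_def P_def summable_on_UNIV_nonneg_real_iff)
  have 2: "lp_norm p UNIV c = (\<Sum>k. ?u k) powr (1/P)" if "summable ?u"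
  proof -
    have "?u summable_on UNIV" using that by (simp add: summable_on_UNIV_nonneg_real_iff)
    then have "infsum ?u UNIV = (\<Sum>k. ?u k)"
      using that
      by (metis has_sum_imp_sums has_sum_infsum sums_unique)
    then show ?thesis using False by (simp add: lp_norm_def P_def)
  qed
  have 3: "(\<Sum>k. ?u k) powr (1/P) \<le> M \<longleftrightarrow> (\<Sum>k. ?u k) \<le> M powr P" if "summable ?u"
  proof -
    have nn: "(\<Sum>k. ?u k) \<ge> 0" by (intro suminf_nonneg that) auto
    have "(\<Sum>k. ?u k) powr (1/P) \<le> M \<longleftrightarrow> ((\<Sum>k. ?u k) powr (1/P)) powr P \<le> M powr P"
      using P assms(2) powr_mono2[of P "(\<Sum>k. ?u k) powr (1/P)" M]
        powr_less_mono2[of P M "(\<Sum>k. ?u k) powr (1/P)"] by (auto simp: not_le[symmetric])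
    also have "((\<Sum>k. ?u k) powr (1/P)) powr P = (\<Sum>k. ?u k)"
      using P nn by (simp add: powr_powr)
    finally show ?thesis .
  qed
  show ?thesis
  proof
    assume *: "c \<in> lp_space p UNIV \<and> lp_norm p UNIV c \<le> M"
    then have s: "summable ?u" and "(\<Sum>k. ?u k) \<le> M powr P" using 1 2 3 by auto
    then have "(\<Sum>k<n. ?u k) \<le> M powr P" for n
      using sum_le_suminf[OF s, of "{..<n}"] by (meson finite_lessThan order_trans powr_ge_zero)
    then show "lp_bound p M (\<lambda>k. cmod (c k))" using False by (simp add: lp_bound_def P_def)
  next
    assume "lp_bound p M (\<lambda>k. cmod (c k))"
    then have *: "(\<Sum>k<n. ?u k) \<le> M powr P" for n using False by (simp add: lp_bound_def P_def)
    have s: "summable ?u" by (rule summableI_nonneg_bounded[of _ "M powr P"]) (use * in auto)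
    have "(\<Sum>k. ?u k) \<le> M powr P" by (rule suminf_le_const[OF s]) (use * in auto)
    then show "c \<in> lp_space p UNIV \<and> lp_norm p UNIV c \<le> M" using 1 2 3 s by auto
  qed
qed

lemma lp_norm_nonneg: "0 \<le> lp_norm p I c" if "c \<in> lp_space p I"
proof (cases "p = \<infinity>")
  case True
  then show ?thesis using that unfolding lp_norm_def lp_space_def
    by (auto intro!: cSup_upper)
qed (simp add: lp_norm_def)

lemma lp_boundI:
  fixes c :: "nat \<Rightarrow> complex"
  assumes "0 < p" "c \<in> lp_space p UNIV"
  shows "lp_bound p (lp_norm p UNIV c) (\<lambda>k. cmod (c k))"
  using lp_bound_iff[OF assms(1) lp_norm_nonneg[OF assms(2)]] assms(2) by blast

lemma lp_bound_component:
  assumes "0 < p" "lp_bound p M u" "0 \<le> M" "0 \<le> u k"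
  shows "u k \<le> M"
proof (cases "p = \<infinity>")
  case False
  define P where "P = enn2real p"
  have P: "P > 0" unfolding P_def using enn2real_pos[OF assms(1) False] .
  have "u k powr P \<le> (\<Sum>k<Suc k. u k powr P)" by (simp add: sum_nonneg)
  also have "\<dots> \<le> M powr P" using assms(2) False by (simp only: lp_bound_def P_def if_False)
  finally show ?thesis using P assms by (metis linorder_not_less powr_less_mono2)
qed (use assms in \<open>auto simp: lp_bound_def\<close>)

lemma lp_bound_mono:
  assumes "0 < p" "lp_bound p M v" "\<And>k. 0 \<le> u k" "\<And>k. u k \<le> v k" "0 \<le> M" "M \<le> N"
  shows "lp_bound p N u"
proof (cases "p = \<infinity>")
  case False
  define P where "P = enn2real p"
  have P: "P > 0" unfolding P_def using enn2real_pos[OF assms(1) False] .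
  have "(\<Sum>k<n. u k powr P) \<le> N powr P" for n
  proof -
    have "(\<Sum>k<n. u k powr P) \<le> (\<Sum>k<n. v k powr P)"
      using P assms by (intro sum_mono powr_mono2) auto
    also have "\<dots> \<le> M powr P" using assms False by (auto simp: lp_bound_def P_def)
    also have "\<dots> \<le> N powr P" using P assms by (intro powr_mono2) auto
    finally show ?thesis .
  qed
  then show ?thesis using False by (auto simp: lp_bound_def P_def)
next
  case True
  then show ?thesis using assms(2) order_trans[OF assms(4) order_trans[OF _ assms(6)]]
    by (simp add: lp_bound_def)
qed

lemma lp_bound_scale:
  assumes "0 < p" "lp_bound p M u" "\<And>k. 0 \<le> u k" "0 \<le> a" "0 \<le> M"
  shows "lp_bound p (a * M) (\<lambda>k. a * u k)"
proof (cases "p = \<infinity>")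
  case False
  then show ?thesis using assms
    by (auto simp: lp_bound_def powr_mult sum_distrib_left[symmetric] intro: mult_left_mono)
qed (use assms in \<open>auto simp: lp_bound_def intro: mult_left_mono\<close>)

text \<open>For p < 1 the triangle inequality fails, and \<open>K\<close> is a quasi-norm constant.
  Estimating u + v by twice the maximum yields one that serves all finite p without distinguishing p
  < 1 from p >= 1.\<close>

lemma lp_bound_add:
  assumes "0 < p"
  obtains K where "0 < K" and "\<And>u v M N. \<lbrakk>lp_bound p M u; lp_bound p N v; \<And>k. 0 \<le> u k; \<And>k. 0 \<le> v k;
     0 \<le> M; 0 \<le> N\<rbrakk> \<Longrightarrow> lp_bound p (K * (M + N)) (\<lambda>k. u k + v k)"
proof (cases "p = \<infinity>")
  case True
  show ?thesis
    by (rule that[of 1]) (auto simp: lp_bound_def True intro: add_mono)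
next
  case False
  define P where "P = enn2real p"
  have P: "P > 0" unfolding P_def using enn2real_pos[OF assms(1) False] .
  show ?thesis
  proof (rule that[of "2 * 2 powr (1/P)"])
    fix u v M N assume a: "lp_bound p M u" "lp_bound p N v" "\<And>k. 0 \<le> u k" "\<And>k. 0 \<le> v k"
      "0 \<le> M" "0 \<le> N"
    have "(\<Sum>k<n. (u k + v k) powr P) \<le> (2 * 2 powr (1/P) * (M + N)) powr P" for n
    proof -
      have "(u k + v k) powr P \<le> 2 powr P * (u k powr P + v k powr P)" for k
      proof -
        have "(u k + v k) powr P \<le> (2 * max (u k) (v k)) powr P"
          using a P by (intro powr_mono2) auto
        also have "\<dots> = 2 powr P * (max (u k) (v k)) powr P" using a by (simp add: powr_mult)
        also have "\<dots> \<le> 2 powr P * (u k powr P + v k powr P)"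
          by (intro mult_left_mono) (auto simp: max_def)
        finally show ?thesis .
      qed
      then have "(\<Sum>k<n. (u k + v k) powr P) \<le> (\<Sum>k<n. 2 powr P * (u k powr P + v k powr P))"
        by (intro sum_mono)
      also have "\<dots> = 2 powr P * ((\<Sum>k<n. u k powr P) + (\<Sum>k<n. v k powr P))"
        by (simp only: sum_distrib_left[symmetric] sum.distrib)
      also have "\<dots> \<le> 2 powr P * (M powr P + N powr P)"
        using a False by (intro mult_left_mono add_mono) (auto simp: lp_bound_def P_def)
      also have "\<dots> \<le> 2 powr P * ((M + N) powr P + (M+N) powr P)"
        using a P by (intro mult_left_mono add_mono powr_mono2) auto
      also have "\<dots> = (2 * 2 powr (1/P) * (M + N)) powr P"
        using a P by (simp add: powr_mult powr_powr)
      finally show ?thesis .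
    qed
    then show "lp_bound p (2 * 2 powr (1/P) * (M + N)) (\<lambda>k. u k + v k)"
      using False by (auto simp: lp_bound_def P_def)
  qed auto
qed

lemma lp_bound_unit: "0 < p \<Longrightarrow> lp_bound p 1 (\<lambda>k. if k = i then 1 else 0)"
  by (simp add: lp_bound_def if_distrib[of "\<lambda>x. x powr _"] cong: if_cong)

lemma lp_bound_finite_support:
  fixes u :: "nat \<Rightarrow> real"
  assumes "0 < p" "\<And>l. 0 \<le> u l" "\<And>l. l \<ge> n \<Longrightarrow> u l = 0"
  shows "\<exists>M\<ge>0. lp_bound p M u"
proof (cases "p = \<infinity>")
  case True
  have "u l \<le> (\<Sum>l<n. u l)" for l
  proof (cases "l < n")
    case True
    then show ?thesis using assms(2) by (intro member_le_sum) auto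
  qed (use assms in \<open>auto simp: sum_nonneg\<close>)
  then show ?thesis using True assms(2) by (intro exI[of _ "\<Sum>l<n. u l"]) (auto simp: lp_bound_def sum_nonneg)
next
  case False
  define P where "P = enn2real p"
  have P: "P > 0" unfolding P_def using enn2real_pos[OF assms(1) False] .
  define T where "T = (\<Sum>l<n. u l powr P)"
  have T0: "T \<ge> 0" by (simp add: T_def sum_nonneg)
  have "(\<Sum>k<N. u k powr P) \<le> T" for N
  proof -
    have "(\<Sum>k<N. u k powr P) \<le> (\<Sum>k<N+n. u k powr P)" by (rule sum_mono2) auto
    also have "\<dots> = T" unfolding T_def by (rule sum.mono_neutral_right) (use assms(3) in auto)
    finally show ?thesis .
  qed
  then have "lp_bound p (T powr (1/P)) u"
    using False P T0 by (simp add: lp_bound_def P_def[symmetric] powr_powr)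
  then show ?thesis by (intro exI[of _ "T powr (1/P)"]) simp
qed

text \<open>For increasing sequences this says that unit intervals contain a bounded number of terms.\<close>

definition spread :: "(nat \<Rightarrow> real) \<Rightarrow> bool" where
  "spread x \<longleftrightarrow> (\<exists>\<kappa>>0. \<exists>C. \<forall>i j. i \<le> j \<longrightarrow> \<kappa> * (real j - real i) - C \<le> x j - x i)"

lemma spread_real: "spread real"
  unfolding spread_def by (rule exI[of _ 1]) (auto intro!: exI[of _ 0])

lemma spread_bounded_diff:
  assumes "\<And>k. \<bar>x k - real k\<bar> \<le> K"
  shows "spread x"
  unfolding spread_def
proof (rule exI[of _ 1], intro exI[of _ "2*K"] conjI allI impI)
  fix i j :: nat assume "i \<le> j"
  show "1 * (real j - real i) - 2 * K \<le> x j - x i"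
    using assms[of i] assms[of j] unfolding abs_le_iff by simp
qed auto

lemma sum_geometric_dist:
  fixes m n :: nat
  assumes "0 < s"
  shows "(\<Sum>k<n. exp (- s * \<bar>real k - real m\<bar>)) \<le> 2 / (1 - exp (- s))"
proof -
  define r where "r = exp (-s)"
  have r: "0 < r" "r < 1" using assms by (auto simp: r_def)
  have e: "exp (- s * real j) = r ^ j" for j unfolding r_def by (metis exp_of_nat2_mult mult.commute)
  have g: "(\<Sum>k<j. r ^ k) \<le> 1/(1-r)" for j
    using sum_le_suminf[of "\<lambda>k. r^k" "{..<j}"] r by (simp add: suminf_geometric summable_geometric)
  have "(\<Sum>k<n. exp (- s * \<bar>real k - real m\<bar>)) \<le> (\<Sum>k<m+n. exp (- s * \<bar>real k - real m\<bar>))"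
    by (rule sum_mono2) auto
  also have "\<dots> = (\<Sum>k<m. exp (- s * \<bar>real k - real m\<bar>)) + (\<Sum>k=m..<m+n. exp (- s * \<bar>real k - real m\<bar>))"
    by (metis atLeast0LessThan le_add1 sum.atLeastLessThan_concat zero_le)
  also have "(\<Sum>k<m. exp (- s * \<bar>real k - real m\<bar>)) = (\<Sum>k<m. r ^ (m - k))"
    by (intro sum.cong refl) (auto simp: e[symmetric] of_nat_diff abs_if)
  also have "\<dots> = (\<Sum>k<m. r ^ Suc k)"
    by (subst sum.nat_diff_reindex[symmetric]) (auto intro!: sum.cong simp del: power_Suc)
  also have "\<dots> \<le> (\<Sum>k<m. r ^ k)"
    using r by (intro sum_mono) (auto intro: mult_left_le_one_le)
  also have "(\<Sum>k=m..<m+n. exp (- s * \<bar>real k - real m\<bar>)) = (\<Sum>k<n. r ^ k)"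
    by (subst sum.atLeastLessThan_shift_0) (auto simp: e[symmetric] atLeast0LessThan)
  finally show ?thesis using g[of m] g[of n] by (simp add: r_def)
qed

lemma spread_exp_sum_finite:
  assumes "spread x" "0 < s"
  obtains K where "0 < K" "\<And>t n. (\<Sum>k<n. exp (- s * \<bar>x k - t\<bar>)) \<le> K"
proof -
  obtain \<kappa> C where \<kappa>: "\<kappa> > 0" and x: "\<And>i j. i \<le> j \<Longrightarrow> \<kappa> * (real j - real i) - C \<le> x j - x i"
    using assms(1) unfolding spread_def by blast
  have C: "C \<ge> 0" using x[of 0 0] by simp
  define K where "K = exp (s * (C + \<kappa>)) * (2 / (1 - exp (- (s * \<kappa>))))"
  have sk: "s * \<kappa> > 0" using assms(2) \<kappa> by simp
  have K: "K > 0" unfolding K_def using sk by simp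
  have b: "(\<Sum>k<n. exp (- s * \<bar>x k - t\<bar>)) \<le> K" for t n
  proof -
    have ex: "\<exists>k. x k \<ge> t"
    proof -
      obtain k :: nat where "real k > (t + C - x 0)/\<kappa>" using reals_Archimedean2 by blast
      then have "\<kappa> * real k > t + C - x 0" using \<kappa> by (simp add: field_simps)
      then show ?thesis using x[OF le0, of k] by (intro exI[of _ k]) simp
    qed
    define m where "m = (LEAST k. x k \<ge> t)"
    have m: "x m \<ge> t" unfolding m_def by (rule LeastI_ex[OF ex])
    have m': "x k < t" if "k < m" for k
    proof -
      have "\<not> x k \<ge> t" using that not_less_Least unfolding m_def by blast
      then show ?thesis by linarith
    qed
    have "exp (- s * \<bar>x k - t\<bar>) \<le> exp (s * (C + \<kappa>)) * exp (- (s*\<kappa>) * \<bar>real k - real m\<bar>)" for k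
    proof -
      \<comment> \<open>\<open>m\<close> is the first index with \<open>x m \<ge> t\<close>. From
        \<open>m\<close> on, \<open>x\<close> grows at rate \<kappa>; below \<open>m\<close> the
        comparison is with \<open>x (m - 1) < t\<close>, and that one step costs the additional
        \<kappa>.\<close>
      have "\<kappa> * \<bar>real k - real m\<bar> - (C + \<kappa>) \<le> \<bar>x k - t\<bar>"
      proof (cases "k < m")
        case True
        then have "x (m - 1) < t" using m' by simp
        moreover have "\<kappa> * (real (m-1) - real k) - C \<le> x (m-1) - x k" using True by (intro x) simp
        moreover have "real (m - 1) = real m - 1" using True by simp
        moreover have "\<bar>real k - real m\<bar> = real m - real k" using True by simp
        ultimately show ?thesis by (simp add: algebra_simps)
      next
        case False
        then show ?thesis using x[of m k] m \<kappa> by simp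
      qed
      then have "s * (\<kappa> * \<bar>real k - real m\<bar> - (C + \<kappa>)) \<le> s * \<bar>x k - t\<bar>" using assms(2) by simp
      then show ?thesis by (simp add: exp_add[symmetric] algebra_simps)
    qed
    then have "(\<Sum>k<n. exp (- s * \<bar>x k - t\<bar>)) \<le>
       (\<Sum>k<n. exp (s * (C + \<kappa>)) * exp (- (s*\<kappa>) * \<bar>real k - real m\<bar>))"
      by (intro sum_mono)
    also have "\<dots> = exp (s * (C + \<kappa>)) * (\<Sum>k<n. exp (- (s*\<kappa>) * \<bar>real k - real m\<bar>))"
      by (simp add: sum_distrib_left)
    also have "\<dots> \<le> K" unfolding K_def
      by (intro mult_left_mono sum_geometric_dist sk) auto
    finally show ?thesis .
  qed
  show ?thesis by (rule that[OF K b])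
qed

lemma spread_exp_summable:
  assumes "spread x" "0 < s"
  shows "summable (\<lambda>k. exp (- s * \<bar>x k - t\<bar>))"
proof -
  obtain K where K: "\<And>t n. (\<Sum>k<n. exp (- s * \<bar>x k - t\<bar>)) \<le> K"
    using spread_exp_sum_finite[OF assms] by metis
  show ?thesis by (rule summableI_nonneg_bounded[OF _ K]) simp
qed

lemma spread_exp_sum:
  assumes "spread x" "0 < s"
  obtains K where "0 < K" "\<And>t. (\<Sum>k. exp (- s * \<bar>x k - t\<bar>)) \<le> K"
proof -
  obtain K where K: "K > 0" "\<And>t n. (\<Sum>k<n. exp (- s * \<bar>x k - t\<bar>)) \<le> K"
    using spread_exp_sum_finite[OF assms] by metis
  show ?thesis
    by (rule that[OF K(1) suminf_le_const[OF spread_exp_summable[OF assms] K(2)]])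
qed

text \<open>
  All exponents are treated at once by writing
  $\sum_l e^{-s d_l} u_l \le (\sum_l e^{-s d_l/2}) \sup_l e^{-s d_l/2} u_l$ and bounding the
  supremum by the corresponding $\ell^p$ sum.
\<close>

lemma lp_bound_exp_kernel:
  assumes "0 < p" "spread x" "spread y" "0 < s"
  obtains C where "0 < C" and "\<And>u v M \<eta>. \<lbrakk>lp_bound p M u; \<And>k. 0 \<le> u k; \<And>k. 0 \<le> v k; 0 \<le> M; 0 \<le> \<eta>;
     \<And>k. v k \<le> \<eta> * (\<Sum>l. exp (- s * \<bar>x k - y l\<bar>) * u l)\<rbrakk> \<Longrightarrow> lp_bound p (\<eta> * C * M) v"
proof -
  have sum_u: "summable (\<lambda>l. exp (- s * \<bar>x k - y l\<bar>) * u l)"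
      "(\<Sum>l. exp (- s * \<bar>x k - y l\<bar>) * u l) \<le> (\<Sum>l. exp (- s * \<bar>x k - y l\<bar>)) * B"
    if "\<And>l. 0 \<le> u l" "\<And>l. u l \<le> B" "s > 0" for u B k s
  proof -
    have K': "summable (\<lambda>l. exp (- s * \<bar>x k - y l\<bar>))"
      using spread_exp_summable[OF assms(3) \<open>s>0\<close>, of "x k"] by (simp add: abs_minus_commute)
    have K2: "summable (\<lambda>l. exp (- s * \<bar>x k - y l\<bar>) * B)" by (rule summable_mult2[OF K'])
    show 1: "summable (\<lambda>l. exp (- s * \<bar>x k - y l\<bar>) * u l)"
      by (rule summable_comparison_test_ev[OF _ K2]) (use that in \<open>simp add: always_eventually\<close>)
    have "(\<Sum>l. exp (- s * \<bar>x k - y l\<bar>) * u l) \<le> (\<Sum>l. exp (- s * \<bar>x k - y l\<bar>) * B)"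
      using that by (intro suminf_le 1 K2 mult_left_mono) auto
    then show "(\<Sum>l. exp (- s * \<bar>x k - y l\<bar>) * u l) \<le> (\<Sum>l. exp (- s * \<bar>x k - y l\<bar>)) * B"
      using suminf_mult2[OF K', of B] by simp
  qed
  obtain K0 where K0: "0 < K0" "\<And>t. (\<Sum>l. exp (- (s/2) * \<bar>y l - t\<bar>)) \<le> K0"
    using spread_exp_sum[OF assms(3), of "s/2"] assms(4) by (metis half_gt_zero)
  obtain K0' where K0': "0 < K0'" "\<And>t. (\<Sum>l. exp (- s * \<bar>y l - t\<bar>)) \<le> K0'"
    using spread_exp_sum[OF assms(3,4)] by metis
  show ?thesis
  proof (cases "p = \<infinity>")
    case True
    show ?thesis
    proof (rule that[OF K0'(1)])
      fix u v M \<eta> assume a: "lp_bound p M u" "\<And>k. 0 \<le> u k" "\<And>k. 0 \<le> v k" "0 \<le> M" "0 \<le> \<eta>"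
        "\<And>k. v k \<le> \<eta> * (\<Sum>l. exp (- s * \<bar>x k - y l\<bar>) * u l)"
      have u: "u l \<le> M" for l using lp_bound_component[OF assms(1) a(1,4) a(2)] .
      have "v k \<le> \<eta> * K0' * M" for k
      proof -
        have "v k \<le> \<eta> * (\<Sum>l. exp (- s * \<bar>x k - y l\<bar>) * u l)" by (rule a(6))
        also have "\<dots> \<le> \<eta> * ((\<Sum>l. exp (- s * \<bar>x k - y l\<bar>)) * M)"
          using sum_u(2)[of u M s k] a u assms(4) by (intro mult_left_mono) auto
        also have "\<dots> \<le> \<eta> * (K0' * M)" using K0'(2)[of "x k"] a
          by (intro mult_left_mono mult_right_mono) (auto simp: abs_minus_commute)
        finally show ?thesis by simp
      qed
      then show "lp_bound p (\<eta> * K0' * M) v" using True by (simp add: lp_bound_def)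
    qed
  next
    case False
    define P where "P = enn2real p"
    have P: "P > 0" unfolding P_def using enn2real_pos[OF assms(1) False] .
    have sP: "s/2*P > 0" using P assms(4) by simp
    obtain K1 where K1: "0 < K1" "\<And>t n. (\<Sum>k<n. exp (- (s/2*P) * \<bar>x k - t\<bar>)) \<le> K1"
      using spread_exp_sum_finite[OF assms(2) sP] by metis
    show ?thesis
    proof (rule that[of "K0 * K1 powr (1/P)"])
      fix u v M \<eta> assume a: "lp_bound p M u" "\<And>k. 0 \<le> u k" "\<And>k. 0 \<le> v k" "0 \<le> M" "0 \<le> \<eta>"
        "\<And>k. v k \<le> \<eta> * (\<Sum>l. exp (- s * \<bar>x k - y l\<bar>) * u l)"
      have u: "u l \<le> M" for l using lp_bound_component[OF assms(1) a(1,4) a(2)] .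
      have uP: "u l powr P \<le> M powr P" for l using a u P by (intro powr_mono2) auto
      have upart: "(\<Sum>l<n. u l powr P) \<le> M powr P" for n
        using a(1) False by (auto simp: lp_bound_def P_def)
      have us: "summable (\<lambda>l. u l powr P)"
        by (rule summableI_nonneg_bounded[of _ "M powr P"]) (use upart in auto)
      have us_le: "(\<Sum>l. u l powr P) \<le> M powr P" by (rule suminf_le_const[OF us]) (use upart in auto)
      define U where "U k = (\<Sum>l. exp (- (s/2*P) * \<bar>x k - y l\<bar>) * u l powr P)" for k
      have Us: "summable (\<lambda>l. exp (- (s/2*P) * \<bar>x k - y l\<bar>) * u l powr P)" for k
        by (rule sum_u(1)[of _ "M powr P"]) (use uP sP in auto)
      have U0: "U k \<ge> 0" for k unfolding U_def by (intro suminf_nonneg Us) auto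
      have v: "v k powr P \<le> (\<eta> * K0) powr P * U k" for k
      proof -
        have c: "exp (- (s/2) * \<bar>x k - y l\<bar>) * u l \<le> U k powr (1/P)" for l
        proof -
          have "exp (- (s/2*P) * \<bar>x k - y l\<bar>) * u l powr P \<le> U k"
            unfolding U_def using sum_le_suminf[OF Us, of "{l}" k] by simp
          then have "(exp (- (s/2*P) * \<bar>x k - y l\<bar>) * u l powr P) powr (1/P) \<le> U k powr (1/P)"
            using P by (intro powr_mono2) auto
          moreover have "(exp (- (s/2*P) * \<bar>x k - y l\<bar>) * u l powr P) powr (1/P)
              = exp (- (s/2) * \<bar>x k - y l\<bar>) * u l"
            using P a(2)[of l] by (simp add: powr_mult powr_powr exp_powr_real)
          ultimately show ?thesis by simp
        qed
        have eq: "exp (- s * \<bar>x k - y l\<bar>) * u l =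
            exp (- (s/2) * \<bar>x k - y l\<bar>) * (exp (- (s/2) * \<bar>x k - y l\<bar>) * u l)" for l
          by (simp add: exp_add[symmetric] mult.assoc[symmetric])
        have "v k \<le> \<eta> * (\<Sum>l. exp (- s * \<bar>x k - y l\<bar>) * u l)" by (rule a(6))
        also have "\<dots> \<le> \<eta> * ((\<Sum>l. exp (- (s/2) * \<bar>x k - y l\<bar>)) * U k powr (1/P))"
          unfolding eq using c a assms(4)
          by (intro mult_left_mono sum_u(2)) auto
        also have "\<dots> \<le> \<eta> * (K0 * U k powr (1/P))" using K0(2)[of "x k"] a
          by (intro mult_left_mono mult_right_mono) (auto simp: abs_minus_commute)
        finally have "v k powr P \<le> (\<eta> * (K0 * U k powr (1/P))) powr P"
          using a P by (intro powr_mono2) auto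
        also have "\<dots> = (\<eta> * K0) powr P * U k" using a K0 P U0[of k]
          by (simp add: powr_mult powr_powr)
        finally show ?thesis .
      qed
      have "(\<Sum>k<n. v k powr P) \<le> (\<eta> * (K0 * K1 powr (1/P)) * M) powr P" for n
      proof -
        \<comment> \<open>Exchanging the sums leaves column sums of the kernel, which are at most
          \<open>K1\<close> because \<open>x\<close> is spread; the row sums were bounded through
          \<open>y\<close>.\<close>
        have "(\<Sum>k<n. U k) = (\<Sum>l. \<Sum>k<n. exp (- (s/2*P) * \<bar>x k - y l\<bar>) * u l powr P)"
          unfolding U_def by (rule suminf_sum[symmetric]) (rule Us)
        also have "\<dots> = (\<Sum>l. (\<Sum>k<n. exp (- (s/2*P) * \<bar>x k - y l\<bar>)) * u l powr P)"
          by (simp add: sum_distrib_right)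
        also have "\<dots> \<le> (\<Sum>l. K1 * u l powr P)"
        proof (rule suminf_le)
          show le: "(\<Sum>k<n. exp (- (s/2*P) * \<bar>x k - y l\<bar>)) * u l powr P \<le> K1 * u l powr P" for l
            by (intro mult_right_mono K1) auto
          show "summable (\<lambda>l. K1 * u l powr P)" by (intro summable_mult us)
          then show "summable (\<lambda>l. (\<Sum>k<n. exp (- (s/2*P) * \<bar>x k - y l\<bar>)) * u l powr P)"
            by (rule summable_comparison_test_ev[rotated])
               (use le in \<open>auto intro!: always_eventually simp: sum_nonneg\<close>)
        qed
        also have "\<dots> = K1 * (\<Sum>l. u l powr P)" by (rule suminf_mult[OF us])
        also have "\<dots> \<le> K1 * M powr P" using us_le K1 by (intro mult_left_mono) auto
        finally have U: "(\<Sum>k<n. U k) \<le> K1 * M powr P" .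
        have "(\<Sum>k<n. v k powr P) \<le> (\<Sum>k<n. (\<eta> * K0) powr P * U k)" by (intro sum_mono v)
        also have "\<dots> = (\<eta> * K0) powr P * (\<Sum>k<n. U k)" by (simp add: sum_distrib_left)
        also have "\<dots> \<le> (\<eta> * K0) powr P * (K1 * M powr P)" using U by (intro mult_left_mono) auto
        also have "\<dots> = (\<eta> * (K0 * K1 powr (1/P)) * M) powr P" using a K0 K1 P
          by (simp add: powr_mult powr_powr)
        finally show ?thesis .
      qed
      then show "lp_bound p (\<eta> * (K0 * K1 powr (1/P)) * M) v" using False by (auto simp: lp_bound_def P_def)
    qed (use K0 K1 in auto)
  qed
qed

section \<open>Taylor coefficients of functions in the Fock space\<close>

text \<open>Completing the square in |y|. Since \<open>s\<close> is free, a Gaussian entry decays at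
  any exponential rate, at the price of a constant; larger rates are chosen where an exponential
  weight has to be absorbed.\<close>

lemma gauss_le:
  fixes y :: real
  assumes "0 < \<beta>"
  shows "exp (- \<beta> * y\<^sup>2) \<le> exp (s\<^sup>2 / (4 * \<beta>)) * exp (- s * \<bar>y\<bar>)"
proof -
  have "0 \<le> \<beta> * (\<bar>y\<bar> - s / (2*\<beta>))\<^sup>2" using assms by simp
  also have "\<dots> = \<beta> * y\<^sup>2 - s * \<bar>y\<bar> + s\<^sup>2 / (4 * \<beta>)"
    using assms by (simp add: power2_diff power_divide field_simps) (simp add: power2_eq_square)
  finally show ?thesis by (simp add: exp_add[symmetric])
qed

text \<open>This plays the role of the area mean value inequality for |g|^P, for every P > 0: the
  integral of |g|^P over the disc is at least the area of the subdisc times A^P. The subdisc is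
  found by maximising a power of the distance to the boundary times |g|. Near the maximiser |g|
  cannot exceed its value there by more than a fixed factor, so Cauchy's estimate for the derivative
  keeps it from dropping fast.\<close>

lemma large_subdisc:
  fixes P :: real
  assumes "0 < P"
  obtains K where "0 < K" and "\<And>g S z0 R. \<lbrakk>g holomorphic_on S; open S; cball z0 R \<subseteq> S; 0 < R\<rbrakk> \<Longrightarrow>
    \<exists>z1 \<rho> A. 0 < \<rho> \<and> 0 \<le> A \<and> ball z1 \<rho> \<subseteq> ball z0 R \<and> (\<forall>z\<in>ball z1 \<rho>. A \<le> cmod (g z)) \<and>
      R\<^sup>2 * cmod (g z0) powr P \<le> K * \<rho>\<^sup>2 * A powr P"
proof -
  \<comment> \<open>With s P = 2 the P-th power of \<open>d powr s * cmod (g w)\<close> is d^2 |g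
    w|^P, which scales like an area.\<close>
  define s where "s = 2 / P"
  have s: "s > 0" "s * P = 2" using assms by (auto simp: s_def)
  \<comment> \<open>Chosen so that the derivative bound \<open>B / (d/4)\<close> times the radius
    \<open>d / D\<close> is half of |g w|.\<close>
  define D where "D = 8 * 2 powr s"
  have "1 \<le> 2 powr s" using s by (intro ge_one_powr_ge_zero) auto
  then have D: "D \<ge> 8" unfolding D_def by simp
  define K where "K = D\<^sup>2 * 2 powr P"
  have "\<exists>z1 \<rho> A. 0 < \<rho> \<and> 0 \<le> A \<and> ball z1 \<rho> \<subseteq> ball z0 R \<and> (\<forall>z\<in>ball z1 \<rho>. A \<le> cmod (g z)) \<and>
      R\<^sup>2 * cmod (g z0) powr P \<le> K * \<rho>\<^sup>2 * A powr P"
    if g: "g holomorphic_on S" and S: "open S" "cball z0 R \<subseteq> S" and R: "0 < R" for g S z0 R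
  proof (cases "g z0 = 0")
    case True
    show ?thesis by (rule exI[of _ z0], rule exI[of _ R], rule exI[of _ 0]) (use R True assms in auto)
  next
    case False
    define h where "h z = (R - dist z0 z) powr s * cmod (g z)" for z
    have contg: "continuous_on (cball z0 R) g"
      using g S(2) holomorphic_on_imp_continuous_on holomorphic_on_subset by blast
    have "continuous_on (cball z0 R) h"
      unfolding h_def using s by (intro continuous_intros contg continuous_on_powr') auto
    then obtain w where w: "w \<in> cball z0 R" "\<And>z. z \<in> cball z0 R \<Longrightarrow> h z \<le> h w"
      using continuous_attains_sup[of "cball z0 R" h] R by auto
    define d where "d = R - dist z0 w"
    have h0: "h z0 = R powr s * cmod (g z0)" by (simp add: h_def)
    then have "h z0 > 0" using False R by simp
    then have "h w > 0" using w(2)[of z0] R by simp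
    then have "d \<noteq> 0" by (auto simp: h_def d_def)
    moreover have "d \<ge> 0" using w(1) by (simp add: d_def)
    ultimately have d: "d > 0" by simp
    \<comment> \<open>Points within d/2 of the maximiser \<open>w\<close> are at distance at least
      d/2 from the outer circle, so maximality of \<open>h\<close> costs at most the factor
      \<open>2 powr s\<close>.\<close>
    have gb: "cmod (g z) \<le> 2 powr s * cmod (g w)" if "z \<in> cball w (d/2)" for z
    proof -
      have dz: "R - dist z0 z \<ge> d/2" "d/2 > 0"
        using that d dist_triangle[of z0 z w] unfolding d_def by (auto simp: field_simps)
      then have "h z \<le> h w" by (intro w(2)) auto
      moreover have "(d/2) powr s * cmod (g z) \<le> h z" unfolding h_def
        using dz s by (intro mult_right_mono powr_mono2) auto
      ultimately have "(d/2) powr s * cmod (g z) \<le> d powr s * cmod (g w)"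
        unfolding h_def d_def by simp
      moreover have "d powr s = (d/2) powr s * 2 powr s" using d by (simp add: powr_mult[symmetric])
      ultimately have "(d/2) powr s * cmod (g z) \<le> (d/2) powr s * (2 powr s * cmod (g w))" by simp
      then show ?thesis using d by simp
    qed
    have sub: "cball w (d/2) \<subseteq> cball z0 R"
    proof
      fix z assume "z \<in> cball w (d/2)"
      then show "z \<in> cball z0 R" using d dist_triangle[of z0 z w] unfolding d_def
        by (auto simp: field_simps)
    qed
    define B where "B = 2 powr s * cmod (g w)"
    have derivb: "cmod (deriv g u) \<le> B / (d/4)" if "u \<in> ball w (d/4)" for u
    proof -
      have sb: "cball u (d/4) \<subseteq> cball w (d/2)"
      proof
        fix z assume "z \<in> cball u (d/4)"
        then show "z \<in> cball w (d/2)" using that dist_triangle[of w z u] by (auto simp: field_simps)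
      qed
      have "cmod ((deriv ^^ 1) g u) \<le> fact 1 * B / (d/4) ^ 1"
      proof (rule Cauchy_inequality)
        show "g holomorphic_on ball u (d/4)"
          using sb sub S(2) ball_subset_cball g holomorphic_on_subset by (metis order_trans)
        show "continuous_on (cball u (d/4)) g" using sb sub contg continuous_on_subset by blast
        show "cmod (g x) \<le> B" if "cmod (u - x) = d/4" for x
          unfolding B_def using that sb by (intro gb) (auto simp: dist_norm subset_iff)
      qed (use d in auto)
      then show ?thesis by simp
    qed
    define \<rho> where "\<rho> = d / D"
    have \<rho>: "0 < \<rho>" "\<rho> \<le> d/8" unfolding \<rho>_def using d D by (auto simp: field_simps)
    have low: "cmod (g w) / 2 \<le> cmod (g z)" if "z \<in> ball w \<rho>" for z
    proof -
      have "cmod (g z - g w) \<le> B / (d/4) * cmod (z - w)"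
      proof (rule field_differentiable_bound[where S="ball w (d/4)" and f'="deriv g"])
        fix u assume "u \<in> ball w (d/4)"
        then have "u \<in> cball w (d/2)" using d by auto
        then have "u \<in> S" using sub S by blast
        then show "(g has_field_derivative deriv g u) (at u within ball w (d / 4))"
          using g S(1) holomorphic_derivI by blast
      qed (use derivb that \<rho> d in auto)
      also have "\<dots> \<le> B / (d/4) * \<rho>"
        using that d by (intro mult_left_mono) (auto simp: B_def dist_norm norm_minus_commute)
      also have "\<dots> = cmod (g w) / 2" unfolding B_def \<rho>_def D_def using d by simp
      finally show ?thesis using norm_triangle_ineq2[of "g w" "g w - g z"] by (simp add: norm_minus_commute)
    qed
    have sub2: "ball w \<rho> \<subseteq> ball z0 R"
    proof
      fix z assume "z \<in> ball w \<rho>"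
      then show "z \<in> ball z0 R" using d dist_triangle[of z0 z w] \<rho> unfolding d_def by auto
    qed
    have "R powr s * cmod (g z0) \<le> d powr s * cmod (g w)"
      using w(2)[of z0] R h0 by (simp add: h_def d_def)
    then have "(R powr s * cmod (g z0)) powr P \<le> (d powr s * cmod (g w)) powr P"
      using assms by (intro powr_mono2) auto
    then have "R\<^sup>2 * cmod (g z0) powr P \<le> d\<^sup>2 * cmod (g w) powr P"
      using R d s by (simp add: powr_mult powr_powr)
    also have "\<dots> = K * \<rho>\<^sup>2 * (cmod (g w) / 2) powr P"
      unfolding K_def \<rho>_def using D by (simp add: powr_divide power_divide)
    finally show ?thesis using \<rho> low sub2 by (intro exI[of _ w] exI[of _ \<rho>] exI[of _ "cmod (g w)/2"]) auto
  qed
  moreover have "K > 0" unfolding K_def using D by simp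
  ultimately show ?thesis using that by blast
qed

text \<open>\<open>b\<close> is the coefficient sequence in l^p and \<open>q\<close> = 2/p the shift
  of the peaks of the monomials. The value q = 0 occurs after the dilation in
  \<open>gauss_series_rescale\<close>.\<close>

definition gauss_series :: "real \<Rightarrow> real \<Rightarrow> (nat \<Rightarrow> complex) \<Rightarrow> complex \<Rightarrow> complex" where
  "gauss_series \<beta> q b z = (\<Sum>l. b l * exp (- \<beta> * (real l + q)\<^sup>2) * z ^ l)"

text \<open>Completing the square on the circle log |z| = 2\<beta>(x + q): as a function of l, the
  weighted monomial is a Gaussian centred at x. The matrix entries and the growth estimates below
  come from this identity.\<close>

lemma gauss_monomial:
  "exp (- \<beta> * (real l + q)\<^sup>2) * exp (2 * \<beta> * (x + q)) ^ l =
     exp (\<beta> * (x\<^sup>2 - q\<^sup>2)) * exp (- \<beta> * (real l - x)\<^sup>2)"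
  unfolding exp_of_nat_mult[symmetric] exp_add[symmetric]
  by (simp add: power2_eq_square algebra_simps)

lemma gauss_weight_summable:
  assumes "0 < \<beta>" "0 \<le> r"
  shows "summable (\<lambda>l. exp (- \<beta> * (real l + q)\<^sup>2) * r ^ l)"
proof -
  define x where "x = ln (max 1 r) / (2*\<beta>) - q"
  have r: "r \<le> exp (2 * \<beta> * (x + q))" using assms by (simp add: x_def)
  have "summable (\<lambda>l. exp (\<beta> * (x\<^sup>2 - q\<^sup>2)) * (exp (1\<^sup>2 / (4*\<beta>)) * exp (- 1 * \<bar>real l - x\<bar>)))"
    by (intro summable_mult spread_exp_summable spread_real) simp
  then show ?thesis
  proof (rule summable_comparison_test_ev[rotated], intro always_eventually allI)
    fix l
    have "norm (exp (- \<beta> * (real l + q)\<^sup>2) * r ^ l) \<le> exp (- \<beta> * (real l + q)\<^sup>2) * exp (2 * \<beta> * (x + q)) ^ l"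
      using r assms by (simp add: abs_mult power_mono)
    also have "\<dots> \<le> exp (\<beta> * (x\<^sup>2 - q\<^sup>2)) * (exp (1\<^sup>2 / (4*\<beta>)) * exp (- 1 * \<bar>real l - x\<bar>))"
      unfolding gauss_monomial by (intro mult_left_mono gauss_le assms) auto
    finally show "norm (exp (- \<beta> * (real l + q)\<^sup>2) * r ^ l) \<le>
       exp (\<beta> * (x\<^sup>2 - q\<^sup>2)) * (exp (1\<^sup>2 / (4*\<beta>)) * exp (- 1 * \<bar>real l - x\<bar>))" .
  qed
qed

lemma gauss_series_summable_norm:
  assumes "0 < \<beta>" "\<And>l. cmod (b l) \<le> M"
  shows "summable (\<lambda>l. cmod (b l) * (exp (- \<beta> * (real l + q)\<^sup>2) * cmod z ^ l))"
proof -
  have s: "summable (\<lambda>l. M * (exp (- \<beta> * (real l + q)\<^sup>2) * cmod z ^ l))"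
    by (intro summable_mult gauss_weight_summable assms) simp
  show ?thesis
    by (rule summable_comparison_test_ev[OF _ s])
       (use assms in \<open>auto simp: abs_mult intro!: always_eventually mult_right_mono\<close>)
qed

lemma gauss_series_sums:
  assumes "0 < \<beta>" "\<And>l. cmod (b l) \<le> M"
  shows "(\<lambda>l. b l * exp (- \<beta> * (real l + q)\<^sup>2) * z ^ l) sums gauss_series \<beta> q b z"
    "cmod (gauss_series \<beta> q b z) \<le> (\<Sum>l. cmod (b l) * (exp (- \<beta> * (real l + q)\<^sup>2) * cmod z ^ l))"
proof -
  have eq: "norm (b l * exp (- \<beta> * (real l + q)\<^sup>2) * z ^ l) =
      cmod (b l) * (exp (- \<beta> * (real l + q)\<^sup>2) * cmod z ^ l)" for l
    by (simp add: norm_mult norm_power)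
  have n: "summable (\<lambda>l. norm (b l * exp (- \<beta> * (real l + q)\<^sup>2) * z ^ l))"
    unfolding eq by (rule gauss_series_summable_norm[OF assms])
  show "(\<lambda>l. b l * exp (- \<beta> * (real l + q)\<^sup>2) * z ^ l) sums gauss_series \<beta> q b z"
    unfolding gauss_series_def using summable_norm_cancel[OF n] by (rule summable_sums)
  show "cmod (gauss_series \<beta> q b z) \<le> (\<Sum>l. cmod (b l) * (exp (- \<beta> * (real l + q)\<^sup>2) * cmod z ^ l))"
    using summable_norm[OF n] unfolding gauss_series_def eq .
qed

lemma power_series_entire:
  fixes a :: "nat \<Rightarrow> complex"
  assumes "\<And>z. (\<lambda>l. a l * z ^ l) sums f z"
  shows "f holomorphic_on UNIV" "a k = (deriv ^^ k) f 0 / fact k"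
proof -
  have "f holomorphic_on ball 0 r" for r
    by (rule power_series_holomorphic[of _ _ a]) (use assms in simp)
  then show holo: "f holomorphic_on UNIV"
    by (simp add: holomorphic_on_def) (metis UNIV_I at_within_open centre_in_ball field_differentiable_at_within
        field_differentiable_within_open mem_ball_0 open_ball reals_Archimedean2 norm_ge_zero)
  have "summable (\<lambda>l. a l * 1 ^ l)" using assms[of 1] by (simp add: sums_iff)
  from conv_radius_geI[OF this] have "1 \<le> fps_conv_radius (Abs_fps a)"
    by (simp add: fps_conv_radius_def one_ereal_def)
  moreover have "(0::ereal) < 1" by simp
  ultimately have "fps_conv_radius (Abs_fps a) > 0" by (rule order.strict_trans2[rotated])
  moreover have "eval_fps (Abs_fps a) z = f z" for z
    using assms[of z] by (simp add: eval_fps_def sums_iff)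
  ultimately have "f has_fps_expansion Abs_fps a" by (simp add: has_fps_expansion_def)
  from fps_nth_fps_expansion[OF this, of k] show "a k = (deriv ^^ k) f 0 / fact k" by simp
qed

lemma gauss_series_entire:
  assumes "0 < \<beta>" "\<And>l. cmod (b l) \<le> M"
  shows "gauss_series \<beta> q b holomorphic_on UNIV"
    "b k * exp (- \<beta> * (real k + q)\<^sup>2) = (deriv ^^ k) (gauss_series \<beta> q b) 0 / fact k"
  using power_series_entire[of "\<lambda>l. b l * exp (- \<beta> * (real l + q)\<^sup>2)", OF gauss_series_sums(1)[OF assms]]
  by auto

lemma entire_gauss_series:
  assumes "f holomorphic_on UNIV" "0 < \<beta>"
  shows "f = gauss_series \<beta> q (\<lambda>k. (deriv ^^ k) f 0 / fact k * exp (\<beta> * (real k + q)\<^sup>2))"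
proof
  fix z
  have "(\<lambda>l. (deriv ^^ l) f 0 / fact l * z ^ l) sums f z"
    using holomorphic_power_series[of f 0 "cmod z + 1" z] assms holomorphic_on_subset
    by (fastforce simp: dist_norm)
  then show "f z = gauss_series \<beta> q (\<lambda>k. (deriv ^^ k) f 0 / fact k * exp (\<beta> * (real k + q)\<^sup>2)) z"
    unfolding gauss_series_def by (simp add: sums_iff exp_minus_inverse mult.assoc flip: of_real_mult exp_add)
qed

text \<open>Cauchy's inequality, kept as a statement about one point of the circle: that point
  becomes the centre of the disc to which \<open>large_subdisc\<close> is applied.\<close>

lemma coeff_le_sphere:
  assumes "f holomorphic_on UNIV" "0 < r"
  obtains z where "cmod z = r" "cmod ((deriv ^^ k) f 0 / fact k) * r ^ k \<le> cmod (f z)"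
proof -
  have c: "continuous_on A f" for A
    using assms(1) holomorphic_on_imp_continuous_on continuous_on_subset by blast
  obtain z where z: "z \<in> sphere 0 r" "\<And>y. y \<in> sphere 0 r \<Longrightarrow> cmod (f y) \<le> cmod (f z)"
    using continuous_attains_sup[of "sphere 0 r" "\<lambda>z. cmod (f z)"] assms(2) c
    by (metis compact_sphere continuous_on_norm less_eq_real_def sphere_eq_empty not_less)
  have "cmod ((deriv ^^ k) f 0) \<le> fact k * cmod (f z) / r ^ k"
    by (rule Cauchy_inequality) (use assms c z holomorphic_on_subset in auto)
  then have "cmod ((deriv ^^ k) f 0 / fact k) * r ^ k \<le> cmod (f z)"
    using assms(2) by (simp add: norm_divide field_simps)
  then show ?thesis using that z(1) by simp
qed

section \<open>Coefficient sequences of Fock functions are the l^p sequences\<close>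

lemma enn2real_two_divide:
  assumes "0 < p" "p \<noteq> (\<infinity>::ennreal)"
  shows "enn2real (2 / p) = 2 / enn2real p"
proof -
  obtain r where r: "p = ennreal r" "0 \<le> r" using assms(2) by (cases p) auto
  then have "r > 0" using assms(1) by auto
  moreover have "2 / p = ennreal (2 / r)"
    using r \<open>r > 0\<close> divide_ennreal[of 2 r] by simp
  ultimately show ?thesis using r by simp
qed

lemma measure_ball_complex: "0 \<le> r \<Longrightarrow> measure lborel (ball (z::complex) r) = pi * r\<^sup>2"
  using content_ball[of r z] by (simp add: unit_ball_vol_2)

lemma emeasure_ball_complex: "0 \<le> r \<Longrightarrow> emeasure lborel (ball (z::complex) r) = ennreal (pi * r\<^sup>2)"
  using emeasure_ball[of r z] by (simp add: unit_ball_vol_2)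

lemma log_plus_nonneg: "0 \<le> log_plus t"
  by (simp add: log_plus_def)

lemma le_exp_log_plus: "t \<le> exp (log_plus t)"
  by (auto simp: log_plus_def max_def)

lemma log_plus_sq_le: "0 < t \<Longrightarrow> (log_plus t)\<^sup>2 \<le> (ln t)\<^sup>2"
  by (auto simp: log_plus_def max_def)

lemma fock_norm_nonneg:
  assumes "f \<in> fock_space p \<alpha>"
  shows "0 \<le> fock_norm p \<alpha> f"
proof (cases "p = \<infinity>")
  case True
  then have "bdd_above (range (\<lambda>z. cmod (f z) * exp (- \<alpha> * (log_plus (cmod z))\<^sup>2)))"
    using assms by (simp add: fock_space_def)
  then have "cmod (f 0) * exp (- \<alpha> * (log_plus (cmod 0))\<^sup>2) \<le> fock_norm p \<alpha> f"
    using True cSUP_upper[OF UNIV_I, of "\<lambda>z. cmod (f z) * exp (- \<alpha> * (log_plus (cmod z))\<^sup>2)" 0]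
    unfolding fock_norm_def by simp
  moreover have "0 \<le> cmod (f 0) * exp (- \<alpha> * (log_plus (cmod 0))\<^sup>2)" by simp
  ultimately show ?thesis by linarith
qed (simp add: fock_norm_def)

text \<open>For finite p a coefficient is controlled by the mass of f in one annulus. There |z|^k
  times the weight is constant up to a bounded factor, so f / z^k may replace f, and
  \<open>large_subdisc\<close> converts a value on the central circle into a disc of definite mass.
  The annuli for different k are disjoint, so all coefficients can be summed against a single
  integral.\<close>

lemma coeff_annulus_disc:
  fixes P q :: real
  assumes "0 < P" "0 < \<alpha>" "\<beta> = 1 / (4 * \<alpha>)" "q = 2 / P"
  obtains K where "0 < K" and "\<And>f k. f holomorphic_on UNIV \<Longrightarrow>
    \<exists>z1 \<rho> m. 0 < \<rho> \<and> 0 \<le> m \<and>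
      (\<forall>z\<in>ball z1 \<rho>. 0 < cmod z \<and> \<bar>ln (cmod z) - 2 * \<beta> * (real k + q)\<bar> < \<beta> \<and>
         m \<le> cmod (f z) powr P * exp (- P * \<alpha> * (log_plus (cmod z))\<^sup>2)) \<and>
      (cmod ((deriv ^^ k) f 0 / fact k) * exp (\<beta> * (real k + q)\<^sup>2)) powr P \<le> K * (pi * \<rho>\<^sup>2 * m)"
proof -
  have \<beta>: "\<beta> > 0" "4 * \<alpha> * \<beta> = 1" using assms by auto
  have q: "q > 0" "P * q = 2" using assms by auto
  obtain K where K: "0 < K" and sub: "\<And>g S z0 R. \<lbrakk>g holomorphic_on S; open S; cball z0 R \<subseteq> S; 0 < R\<rbrakk> \<Longrightarrow>
    \<exists>z1 \<rho> A. 0 < \<rho> \<and> 0 \<le> A \<and> ball z1 \<rho> \<subseteq> ball z0 R \<and> (\<forall>z\<in>ball z1 \<rho>. A \<le> cmod (g z)) \<and>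
      R\<^sup>2 * cmod (g z0) powr P \<le> K * \<rho>\<^sup>2 * A powr P"
    using large_subdisc[OF assms(1)] by metis
  \<comment> \<open>A disc of radius c r about a point of modulus r stays between the radii exp (-
    \<beta>) r and exp \<beta> r; the upper bound is 2 - exp (- \<beta>) \<le> exp \<beta>.\<close>
  define c where "c = 1 - exp (-\<beta>)"
  have c: "0 < c" "c < 1" using \<beta> by (auto simp: c_def)
  have c2: "1 + c \<le> exp \<beta>"
  proof -
    have "2 \<le> exp \<beta> + exp (-\<beta>)"
      using exp_ge_add_one_self[of \<beta>] exp_ge_add_one_self[of "-\<beta>"] by linarith
    then show ?thesis by (simp add: c_def)
  qed
  \<comment> \<open>In the variable v = ln |z| / (2\<beta>) the annulus reaches at most q + 1/2 away
    from k, the shift from k to k + q included; \<open>E\<close> absorbs the resulting quadratic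
    error.\<close>
  define E where "E = exp (P * \<beta> * (q + 1/2)\<^sup>2)"
  have main: "\<exists>z1 \<rho> m. 0 < \<rho> \<and> 0 \<le> m \<and>
      (\<forall>z\<in>ball z1 \<rho>. 0 < cmod z \<and> \<bar>ln (cmod z) - 2 * \<beta> * (real k + q)\<bar> < \<beta> \<and>
         m \<le> cmod (f z) powr P * exp (- P * \<alpha> * (log_plus (cmod z))\<^sup>2)) \<and>
      (cmod ((deriv ^^ k) f 0 / fact k) * exp (\<beta> * (real k + q)\<^sup>2)) powr P \<le> K / c\<^sup>2 * E / pi * (pi * \<rho>\<^sup>2 * m)"
    if f: "f holomorphic_on UNIV" for f k
  proof -
    define r where "r = exp (2 * \<beta> * (real k + q))"
    have r: "r > 0" by (simp add: r_def)
    obtain z0 where z0: "cmod z0 = r" "cmod ((deriv ^^ k) f 0 / fact k) * r ^ k \<le> cmod (f z0)"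
      using coeff_le_sphere[OF f r] by metis
    define g where "g z = f z / z ^ k" for z
    have gh: "g holomorphic_on (-{0})" unfolding g_def
      by (intro holomorphic_intros holomorphic_on_subset[OF f]) auto
    have sb: "cball z0 (c * r) \<subseteq> - {0}" using z0 r c by (auto simp: dist_norm)
    have "0 < c * r" using c r by simp
    moreover have "open (- {0::complex})" by auto
    ultimately obtain z1 \<rho> A where A: "0 < \<rho>" "0 \<le> A" "ball z1 \<rho> \<subseteq> ball z0 (c*r)"
      "\<And>z. z \<in> ball z1 \<rho> \<Longrightarrow> A \<le> cmod (g z)" "(c*r)\<^sup>2 * cmod (g z0) powr P \<le> K * \<rho>\<^sup>2 * A powr P"
      using sub[OF gh _ sb] by blast
    define m where "m = A powr P * (exp (P * \<beta> * (real k)\<^sup>2) / E)"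
    have 1: "0 < cmod z \<and> \<bar>ln (cmod z) - 2 * \<beta> * (real k + q)\<bar> < \<beta> \<and>
         m \<le> cmod (f z) powr P * exp (- P * \<alpha> * (log_plus (cmod z))\<^sup>2)" if z: "z \<in> ball z1 \<rho>" for z
    proof -
      have "z \<in> ball z0 (c*r)" using A(3) z by blast
      then have d: "cmod (z0 - z) < c * r" by (simp add: dist_norm)
      have "cmod z > r - c * r" using d z0(1) norm_triangle_ineq2[of z0 z] by linarith
      moreover have "cmod z < r + c * r"
        using d z0(1) norm_triangle_ineq4[of z0 "z0 - z"] by (simp add: norm_minus_commute)
      moreover have "r - c * r = exp (2 * \<beta> * (real k + q) - \<beta>)" unfolding r_def c_def
        by (simp add: algebra_simps exp_diff exp_minus divide_inverse)
      moreover have "r + c * r \<le> exp (2 * \<beta> * (real k + q) + \<beta>)"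
        using mult_left_mono[OF c2, of r] r unfolding exp_add r_def[symmetric] by (simp add: algebra_simps)
      ultimately have rng: "exp (2 * \<beta> * (real k + q) - \<beta>) < cmod z" "cmod z < exp (2 * \<beta> * (real k + q) + \<beta>)"
        by linarith+
      have zp: "cmod z > 0" using rng(1) by (meson exp_gt_zero less_trans)
      have l1: "2 * \<beta> * (real k + q) - \<beta> < ln (cmod z)"
        using rng(1) zp by (metis exp_gt_zero ln_exp ln_less_cancel_iff)
      have l2: "ln (cmod z) < 2 * \<beta> * (real k + q) + \<beta>"
        using rng(2) zp by (metis exp_gt_zero ln_exp ln_less_cancel_iff)
      define v where "v = ln (cmod z) / (2*\<beta>)"
      have lv: "ln (cmod z) = 2 * \<beta> * v" using \<beta> by (simp add: v_def)
      have "\<beta> * (2 * (real k + q) - 1) < \<beta> * (2 * v)" "\<beta> * (2 * v) < \<beta> * (2 * (real k + q) + 1)"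
        using l1 l2 lv by (simp_all add: algebra_simps)
      then have v: "\<bar>v - real k\<bar> \<le> q + 1/2" using \<beta> q by (simp add: abs_le_iff)
      then have v2: "(v - real k)\<^sup>2 \<le> (q+1/2)\<^sup>2" by (metis abs_ge_zero power2_abs power_mono)
      have al: "\<alpha> * (ln (cmod z))\<^sup>2 = \<beta> * v\<^sup>2"
      proof -
        have "\<alpha> * (ln (cmod z))\<^sup>2 = (4 * \<alpha> * \<beta>) * (\<beta> * v\<^sup>2)"
          unfolding lv by (simp add: power2_eq_square)
        then show ?thesis using \<beta>(2) by simp
      qed
      have e1: "P * \<beta> * (real k)\<^sup>2 - P * \<beta> * (q+1/2)\<^sup>2 \<le> P * (real k * ln (cmod z)) - P * \<alpha> * (log_plus (cmod z))\<^sup>2"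
      proof -
        have "P * \<beta> * (v - real k)\<^sup>2 \<le> P * \<beta> * (q+1/2)\<^sup>2"
          using v2 assms(1) \<beta> by (intro mult_left_mono) auto
        moreover have "P * \<alpha> * (log_plus (cmod z))\<^sup>2 \<le> P * (\<beta> * v\<^sup>2)"
          unfolding al[symmetric] mult.assoc using assms log_plus_sq_le[OF zp] by (intro mult_left_mono) auto
        ultimately show ?thesis unfolding lv by (simp add: power2_eq_square algebra_simps)
      qed
      have "A * cmod z ^ k \<le> cmod (f z)"
        using A(4)[OF z] zp by (simp add: g_def norm_divide norm_power field_simps)
      then have "(A * cmod z ^ k) powr P \<le> cmod (f z) powr P"
        using A(2) zp assms(1) by (intro powr_mono2) auto
      moreover have "(A * cmod z ^ k) powr P = A powr P * exp (P * (real k * ln (cmod z)))"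
      proof -
        have "(cmod z ^ k) powr P = exp (P * (real k * ln (cmod z)))"
          using zp by (simp add: powr_def ln_realpow)
        then show ?thesis using A(2) by (simp add: powr_mult)
      qed
      ultimately have "A powr P * exp (P * (real k * ln (cmod z))) * exp (- P * \<alpha> * (log_plus (cmod z))\<^sup>2)
         \<le> cmod (f z) powr P * exp (- P * \<alpha> * (log_plus (cmod z))\<^sup>2)" by (intro mult_right_mono) auto
      moreover have "m \<le> A powr P * exp (P * (real k * ln (cmod z))) * exp (- P * \<alpha> * (log_plus (cmod z))\<^sup>2)"
        unfolding m_def E_def exp_diff[symmetric] mult.assoc[of "A powr P"] exp_add[symmetric]
        by (intro mult_left_mono) (use e1 in simp_all)
      ultimately have "m \<le> cmod (f z) powr P * exp (- P * \<alpha> * (log_plus (cmod z))\<^sup>2)"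
        by (rule order_trans[rotated])
      moreover have "\<bar>ln (cmod z) - 2 * \<beta> * (real k + q)\<bar> < \<beta>" using l1 l2 by (simp only: abs_less_iff) linarith
      ultimately show ?thesis using zp by blast
    qed
    define a where "a = cmod ((deriv ^^ k) f 0 / fact k)"
    have a0: "a \<ge> 0" by (simp add: a_def)
    have "a \<le> cmod (g z0)" using z0 r by (simp add: g_def a_def norm_divide norm_power field_simps)
    then have "a powr P \<le> cmod (g z0) powr P" using assms(1) a0 by (intro powr_mono2) auto
    then have "(c*r)\<^sup>2 * a powr P \<le> K * \<rho>\<^sup>2 * A powr P"
      using A(5) mult_left_mono[of "a powr P" "cmod (g z0) powr P" "(c*r)\<^sup>2"] by simp
    then have ap: "a powr P \<le> K / c\<^sup>2 * \<rho>\<^sup>2 * A powr P / r\<^sup>2"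
      using c r by (simp add: field_simps power_mult_distrib)
    \<comment> \<open>The area of the disc contributes r^2, and this moves the normalisation from
      k^2 to (k + q)^2, because P q = 2.\<close>
    have r2: "exp (P * (\<beta> * (real k + q)\<^sup>2)) \<le> r\<^sup>2 * exp (P * \<beta> * (real k)\<^sup>2)"
    proof -
      have "P * (\<beta> * (real k + q)\<^sup>2) = P * \<beta> * (real k)\<^sup>2 + 2 * (P*q) * \<beta> * real k + (P*q) * q * \<beta>"
        by (simp add: power2_eq_square algebra_simps)
      also have "\<dots> \<le> 2 * (2 * \<beta> * (real k + q)) + P * \<beta> * (real k)\<^sup>2"
        unfolding q(2) using q \<beta> by (simp add: algebra_simps)
      finally show ?thesis unfolding r_def exp_double[symmetric] exp_add[symmetric] by simp
    qed
    have "(a * exp (\<beta> * (real k + q)\<^sup>2)) powr P = a powr P * exp (P * (\<beta> * (real k + q)\<^sup>2))"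
      using a0 by (simp add: powr_mult exp_powr_real mult.commute)
    also have "\<dots> \<le> (K / c\<^sup>2 * \<rho>\<^sup>2 * A powr P / r\<^sup>2) * (r\<^sup>2 * exp (P * \<beta> * (real k)\<^sup>2))"
      using ap r2 K by (intro mult_mono) auto
    also have "\<dots> = K / c\<^sup>2 * E / pi * (pi * \<rho>\<^sup>2 * m)"
      using r by (simp add: m_def E_def)
    finally show ?thesis unfolding a_def using A(1) 1
      by (intro exI[of _ z1] exI[of _ \<rho>] exI[of _ m]) (auto simp: m_def E_def)
  qed
  show ?thesis by (rule that[OF _ main]) (use K c in \<open>auto simp: E_def\<close>)
qed

lemma fock_coefficients:
  assumes "0 < p" "0 < \<alpha>" "\<beta> = 1 / (4 * \<alpha>)" "q = enn2real (2 / p)"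
  obtains C where "0 < C" and "\<And>f. f \<in> fock_space p \<alpha> \<Longrightarrow>
    lp_bound p (C * fock_norm p \<alpha> f) (\<lambda>k. cmod ((deriv ^^ k) f 0 / fact k * exp (\<beta> * (real k + q)\<^sup>2)))"
proof (cases "p = \<infinity>")
  case True
  have q: "q = 0" using assms True by simp
  have \<beta>: "\<beta> > 0" "4 * \<alpha> * \<beta> = 1" using assms by auto
  show ?thesis
  proof (rule that[of 1])
    fix f assume f: "f \<in> fock_space p \<alpha>"
    then have fh: "f holomorphic_on UNIV"
      and bdd: "bdd_above (range (\<lambda>z. cmod (f z) * exp (- \<alpha> * (log_plus (cmod z))\<^sup>2)))"
      using True by (auto simp: fock_space_def)
    define N where "N = fock_norm p \<alpha> f"
    have N: "cmod (f z) * exp (- \<alpha> * (log_plus (cmod z))\<^sup>2) \<le> N" for z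
      using True bdd unfolding N_def fock_norm_def by (auto intro!: cSup_upper)
    have "cmod ((deriv ^^ k) f 0 / fact k * exp (\<beta> * (real k + q)\<^sup>2)) \<le> N" for k
    proof -
      define r where "r = exp (2 * \<beta> * real k)"
      have r: "r > 0" by (simp add: r_def)
      obtain z where z: "cmod z = r" "cmod ((deriv ^^ k) f 0 / fact k) * r ^ k \<le> cmod (f z)"
        using coeff_le_sphere[OF fh r] by metis
      define a where "a = cmod ((deriv ^^ k) f 0 / fact k)"
      have "\<alpha> * (log_plus r)\<^sup>2 \<le> \<alpha> * (ln r)\<^sup>2"
        using log_plus_sq_le[OF r] assms by (intro mult_left_mono) auto
      also have "\<dots> = 4 * \<alpha> * \<beta> * (\<beta> * (real k)\<^sup>2)" by (simp add: r_def power2_eq_square)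
      finally have "\<alpha> * (log_plus r)\<^sup>2 \<le> \<beta> * (real k)\<^sup>2" using \<beta> by simp
      then have "a * r ^ k * exp (- (\<beta> * (real k)\<^sup>2)) \<le> cmod (f z) * exp (- \<alpha> * (log_plus (cmod z))\<^sup>2)"
        using z unfolding a_def by (intro mult_mono) auto
      also have "\<dots> \<le> N" by (rule N)
      also have "a * r ^ k * exp (- (\<beta> * (real k)\<^sup>2)) = a * exp (\<beta> * (real k)\<^sup>2)"
        unfolding r_def exp_of_nat_mult[symmetric] mult.assoc exp_add[symmetric]
        by (simp add: power2_eq_square algebra_simps)
      finally show ?thesis by (simp add: norm_mult norm_divide a_def q)
    qed
    then show "lp_bound p (1 * fock_norm p \<alpha> f) (\<lambda>k. cmod ((deriv ^^ k) f 0 / fact k * exp (\<beta> * (real k + q)\<^sup>2)))"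
      using True by (simp add: lp_bound_def N_def)
  qed simp
next
  case False
  define P where "P = enn2real p"
  have P: "P > 0" unfolding P_def using enn2real_pos[OF assms(1) False] .
  have q: "q = 2 / P" unfolding assms P_def by (rule enn2real_two_divide[OF assms(1) False])
  have \<beta>: "\<beta> > 0" using assms by auto
  obtain K where K: "0 < K" and main: "\<And>f k. f holomorphic_on UNIV \<Longrightarrow>
    \<exists>z1 \<rho> m. 0 < \<rho> \<and> 0 \<le> m \<and>
      (\<forall>z\<in>ball z1 \<rho>. 0 < cmod z \<and> \<bar>ln (cmod z) - 2 * \<beta> * (real k + q)\<bar> < \<beta> \<and>
         m \<le> cmod (f z) powr P * exp (- P * \<alpha> * (log_plus (cmod z))\<^sup>2)) \<and>
      (cmod ((deriv ^^ k) f 0 / fact k) * exp (\<beta> * (real k + q)\<^sup>2)) powr P \<le> K * (pi * \<rho>\<^sup>2 * m)"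
    using coeff_annulus_disc[OF P assms(2,3) q] by metis
  show ?thesis
  proof (rule that[of "K powr (1/P)"])
    fix f assume f: "f \<in> fock_space p \<alpha>"
    define F where "F z = cmod (f z) powr P * exp (- P * \<alpha> * (log_plus (cmod z))\<^sup>2)" for z
    have fh: "f holomorphic_on UNIV" and int: "integrable lborel F"
      using f False unfolding fock_space_def F_def P_def by auto
    define b where "b k = cmod ((deriv ^^ k) f 0 / fact k * exp (\<beta> * (real k + q)\<^sup>2))" for k
    have b: "b k = cmod ((deriv ^^ k) f 0 / fact k) * exp (\<beta> * (real k + q)\<^sup>2)" for k
      by (simp add: b_def norm_mult norm_divide)
    have I0: "integral\<^sup>L lborel F \<ge> 0" by (intro Bochner_Integration.integral_nonneg) (simp add: F_def)
    obtain w \<rho> m where w: "\<And>k. 0 < \<rho> k" "\<And>k. 0 \<le> m k"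
      "\<And>k z. z \<in> ball (w k) (\<rho> k) \<Longrightarrow> 0 < cmod z \<and> \<bar>ln (cmod z) - 2 * \<beta> * (real k + q)\<bar> < \<beta> \<and> m k \<le> F z"
      "\<And>k. b k powr P \<le> K * (pi * (\<rho> k)\<^sup>2 * m k)"
      using main[OF fh] unfolding F_def[symmetric] b[symmetric] by metis
    have disj: "k = j" if "z \<in> ball (w k) (\<rho> k)" "z \<in> ball (w j) (\<rho> j)" for k j z
    proof -
      have "\<bar>2 * \<beta> * (real k + q) - 2 * \<beta> * (real j + q)\<bar> < 2 * \<beta>"
        using w(3)[OF that(1)] w(3)[OF that(2)] by linarith
      moreover have "2 * \<beta> * (real k + q) - 2 * \<beta> * (real j + q) = 2 * \<beta> * (real k - real j)"
        by (simp add: algebra_simps)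
      ultimately have "2 * \<beta> * \<bar>real k - real j\<bar> < 2 * \<beta> * 1" using \<beta> by (simp add: abs_mult)
      then have "\<bar>real k - real j\<bar> < 1" using \<beta> by simp
      then show ?thesis by linarith
    qed
    have "(\<Sum>k<n. b k powr P) \<le> (K powr (1/P) * fock_norm p \<alpha> f) powr P" for n
    proof -
      have "(\<Sum>k<n. b k powr P) \<le> (\<Sum>k<n. K * (pi * (\<rho> k)\<^sup>2 * m k))" by (intro sum_mono w(4))
      also have "\<dots> = K * (\<Sum>k<n. measure lborel (ball (w k) (\<rho> k)) * m k)"
        by (simp add: sum_distrib_left measure_ball_complex less_imp_le[OF w(1)])
      also have "(\<Sum>k<n. measure lborel (ball (w k) (\<rho> k)) * m k) =
          (LINT z|lborel. (\<Sum>k<n. indicator (ball (w k) (\<rho> k)) z * m k))"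
        by (subst Bochner_Integration.integral_sum)
           (auto simp: emeasure_ball_complex less_imp_le[OF w(1)])
      also have "\<dots> \<le> integral\<^sup>L lborel F"
      proof (rule integral_mono[OF _ int])
        show "integrable lborel (\<lambda>z. \<Sum>k<n. indicator (ball (w k) (\<rho> k)) z * m k)"
          by (intro Bochner_Integration.integrable_sum integrable_mult_left integrable_real_indicator)
             (auto simp: emeasure_ball_complex less_imp_le[OF w(1)])
        show "(\<Sum>k<n. indicator (ball (w k) (\<rho> k)) z * m k) \<le> F z" for z
        proof (cases "\<exists>k<n. z \<in> ball (w k) (\<rho> k)")
          case True
          then obtain k where k: "k < n" "z \<in> ball (w k) (\<rho> k)" by blast
          have "indicator (ball (w j) (\<rho> j)) z * m j = (if j = k then m k else 0)" for j
          proof (cases "j = k")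
            case False
            then have "z \<notin> ball (w j) (\<rho> j)" using disj[OF k(2), of j] by blast
            then show ?thesis using False by simp
          qed (use k in simp)
          then have "(\<Sum>j<n. indicator (ball (w j) (\<rho> j)) z * m j) = (\<Sum>j<n. if j = k then m k else 0)"
            by (intro sum.cong refl) simp
          also have "\<dots> = m k" using k by simp
          finally show ?thesis using w(3)[OF k(2)] by simp
        next
          case False
          then have "(\<Sum>j<n. indicator (ball (w j) (\<rho> j)) z * m j) = 0"
            by (intro sum.neutral) (auto simp: indicator_def)
          then show ?thesis by (simp add: F_def)
        qed
      qed
      finally have "(\<Sum>k<n. b k powr P) \<le> K * integral\<^sup>L lborel F" using K by simp
      also have "\<dots> = (K powr (1/P) * fock_norm p \<alpha> f) powr P"
        using K P I0 False unfolding fock_norm_def F_def P_def[symmetric] by (simp add: powr_mult powr_powr)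
      finally show ?thesis .
    qed
    then show "lp_bound p (K powr (1/P) * fock_norm p \<alpha> f) (\<lambda>k. cmod ((deriv ^^ k) f 0 / fact k * exp (\<beta> * (real k + q)\<^sup>2)))"
      using False by (simp add: lp_bound_def P_def b_def)
  qed (use K in auto)
qed

text \<open>\<open>N\<close> cuts the plane into annuli of width 1 in the variable 2\<alpha> log_+
  |z|. On the n-th one the weighted function is at most a constant times exp (- q log_+ |z|)
  \<open>v b n\<close>, where \<open>v b\<close> is an exponential convolution of the moduli of the
  coefficients. For finite p the p-th power of that exponential is exp (- 2 log_+ |z|), which
  cancels the area of the annulus. What remains is an instance of
  \<open>lp_bound_exp_kernel\<close>.\<close>

lemma gauss_series_in_fock:
  assumes "0 < p" "0 < \<alpha>" "\<beta> = 1 / (4 * \<alpha>)" "q = enn2real (2 / p)"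
  obtains C where "0 < C" and "\<And>b M. \<lbrakk>lp_bound p M (\<lambda>k. cmod (b k)); 0 \<le> M\<rbrakk> \<Longrightarrow>
    gauss_series \<beta> q b \<in> fock_space p \<alpha> \<and> fock_norm p \<alpha> (gauss_series \<beta> q b) \<le> C * M"
proof -
  have \<beta>: "\<beta> > 0" "4 * \<alpha> * \<beta> = 1" using assms by auto
  define w where "w f z = cmod (f z) * exp (- \<alpha> * (log_plus (cmod z))\<^sup>2)" for f z
  define N where "N z = nat \<lfloor>2 * \<alpha> * log_plus (cmod z)\<rfloor>" for z
  define G where "G = exp (1\<^sup>2 / (4*\<beta>)) * exp 1"
  define v where "v b n = (\<Sum>l. exp (- 1 * \<bar>(real n - q) - real l\<bar>) * cmod (b l))" for b n
  have N: "real (N z) \<le> 2 * \<alpha> * log_plus (cmod z)" "2 * \<alpha> * log_plus (cmod z) < real (N z) + 1" for z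
  proof -
    have "0 \<le> 2 * \<alpha> * log_plus (cmod z)" using assms log_plus_nonneg by simp
    then show "real (N z) \<le> 2 * \<alpha> * log_plus (cmod z)" "2 * \<alpha> * log_plus (cmod z) < real (N z) + 1"
      unfolding N_def by linarith+
  qed
  have sp: "spread (\<lambda>n. real n - q)" by (rule spread_bounded_diff[of _ "\<bar>q\<bar>"]) simp
  obtain C where C: "0 < C" and lpv: "\<And>u v M \<eta>. \<lbrakk>lp_bound p M u; \<And>k. 0 \<le> u k; \<And>k. 0 \<le> v k; 0 \<le> M; 0 \<le> \<eta>;
     \<And>k. v k \<le> \<eta> * (\<Sum>l. exp (- 1 * \<bar>(real k - q) - real l\<bar>) * u l)\<rbrakk> \<Longrightarrow> lp_bound p (\<eta> * C * M) v"
    using lp_bound_exp_kernel[OF assms(1) sp spread_real zero_less_one] by blast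
  have bound: "w (gauss_series \<beta> q b) z \<le> G * exp (- q * log_plus (cmod z)) * v b (N z)"
    and v0: "0 \<le> v b n" and vlp: "lp_bound p (C * M) (v b)"
    if b: "lp_bound p M (\<lambda>k. cmod (b k))" "0 \<le> M" for b M z n
  proof -
    have bM: "cmod (b l) \<le> M" for l using lp_bound_component[OF assms(1) b] by simp
    have vs: "summable (\<lambda>l. exp (- 1 * \<bar>(real n - q) - real l\<bar>) * cmod (b l))" for n
    proof (rule summable_comparison_test_ev[OF always_eventually, OF allI])
      show "summable (\<lambda>l. exp (- 1 * \<bar>real l - (real n - q)\<bar>) * M)"
        by (intro summable_mult2 spread_exp_summable spread_real) simp
      show "norm (exp (- 1 * \<bar>(real n - q) - real l\<bar>) * cmod (b l)) \<le> exp (- 1 * \<bar>real l - (real n - q)\<bar>) * M" for l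
        using bM[of l] by (simp add: abs_minus_commute)
    qed
    show v0: "0 \<le> v b n" for n unfolding v_def by (intro suminf_nonneg vs) auto
    show "lp_bound p (C * M) (v b)"
      using lpv[OF b(1) _ _ b(2), of "v b" 1] v0 by (simp add: v_def)
    define L where "L = log_plus (cmod z)"
    \<comment> \<open>Inside the unit disc \<open>L\<close> is 0 and |z| is merely bounded by exp L.
      The majorant has nonnegative terms, so it may be evaluated at radius exp L, where it is a
      Gaussian centred at \<open>x\<close>.\<close>
    define x where "x = 2 * \<alpha> * L - q"
    have "2 * \<beta> * (x + q) = (4 * \<alpha> * \<beta>) * L" by (simp add: x_def)
    then have L: "L = 2 * \<beta> * (x + q)" using \<beta> by simp
    have zL: "cmod z \<le> exp (2 * \<beta> * (x + q))" using le_exp_log_plus[of "cmod z"] unfolding L[symmetric] L_def .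
    have xN: "\<bar>x - (real (N z) - q)\<bar> \<le> 1" using N[of z] unfolding x_def L_def by simp
    have "cmod (gauss_series \<beta> q b z) \<le> (\<Sum>l. cmod (b l) * (exp (- \<beta> * (real l + q)\<^sup>2) * cmod z ^ l))"
      by (rule gauss_series_sums(2)[OF \<beta>(1) bM])
    also have "\<dots> \<le> (\<Sum>l. exp (\<beta> * (x\<^sup>2 - q\<^sup>2)) * G * (exp (- 1 * \<bar>(real (N z) - q) - real l\<bar>) * cmod (b l)))"
    proof (rule suminf_le)
      show "summable (\<lambda>l. cmod (b l) * (exp (- \<beta> * (real l + q)\<^sup>2) * cmod z ^ l))"
        by (rule gauss_series_summable_norm[OF \<beta>(1) bM])
      show "summable (\<lambda>l. exp (\<beta> * (x\<^sup>2 - q\<^sup>2)) * G * (exp (- 1 * \<bar>(real (N z) - q) - real l\<bar>) * cmod (b l)))"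
        by (intro summable_mult vs)
      fix l
      have "exp (- \<beta> * (real l + q)\<^sup>2) * cmod z ^ l \<le> exp (- \<beta> * (real l + q)\<^sup>2) * exp (2 * \<beta> * (x + q)) ^ l"
        using zL by (intro mult_left_mono power_mono) auto
      also have "\<dots> \<le> exp (\<beta> * (x\<^sup>2 - q\<^sup>2)) * (exp (1\<^sup>2 / (4*\<beta>)) * exp (- 1 * \<bar>real l - x\<bar>))"
        unfolding gauss_monomial by (intro mult_left_mono gauss_le \<beta>) auto
      also have "\<dots> \<le> exp (\<beta> * (x\<^sup>2 - q\<^sup>2)) * (exp (1\<^sup>2 / (4*\<beta>)) * exp (1 - \<bar>(real (N z) - q) - real l\<bar>))"
        using xN by (intro mult_left_mono) auto
      finally have "exp (- \<beta> * (real l + q)\<^sup>2) * cmod z ^ l \<le>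
          exp (\<beta> * (x\<^sup>2 - q\<^sup>2)) * G * exp (- 1 * \<bar>(real (N z) - q) - real l\<bar>)"
        unfolding G_def by (simp only: mult.assoc exp_add[symmetric] add.assoc diff_conv_add_uminus mult_minus1)
      from mult_right_mono[OF this, of "cmod (b l)"]
      show "cmod (b l) * (exp (- \<beta> * (real l + q)\<^sup>2) * cmod z ^ l) \<le>
          exp (\<beta> * (x\<^sup>2 - q\<^sup>2)) * G * (exp (- 1 * \<bar>(real (N z) - q) - real l\<bar>) * cmod (b l))"
        by (simp add: mult_ac)
    qed
    also have "\<dots> = exp (\<beta> * (x\<^sup>2 - q\<^sup>2)) * G * v b (N z)"
      unfolding v_def by (rule suminf_mult[OF vs])
    finally have "w (gauss_series \<beta> q b) z \<le> exp (\<beta> * (x\<^sup>2 - q\<^sup>2)) * G * v b (N z) * exp (- \<alpha> * L\<^sup>2)"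
      unfolding w_def L_def by (intro mult_right_mono) auto
    also have "\<dots> = G * (exp (\<beta> * (x\<^sup>2 - q\<^sup>2)) * exp (- \<alpha> * L\<^sup>2)) * v b (N z)" by simp
    also have "exp (\<beta> * (x\<^sup>2 - q\<^sup>2)) * exp (- \<alpha> * L\<^sup>2) = exp (- q * L)"
    proof -
      have "\<alpha> * L\<^sup>2 = (4 * \<alpha> * \<beta>) * (\<beta> * (x + q)\<^sup>2)" unfolding L by (simp add: power2_eq_square)
      then have "\<beta> * (x\<^sup>2 - q\<^sup>2) - \<alpha> * L\<^sup>2 = - q * L" unfolding \<beta>(2) unfolding L
        by (simp add: power2_eq_square algebra_simps)
      then show ?thesis by (simp add: exp_add[symmetric])
    qed
    finally show "w (gauss_series \<beta> q b) z \<le> G * exp (- q * log_plus (cmod z)) * v b (N z)"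
      unfolding L_def .
  qed
  have G: "G > 0" by (simp add: G_def)
  show ?thesis
  proof (cases "p = \<infinity>")
    case True
    have q: "q = 0" using assms True by simp
    show ?thesis
    proof (rule that[of "G * C"])
      fix b M assume b: "lp_bound p M (\<lambda>k. cmod (b k))" "0 \<le> (M::real)"
      have "v b n \<le> C * M" for n
        using lp_bound_component[OF assms(1) vlp[OF b] _ v0[OF b]] b C by simp
      then have "G * v b (N z) \<le> G * (C * M)" for z using G by (intro mult_left_mono) auto
      then have "w (gauss_series \<beta> q b) z \<le> G * C * M" for z
        using bound[OF b, of z] by (simp add: q) (metis (no_types, lifting) mult.assoc order_trans)
      moreover have "gauss_series \<beta> q b holomorphic_on UNIV"
        by (rule gauss_series_entire(1)[of _ _ M]) (use \<beta> lp_bound_component[OF assms(1) b] in auto)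
      ultimately show "gauss_series \<beta> q b \<in> fock_space p \<alpha> \<and> fock_norm p \<alpha> (gauss_series \<beta> q b) \<le> G * C * M"
        using True unfolding fock_space_def fock_norm_def w_def
        by (auto intro!: bdd_aboveI[of _ "G * C * M"] cSUP_least)
    qed (use G C in auto)
  next
    case False
    define P where "P = enn2real p"
    have P: "P > 0" unfolding P_def using enn2real_pos[OF assms(1) False] .
    have q: "q * P = 2" using P unfolding assms P_def enn2real_two_divide[OF assms(1) False] by simp
    define D where "D = pi * exp (1/\<alpha>) * (G powr P * C powr P)"
    have D: "D > 0" using G C by (simp add: D_def)
    show ?thesis
    proof (rule that[of "D powr (1/P)"])
      fix b M assume b: "lp_bound p M (\<lambda>k. cmod (b k))" "0 \<le> (M::real)"
      define f where "f = gauss_series \<beta> q b"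
      have fh: "f holomorphic_on UNIV" unfolding f_def
        by (rule gauss_series_entire(1)[of _ _ M]) (use \<beta> lp_bound_component[OF assms(1) b] in auto)
      define F where "F z = cmod (f z) powr P * exp (- P * \<alpha> * (log_plus (cmod z))\<^sup>2)" for z
      have Fw: "F z = w f z powr P" for z
        by (simp add: F_def w_def powr_mult exp_powr_real mult_ac)
      have F0: "F z \<ge> 0" for z by (simp add: F_def)
      have f_meas: "f \<in> borel_measurable lborel"
        using holomorphic_on_imp_continuous_on[OF fh] by (simp add: borel_measurable_continuous_onI)
      have lp_meas: "log_plus \<in> borel_measurable borel" unfolding log_plus_def by measurable
      have F_meas: "F \<in> borel_measurable lborel"
        unfolding F_def using f_meas lp_meas by measurable
      define s where "s n = G powr P * exp (- real n / \<alpha>) * v b n powr P" for n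
      have s0: "s n \<ge> 0" for n by (simp add: s_def)
      define R where "R n = exp ((real n + 1) / (2 * \<alpha>))" for n
      have zR: "z \<in> ball 0 (R (N z))" for z
      proof -
        have "cmod z \<le> exp (log_plus (cmod z))" by (rule le_exp_log_plus)
        also have "log_plus (cmod z) < (real (N z) + 1) / (2 * \<alpha>)" using N(2)[of z] assms by (simp add: field_simps)
        then have "exp (log_plus (cmod z)) < R (N z)" by (simp add: R_def)
        finally show ?thesis by simp
      qed
      have Fs: "F z \<le> s (N z)" for z
      proof -
        have "F z \<le> (G * exp (- q * log_plus (cmod z)) * v b (N z)) powr P"
          unfolding Fw using bound[OF b, of z] P unfolding f_def by (intro powr_mono2) (auto simp: w_def)
        also have "\<dots> = G powr P * exp (- (q*P) * log_plus (cmod z)) * v b (N z) powr P"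
          using G v0[OF b] by (simp add: powr_mult exp_powr_real mult_ac)
        also have "\<dots> \<le> s (N z)" unfolding s_def q
          by (intro mult_right_mono mult_left_mono) (use N(1)[of z] assms in \<open>auto simp: field_simps\<close>)
        finally show ?thesis .
      qed
      \<comment> \<open>Whole discs of radius \<open>R n\<close> replace the annuli: their areas
        grow geometrically, so only a constant is lost and each area is explicit.\<close>
      have "(\<integral>\<^sup>+z. ennreal (F z) \<partial>lborel) \<le> (\<integral>\<^sup>+z. (\<Sum>n. ennreal (s n) * indicator (ball (0::complex) (R n)) z) \<partial>lborel)"
      proof (rule nn_integral_mono)
        fix z :: complex
        have "ennreal (F z) \<le> ennreal (s (N z)) * indicator (ball 0 (R (N z))) z"
          using Fs[of z] zR[of z] by (simp add: ennreal_leI)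
        also have "\<dots> \<le> (\<Sum>n. ennreal (s n) * indicator (ball 0 (R n)) z)"
          using sum_le_suminf[of "\<lambda>n. ennreal (s n) * indicator (ball 0 (R n)) z" "{N z}"]
          by (simp del: sum_mult_indicator)
        finally show "ennreal (F z) \<le> (\<Sum>n. ennreal (s n) * indicator (ball 0 (R n)) z)" .
      qed
      also have "\<dots> = (\<Sum>n. ennreal (s n) * emeasure lborel (ball (0::complex) (R n)))"
      proof (subst nn_integral_suminf)
        show "(\<lambda>z::complex. ennreal (s n) * indicator (ball 0 (R n)) z) \<in> borel_measurable lborel" for n
          by (intro borel_measurable_times_ennreal borel_measurable_const borel_measurable_indicator) auto
        show "(\<Sum>n. \<integral>\<^sup>+z. ennreal (s n) * indicator (ball (0::complex) (R n)) z \<partial>lborel) =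
            (\<Sum>n. ennreal (s n) * emeasure lborel (ball (0::complex) (R n)))"
          by (intro suminf_cong nn_integral_cmult_indicator) simp
      qed
      also have "\<dots> = (\<Sum>n. ennreal (pi * exp (1/\<alpha>) * G powr P * v b n powr P))"
      proof (intro suminf_cong)
        fix n
        have "(R n)\<^sup>2 = exp (real n / \<alpha>) * exp (1/\<alpha>)"
          unfolding R_def exp_double[symmetric] exp_add[symmetric] by (simp add: add_divide_distrib)
        then have "s n * (pi * (R n)\<^sup>2) = pi * exp (1/\<alpha>) * G powr P * v b n powr P"
          unfolding s_def by (simp add: exp_minus field_simps)
        moreover have "emeasure lborel (ball (0::complex) (R n)) = ennreal (pi * (R n)\<^sup>2)"
          by (rule emeasure_ball_complex) (simp add: R_def)
        ultimately show "ennreal (s n) * emeasure lborel (ball (0::complex) (R n)) =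
            ennreal (pi * exp (1/\<alpha>) * G powr P * v b n powr P)"
          using s0[of n] by (simp add: ennreal_mult[symmetric])
      qed
      also have "\<dots> \<le> ennreal (D * M powr P)"
      proof (rule suminf_le_const)
        fix n
        have "(\<Sum>i<n. ennreal (pi * exp (1/\<alpha>) * G powr P * v b i powr P)) =
            ennreal (\<Sum>i<n. pi * exp (1/\<alpha>) * G powr P * v b i powr P)"
          by (rule sum_ennreal) simp
        also have "(\<Sum>i<n. pi * exp (1/\<alpha>) * G powr P * v b i powr P) =
            pi * exp (1/\<alpha>) * G powr P * (\<Sum>i<n. v b i powr P)" by (simp add: sum_distrib_left)
        also have "(\<Sum>i<n. v b i powr P) \<le> (C * M) powr P"
          using vlp[OF b] False by (simp add: lp_bound_def P_def)
        then have "pi * exp (1/\<alpha>) * G powr P * (\<Sum>i<n. v b i powr P) \<le> pi * exp (1/\<alpha>) * G powr P * (C * M) powr P"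
          by (intro mult_left_mono) auto
        also have "\<dots> = D * M powr P" using C b by (simp add: D_def powr_mult)
        finally show "(\<Sum>i<n. ennreal (pi * exp (1/\<alpha>) * G powr P * v b i powr P)) \<le> ennreal (D * M powr P)"
          by (simp add: ennreal_leI)
      qed simp
      finally have nn: "(\<integral>\<^sup>+z. ennreal (F z) \<partial>lborel) \<le> ennreal (D * M powr P)" .
      have int: "integrable lborel F"
      proof (rule integrableI_nonneg[OF F_meas])
        show "(\<integral>\<^sup>+z. ennreal (F z) \<partial>lborel) < \<infinity>" using nn le_less_trans by fastforce
      qed (simp add: F0)
      have "ennreal (integral\<^sup>L lborel F) \<le> ennreal (D * M powr P)"
        using nn nn_integral_eq_integral[OF int] F0 by simp
      then have I: "integral\<^sup>L lborel F \<le> D * M powr P"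
        using D by (subst (asm) ennreal_le_iff) auto
      have "fock_norm p \<alpha> f = integral\<^sup>L lborel F powr (1/P)"
        using False by (simp add: fock_norm_def F_def[abs_def] P_def)
      also have "\<dots> \<le> (D * M powr P) powr (1/P)"
        using I P F0 by (intro powr_mono2) (auto intro: Bochner_Integration.integral_nonneg)
      also have "\<dots> = D powr (1/P) * M" using D P b by (simp add: powr_mult powr_powr)
      finally have "fock_norm p \<alpha> f \<le> D powr (1/P) * M" .
      moreover have "f \<in> fock_space p \<alpha>" using False fh int by (simp add: fock_space_def F_def[abs_def] P_def)
      ultimately show "gauss_series \<beta> q b \<in> fock_space p \<alpha> \<and> fock_norm p \<alpha> (gauss_series \<beta> q b) \<le> D powr (1/P) * M"
        by (simp add: f_def)
    qed (use D in auto)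
  qed
qed

section \<open>Lagrange interpolation at perturbed integers\<close>

lemma exp_sum_prod_le:
  fixes x :: "'a \<Rightarrow> real"
  assumes "\<And>i. i \<in> I \<Longrightarrow> 0 \<le> x i" "sum x I \<le> K"
  shows "(\<Prod>i\<in>I. (1 + x i)) \<le> exp K"
proof (cases "finite I")
  case True
  have "(\<Prod>i\<in>I. (1 + x i)) \<le> (\<Prod>i\<in>I. exp (x i))"
    using assms exp_ge_add_one_self by (intro prod_mono) (auto intro: add_nonneg_nonneg)
  also have "\<dots> = exp (sum x I)" using True by (simp add: exp_sum)
  finally show ?thesis using assms(2) by (meson exp_le_cancel_iff order_trans)
next
  case False
  then show ?thesis using assms by simp
qed

lemma poly_sums: "(\<lambda>l. coeff Q l * z ^ l) sums poly Q (z::complex)"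
proof -
  have "(\<lambda>l. coeff Q l * z ^ l) sums (\<Sum>l\<le>degree Q. coeff Q l * z ^ l)"
    by (rule sums_finite) (auto simp: coeff_eq_0)
  then show ?thesis by (simp add: poly_altdef)
qed

lemma poly_coeff_le:
  assumes "\<And>z. cmod z = r \<Longrightarrow> cmod (poly Q z) \<le> B" "0 < r"
  shows "cmod (coeff Q j) * r ^ j \<le> B"
proof -
  have h: "poly Q holomorphic_on UNIV" using power_series_entire(1)[OF poly_sums] .
  obtain z where "cmod z = r" "cmod ((deriv ^^ j) (poly Q) 0 / fact j) * r ^ j \<le> cmod (poly Q z)"
    using coeff_le_sphere[OF h assms(2)] by metis
  then show ?thesis using power_series_entire(2)[OF poly_sums, of Q j] assms(1)[of z] by simp
qed

text \<open>Half of the rate is traded for a factor that tends to 0 with the truncation index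
  \<open>n\<close>; the other half remains for summation.\<close>

lemma exp_dist_shift:
  assumes "real n \<le> x" "0 < \<eta>"
  shows "exp (- (2 * \<eta>) * \<bar>x - t\<bar>) \<le> exp (- \<eta> * (real n - t)) * exp (- \<eta> * \<bar>x - t\<bar>)"
proof -
  have "\<eta> * (real n - t) \<le> \<eta> * \<bar>x - t\<bar>" using assms by (intro mult_left_mono) auto
  then show ?thesis by (simp add: exp_add[symmetric])
qed

section \<open>Values at the dilated nodes, normalised to Gaussian matrix entries\<close>

locale gauss_nodes =
  fixes \<beta> :: real and \<omega> :: "nat \<Rightarrow> complex" and \<tau> :: "nat \<Rightarrow> real"
  assumes \<beta>_pos: "0 < \<beta>"
    and norm_\<omega>: "\<And>k. cmod (\<omega> k) = exp (2 * \<beta> * \<tau> k)"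
    and inj_\<omega>: "inj \<omega>"
    and mono_\<tau>: "\<And>i j. i \<le> j \<Longrightarrow> \<tau> i \<le> \<tau> j"
begin

text \<open>This is the matrix of the overview applied to \<open>b\<close>: the exponential factor
  removes from the monomials at the node the part that does not depend on l, which leaves entries of
  modulus exp (- \<beta> (l - \<tau> k)^2).\<close>

definition val :: "(nat \<Rightarrow> complex) \<Rightarrow> nat \<Rightarrow> complex" where
  "val b k = gauss_series \<beta> 0 b (\<omega> k) * exp (- \<beta> * (\<tau> k)\<^sup>2)"

lemma val_summable:
  assumes "\<And>l. cmod (b l) \<le> M"
  shows "summable (\<lambda>l. exp (- \<beta> * (real l - x)\<^sup>2) * cmod (b l))"
proof (rule summable_comparison_test_ev[OF always_eventually, OF allI])
  show "summable (\<lambda>l. exp (1\<^sup>2 / (4*\<beta>)) * exp (- 1 * \<bar>real l - x\<bar>) * M)"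
    by (intro summable_mult2 summable_mult spread_exp_summable spread_real) simp
  show "norm (exp (- \<beta> * (real l - x)\<^sup>2) * cmod (b l)) \<le> exp (1\<^sup>2 / (4*\<beta>)) * exp (- 1 * \<bar>real l - x\<bar>) * M" for l
    by (subst real_norm_def, subst abs_of_nonneg) (auto intro!: mult_mono gauss_le[OF \<beta>_pos, of _ 1, simplified] assms)
qed

lemma val_le:
  assumes "\<And>l. cmod (b l) \<le> M"
  shows "cmod (val b k) \<le> (\<Sum>l. exp (- \<beta> * (real l - \<tau> k)\<^sup>2) * cmod (b l))"
proof -
  have eq: "cmod (b l) * (exp (- \<beta> * (real l + 0)\<^sup>2) * cmod (\<omega> k) ^ l) =
      exp (\<beta> * (\<tau> k)\<^sup>2) * (exp (- \<beta> * (real l - \<tau> k)\<^sup>2) * cmod (b l))" for l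
    using gauss_monomial[of \<beta> l 0 "\<tau> k"] by (simp add: norm_\<omega>)
  have "cmod (val b k) \<le> (\<Sum>l. cmod (b l) * (exp (- \<beta> * (real l + 0)\<^sup>2) * cmod (\<omega> k) ^ l)) * exp (- \<beta> * (\<tau> k)\<^sup>2)"
    unfolding val_def norm_mult using gauss_series_sums(2)[of \<beta> b M 0 "\<omega> k", OF \<beta>_pos assms] by (simp add: norm_\<omega>)
  also have "\<dots> = (\<Sum>l. exp (- \<beta> * (real l - \<tau> k)\<^sup>2) * cmod (b l)) * (exp (\<beta> * (\<tau> k)\<^sup>2) * exp (- \<beta> * (\<tau> k)\<^sup>2))"
    unfolding eq by (subst suminf_mult[OF val_summable[OF assms]]) simp
  finally show ?thesis by (simp add: exp_add[symmetric])
qed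

text \<open>Even exponentially growing coefficients are summable against a Gaussian row. This lets
  \<open>val\<close> pass to limits whose error grows exponentially in the coefficient
  index.\<close>

lemma gauss_exp_summable:
  assumes "\<And>l. 0 \<le> u l" "\<And>l. u l \<le> M * exp (s * real l)"
  shows "summable (\<lambda>l. exp (- \<beta> * (real l - x)\<^sup>2) * u l)"
proof (rule summable_comparison_test_ev[OF always_eventually, OF allI])
  let ?s = "\<bar>s\<bar> + 1"
  show "summable (\<lambda>l. exp (?s\<^sup>2 / (4*\<beta>)) * exp (\<bar>s\<bar> * \<bar>x\<bar>) * \<bar>M\<bar> * exp (- 1 * \<bar>real l - x\<bar>))"
    by (intro summable_mult spread_exp_summable spread_real) simp
  fix l
  have "s * real l \<le> \<bar>s\<bar> * \<bar>real l - x\<bar> + \<bar>s\<bar> * \<bar>x\<bar>"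
  proof -
    have "s * real l \<le> \<bar>s\<bar> * \<bar>real l\<bar>" by (metis abs_ge_self abs_mult)
    also have "\<dots> \<le> \<bar>s\<bar> * (\<bar>real l - x\<bar> + \<bar>x\<bar>)" by (intro mult_left_mono) auto
    finally show ?thesis by (simp add: distrib_left)
  qed
  then have "exp (s * real l) \<le> exp (\<bar>s\<bar> * \<bar>real l - x\<bar>) * exp (\<bar>s\<bar> * \<bar>x\<bar>)"
    by (simp add: exp_add[symmetric])
  then have "\<bar>M\<bar> * exp (s * real l) \<le> \<bar>M\<bar> * (exp (\<bar>s\<bar> * \<bar>real l - x\<bar>) * exp (\<bar>s\<bar> * \<bar>x\<bar>))"
    by (intro mult_left_mono) auto
  moreover have "u l \<le> \<bar>M\<bar> * exp (s * real l)"
  proof -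
    have "M * exp (s * real l) \<le> \<bar>M\<bar> * exp (s * real l)" by (rule mult_right_mono) auto
    then show ?thesis using assms(2)[of l] by linarith
  qed
  ultimately have "u l \<le> \<bar>M\<bar> * (exp (\<bar>s\<bar> * \<bar>real l - x\<bar>) * exp (\<bar>s\<bar> * \<bar>x\<bar>))" by linarith
  then have "exp (- \<beta> * (real l - x)\<^sup>2) * u l \<le>
    (exp (?s\<^sup>2 / (4*\<beta>)) * exp (- ?s * \<bar>real l - x\<bar>)) * (\<bar>M\<bar> * (exp (\<bar>s\<bar> * \<bar>real l - x\<bar>) * exp (\<bar>s\<bar> * \<bar>x\<bar>)))"
    using assms(1) by (intro mult_mono gauss_le \<beta>_pos) auto
  also have "\<dots> = exp (?s\<^sup>2 / (4*\<beta>)) * exp (\<bar>s\<bar> * \<bar>x\<bar>) * \<bar>M\<bar> * (exp (- ?s * \<bar>real l - x\<bar>) * exp (\<bar>s\<bar> * \<bar>real l - x\<bar>))"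
    by (simp only: mult_ac)
  also have "exp (- ?s * \<bar>real l - x\<bar>) * exp (\<bar>s\<bar> * \<bar>real l - x\<bar>) = exp (- 1 * \<bar>real l - x\<bar>)"
    unfolding exp_add[symmetric] by (simp add: algebra_simps)
  finally show "norm (exp (- \<beta> * (real l - x)\<^sup>2) * u l) \<le>
     exp (?s\<^sup>2 / (4*\<beta>)) * exp (\<bar>s\<bar> * \<bar>x\<bar>) * \<bar>M\<bar> * exp (- 1 * \<bar>real l - x\<bar>)"
    using assms(1)[of l] by simp
qed

lemma val_bounded:
  obtains C where "0 < C" "\<And>b M k. (\<And>l. cmod (b l) \<le> M) \<Longrightarrow> cmod (val b k) \<le> C * M"
proof -
  obtain K1 where K1: "0 < K1" "\<And>t. (\<Sum>l. exp (- 1 * \<bar>real l - t\<bar>)) \<le> K1"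
    using spread_exp_sum[OF spread_real zero_less_one] by blast
  define G where "G = exp (1\<^sup>2 / (4*\<beta>))"
  show ?thesis
  proof (rule that[of "G * K1"])
    show "0 < G * K1" using K1 by (simp add: G_def)
    fix b :: "nat \<Rightarrow> complex" and M k assume b: "\<And>l. cmod (b l) \<le> (M::real)"
    have M: "0 \<le> M" using b[of 0] norm_ge_zero order_trans by blast
    have "cmod (val b k) \<le> (\<Sum>l. exp (- \<beta> * (real l - \<tau> k)\<^sup>2) * cmod (b l))" by (rule val_le[OF b])
    also have "\<dots> \<le> (\<Sum>l. (G * M) * exp (- 1 * \<bar>real l - \<tau> k\<bar>))"
    proof (rule suminf_le[OF _ val_summable[OF b]])
      show "summable (\<lambda>l. (G * M) * exp (- 1 * \<bar>real l - \<tau> k\<bar>))"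
        by (intro summable_mult spread_exp_summable spread_real) simp
      fix l
      have "exp (- \<beta> * (real l - \<tau> k)\<^sup>2) * cmod (b l) \<le> (G * exp (- 1 * \<bar>real l - \<tau> k\<bar>)) * M"
        unfolding G_def by (intro mult_mono gauss_le \<beta>_pos b) auto
      then show "exp (- \<beta> * (real l - \<tau> k)\<^sup>2) * cmod (b l) \<le> (G * M) * exp (- 1 * \<bar>real l - \<tau> k\<bar>)"
        by (simp add: mult_ac)
    qed
    also have "\<dots> = (G * M) * (\<Sum>l. exp (- 1 * \<bar>real l - \<tau> k\<bar>))"
      by (intro suminf_mult spread_exp_summable spread_real) simp
    also have "\<dots> \<le> (G * M) * K1" using M by (intro mult_left_mono K1) (auto simp: G_def)
    finally show "cmod (val b k) \<le> G * K1 * M" by (simp add: mult_ac)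
  qed
qed

lemma val_add:
  assumes "\<And>l. cmod (b l) \<le> M" "\<And>l. cmod (c l) \<le> N"
  shows "val (\<lambda>l. b l + c l) k = val b k + val c k"
proof -
  have "(\<lambda>l. b l * exp (- \<beta> * (real l + 0)\<^sup>2) * \<omega> k ^ l + c l * exp (- \<beta> * (real l + 0)\<^sup>2) * \<omega> k ^ l)
     sums (gauss_series \<beta> 0 b (\<omega> k) + gauss_series \<beta> 0 c (\<omega> k))"
    by (intro sums_add gauss_series_sums(1)[OF \<beta>_pos assms(1)] gauss_series_sums(1)[OF \<beta>_pos assms(2)])
  then have "gauss_series \<beta> 0 (\<lambda>l. b l + c l) (\<omega> k) = gauss_series \<beta> 0 b (\<omega> k) + gauss_series \<beta> 0 c (\<omega> k)"
    unfolding gauss_series_def[of _ _ "\<lambda>l. b l + c l"] by (simp add: sums_iff distrib_right)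
  then show ?thesis by (simp add: val_def distrib_right)
qed

lemma val_scale:
  assumes "\<And>l. cmod (b l) \<le> M"
  shows "val (\<lambda>l. a * b l) k = a * val b k"
proof -
  have "(\<lambda>l. a * (b l * exp (- \<beta> * (real l + 0)\<^sup>2) * \<omega> k ^ l)) sums (a * gauss_series \<beta> 0 b (\<omega> k))"
    by (intro sums_mult gauss_series_sums(1)[OF \<beta>_pos assms(1)])
  then have "gauss_series \<beta> 0 (\<lambda>l. a * b l) (\<omega> k) = a * gauss_series \<beta> 0 b (\<omega> k)"
    unfolding gauss_series_def[of _ _ "\<lambda>l. a * b l"] by (simp add: sums_iff mult.assoc)
  then show ?thesis by (simp add: val_def)
qed

lemma val_diff:
  assumes "\<And>l. cmod (b l) \<le> M" "\<And>l. cmod (c l) \<le> N"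
  shows "val (\<lambda>l. b l - c l) k = val b k - val c k"
  using val_add[of b M "\<lambda>l. (-1) * c l" N k] val_scale[of c N "-1" k] assms by simp

definition coeffs_of :: "complex poly \<Rightarrow> nat \<Rightarrow> complex" where
  "coeffs_of Q l = coeff Q l * exp (\<beta> * (real l)\<^sup>2)"

lemma gauss_series_coeffs_of: "gauss_series \<beta> 0 (coeffs_of Q) z = poly Q z"
  using poly_sums[of Q z] unfolding gauss_series_def coeffs_of_def
  by (simp add: sums_iff mult.assoc exp_minus_inverse flip: of_real_mult exp_add)

lemma val_coeffs_of: "val (coeffs_of Q) k = poly Q (\<omega> k) * exp (- \<beta> * (\<tau> k)\<^sup>2)"
  by (simp add: val_def gauss_series_coeffs_of)

text \<open>In terms of the two moduli each factor is at most max (1 + min/max), and min/max is exp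
  (- 2\<beta> |\<tau> i - t|), which is summable over a spread sequence. Up to a constant, products
  of distances are thus bounded by products of maxima.\<close>

lemma prod_dist_le:
  assumes "(\<Sum>i\<in>I. exp (- (2*\<beta>) * \<bar>\<tau> i - t\<bar>)) \<le> K" "cmod z = exp (2*\<beta>*t)" "finite I"
  shows "(\<Prod>i\<in>I. cmod (z - \<omega> i)) \<le> exp (2*\<beta> * (\<Sum>i\<in>I. max t (\<tau> i))) * exp K"
proof -
  have b2: "2 * \<beta> > 0" using \<beta>_pos by simp
  define x where "x i = exp (- (2*\<beta>) * \<bar>\<tau> i - t\<bar>)" for i
  have "cmod (z - \<omega> i) \<le> exp (2*\<beta>*max t (\<tau> i)) * (1 + x i)" for i
  proof -
    have "exp (2*\<beta>*max t (\<tau> i)) * x i = exp (2*\<beta>*min t (\<tau> i))"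
      unfolding x_def exp_add[symmetric] by (auto simp: max_def min_def algebra_simps)
    moreover have "cmod (z - \<omega> i) \<le> exp (2*\<beta>*t) + exp (2*\<beta>*\<tau> i)"
      using norm_triangle_ineq4[of z "\<omega> i"] assms(2) by (simp add: norm_\<omega>)
    moreover have "exp (2*\<beta>*t) + exp (2*\<beta>*\<tau> i) = exp (2*\<beta>*max t (\<tau> i)) + exp (2*\<beta>*min t (\<tau> i))"
      by (simp add: max_def min_def)
    ultimately show ?thesis by (simp add: distrib_left)
  qed
  then have "(\<Prod>i\<in>I. cmod (z - \<omega> i)) \<le> (\<Prod>i\<in>I. exp (2*\<beta>*max t (\<tau> i)) * (1 + x i))"
    by (intro prod_mono) auto
  also have "\<dots> = exp (2*\<beta> * (\<Sum>i\<in>I. max t (\<tau> i))) * (\<Prod>i\<in>I. 1 + x i)"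
    using assms(3) by (simp add: prod.distrib exp_sum sum_distrib_left)
  also have "\<dots> \<le> exp (2*\<beta> * (\<Sum>i\<in>I. max t (\<tau> i))) * exp K"
    by (intro mult_left_mono exp_sum_prod_le) (use assms(1) in \<open>auto simp: x_def\<close>)
  finally show ?thesis .
qed

end

text \<open>The averages are controlled over arbitrary intervals, at the cost of the additive
  \<open>C0\<close>: the entry (j, k) of an inverse section involves the sum of the deviations over
  exactly the indices between j and k.\<close>

locale good_nodes = gauss_nodes +
  fixes K s \<epsilon> C0 :: real
  assumes dev: "\<And>k. \<bar>\<tau> k - real k\<bar> \<le> K"
    and s: "0 < s" "s \<le> 1"
    and sep: "\<And>i k. i \<noteq> k \<Longrightarrow> s * max (cmod (\<omega> i)) (cmod (\<omega> k)) \<le> cmod (\<omega> i - \<omega> k)"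
    and \<epsilon>: "0 < \<epsilon>"
    and avg: "\<And>i j. i \<le> j \<Longrightarrow> \<bar>\<Sum>m=i..<j. (\<tau> m - real m)\<bar> \<le> (1/2 - \<epsilon>) * (real j - real i) + C0"
begin

lemma spread_\<tau>: "spread \<tau>"
  using spread_bounded_diff[of \<tau> K] dev by blast

text \<open>Up to the factor \<beta> and a constant, this is the logarithm of the bound for the
  entry (j, k). Writing the partial sums of \<tau> as m (m - 1) / 2 + \<Delta> m, the quadratic
  terms cancel, the indices beyond both j and k drop out, and what is left is - |j - k| plus twice a
  difference of \<Delta>, up to a constant. The average condition uses up at most (1 - 2\<epsilon>)
  |j - k| of that.\<close>

lemma lagrange_exponent:
  obtains C1 where "\<And>n j k. \<lbrakk>j < n; k < n\<rbrakk> \<Longrightarrow>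
     (\<tau> k)\<^sup>2 - (real j)\<^sup>2 + 2 * (\<Sum>i\<in>{..<n}-{k}. max (real j) (\<tau> i) - max (\<tau> k) (\<tau> i)) \<le> - 2 * \<epsilon> * \<bar>real j - real k\<bar> + C1"
proof -
  have K0: "K \<ge> 0" using dev[of 0] by linarith
  define C2 where "C2 = K * exp K * (2 / (1 - exp (-1)))"
  define \<Delta> where "\<Delta> m = (\<Sum>i<m. \<tau> i - real i)" for m
  define \<Theta> where "\<Theta> m = (\<Sum>i<m. \<tau> i)" for m
  have \<Theta>: "\<Theta> m = real m * (real m - 1) / 2 + \<Delta> m" for m
  proof -
    have "(\<Sum>i<m. real i) = real m * (real m - 1) / 2" by (induction m) (auto simp: field_simps)
    then show ?thesis by (simp add: \<Theta>_def \<Delta>_def sum_subtractf)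
  qed
  have \<Theta>diff: "\<Theta> n - \<Theta> m = (\<Sum>i=m..<n. \<tau> i)" if "m \<le> n" for m n
    unfolding \<Theta>_def using sum_diff_nat_ivl[of 0 m n \<tau>] that by (simp add: atLeast0LessThan)
  have \<Delta>diff: "\<bar>\<Delta> n - \<Delta> m\<bar> \<le> (1/2 - \<epsilon>) * (real n - real m) + C0" if "m \<le> n" for m n
  proof -
    have "\<Delta> n - \<Delta> m = (\<Sum>i=m..<n. \<tau> i - real i)"
      unfolding \<Delta>_def using sum_diff_nat_ivl[of 0 m n "\<lambda>i. \<tau> i - real i"] that by (simp add: atLeast0LessThan)
    then show ?thesis using avg[OF that] by simp
  qed
  have main: "(\<tau> k)\<^sup>2 - (real j)\<^sup>2 + 2 * (\<Sum>i\<in>{..<n}-{k}. max (real j) (\<tau> i) - max (\<tau> k) (\<tau> i))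
      \<le> - 2 * \<epsilon> * \<bar>real j - real k\<bar> + (K\<^sup>2 + 2 * C2 + 2 * K + 2 * C0)" if jk: "j < n" "k < n" for n j k
  proof -
    \<comment> \<open>Deciding by i < j instead of comparing j with \<tau> i is wrong only if |i -
      j| < K, and then by at most \<open>K\<close>; the exponential term majorises that error and is
      summable.\<close>
    have e: "max (real j) (\<tau> i) \<le> (if i < j then real j else \<tau> i) + K * exp K * exp (- 1 * \<bar>real i - real j\<bar>)" for i
    proof -
      have i: "\<bar>\<tau> i - real i\<bar> \<le> K" by (rule dev)
      show ?thesis
      proof (cases "\<bar>real i - real j\<bar> < K")
        case True
        then have "K * 1 \<le> K * exp (K - \<bar>real i - real j\<bar>)" using K0 by (intro mult_left_mono) auto
        then have "K \<le> K * exp K * exp (- 1 * \<bar>real i - real j\<bar>)" by (simp add: exp_diff exp_minus divide_inverse)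
        moreover have "max (real j) (\<tau> i) \<le> (if i < j then real j else \<tau> i) + K" using i K0 by auto
        ultimately show ?thesis by linarith
      next
        case False
        then have "max (real j) (\<tau> i) \<le> (if i < j then real j else \<tau> i)" using i by auto
        moreover have "0 \<le> K * exp K * exp (- 1 * \<bar>real i - real j\<bar>)" using K0 by simp
        ultimately show ?thesis by linarith
      qed
    qed
    have "(\<Sum>i<n. max (real j) (\<tau> i)) \<le> (\<Sum>i<n. (if i < j then real j else \<tau> i) + K * exp K * exp (- 1 * \<bar>real i - real j\<bar>))"
      by (intro sum_mono e)
    also have "\<dots> = (\<Sum>i<n. if i < j then real j else \<tau> i) + K * exp K * (\<Sum>i<n. exp (- 1 * \<bar>real i - real j\<bar>))"
      by (simp add: sum.distrib sum_distrib_left)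
    also have "(\<Sum>i<n. exp (- 1 * \<bar>real i - real j\<bar>)) \<le> 2 / (1 - exp (-1))"
      by (rule sum_geometric_dist) simp
    then have "K * exp K * (\<Sum>i<n. exp (- 1 * \<bar>real i - real j\<bar>)) \<le> C2"
      unfolding C2_def using K0 by (intro mult_left_mono) auto
    also have "(\<Sum>i<n. if i < j then real j else \<tau> i) = real j * real j + (\<Theta> n - \<Theta> j)"
    proof -
      have "(\<Sum>i<n. if i < j then real j else \<tau> i) = (\<Sum>i\<in>{0..<j}. if i < j then real j else \<tau> i) + (\<Sum>i=j..<n. if i < j then real j else \<tau> i)"
        unfolding atLeast0LessThan[symmetric]
        by (rule sum.atLeastLessThan_concat[OF le0 less_imp_le[OF jk(1)], symmetric])
      also have "(\<Sum>i\<in>{0..<j}. if i < j then real j else \<tau> i) = real j * real j" by simp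
      also have "(\<Sum>i=j..<n. if i < j then real j else \<tau> i) = \<Theta> n - \<Theta> j"
        using jk by (subst \<Theta>diff) (auto intro: sum.cong)
      finally show ?thesis .
    qed
    finally have A1: "(\<Sum>i<n. max (real j) (\<tau> i)) \<le> real j * real j + (\<Theta> n - \<Theta> j) + C2" by simp
    have A2: "(\<Sum>i<n. max (\<tau> k) (\<tau> i)) = real k * \<tau> k + (\<Theta> n - \<Theta> k)"
    proof -
      have "(\<Sum>i<n. max (\<tau> k) (\<tau> i)) = (\<Sum>i\<in>{0..<k}. max (\<tau> k) (\<tau> i)) + (\<Sum>i=k..<n. max (\<tau> k) (\<tau> i))"
        unfolding atLeast0LessThan[symmetric]
        by (rule sum.atLeastLessThan_concat[OF le0 less_imp_le[OF jk(2)], symmetric])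
      also have "(\<Sum>i\<in>{0..<k}. max (\<tau> k) (\<tau> i)) = (\<Sum>i\<in>{0..<k}. \<tau> k)"
        by (intro sum.cong refl) (use mono_\<tau> in \<open>auto simp: max_absorb1\<close>)
      also have "(\<Sum>i=k..<n. max (\<tau> k) (\<tau> i)) = \<Theta> n - \<Theta> k"
        using jk by (subst \<Theta>diff) (auto intro!: sum.cong max_absorb2 mono_\<tau>)
      finally show ?thesis by simp
    qed
    have "(\<Sum>i\<in>{..<n}-{k}. max (real j) (\<tau> i) - max (\<tau> k) (\<tau> i)) =
        (\<Sum>i<n. max (real j) (\<tau> i) - max (\<tau> k) (\<tau> i)) - (max (real j) (\<tau> k) - max (\<tau> k) (\<tau> k))"
      using jk by (subst sum_diff1) auto
    also have "\<dots> \<le> real j * real j + \<Theta> k - \<Theta> j + C2 - real k * \<tau> k - max (real j) (\<tau> k) + \<tau> k"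
      using A1 A2 by (simp add: sum_subtractf)
    finally have S0: "(\<Sum>i\<in>{..<n}-{k}. max (real j) (\<tau> i) - max (\<tau> k) (\<tau> i)) \<le>
      real j * real j + \<Theta> k - \<Theta> j + C2 - real k * \<tau> k - max (real j) (\<tau> k) + \<tau> k" .
    have T: "2 * \<Theta> m = real m * real m - real m + 2 * \<Delta> m" for m
      unfolding \<Theta> by (simp add: field_simps)
    \<comment> \<open>The two quadratic sums have left the linear term j - k. For j >= k the
      subtracted maximum turns it into - (j - k), up to 2 K; for j < k it already has the right
      sign.\<close>
    have S: "(\<tau> k)\<^sup>2 - (real j)\<^sup>2 + 2 * (\<Sum>i\<in>{..<n}-{k}. max (real j) (\<tau> i) - max (\<tau> k) (\<tau> i)) \<le>
       (\<tau> k - real k)\<^sup>2 + 2 * C2 + (real j - real k) - 2 * (max (real j) (\<tau> k) - \<tau> k) + 2 * (\<Delta> k - \<Delta> j)"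
      using S0 T[of k] T[of j] by (simp add: power2_eq_square algebra_simps)
    have sq: "(\<tau> k - real k)\<^sup>2 \<le> K\<^sup>2" using dev[of k] by (metis abs_ge_zero power2_abs power_mono)
    have aux: "d - 2 * a + 2 * x \<le> t + 2 * K + 2 * C0"
      if "d - K \<le> a" "x \<le> h + C0" "h = d / 2 - e" "t = - 2 * e" for d a x t h e :: real
      using that by linarith
    have aux': "- d - 2 * a + 2 * x \<le> t + 2 * K + 2 * C0"
      if "0 \<le> K" "x \<le> h + C0" "0 \<le> a" "h = d / 2 - e" "t = - 2 * e" for d a x t h e :: real
      using that by linarith
    have "(real j - real k) - 2 * (max (real j) (\<tau> k) - \<tau> k) + 2 * (\<Delta> k - \<Delta> j) \<le> - 2 * \<epsilon> * \<bar>real j - real k\<bar> + 2 * K + 2 * C0"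
    proof (cases "k \<le> j")
      case True
      have "max (real j) (\<tau> k) - \<tau> k \<ge> real j - real k - K" using dev[of k] by linarith
      moreover have "\<Delta> k - \<Delta> j \<le> (1/2 - \<epsilon>) * (real j - real k) + C0" using \<Delta>diff[OF True] by linarith
      moreover have "(1/2 - \<epsilon>) * (real j - real k) = (real j - real k) / 2 - \<epsilon> * (real j - real k)"
        by (simp add: left_diff_distrib)
      moreover have "- 2 * \<epsilon> * \<bar>real j - real k\<bar> = - 2 * (\<epsilon> * (real j - real k))" using True by simp
      ultimately show ?thesis by (rule aux)
    next
      case False
      then have "\<Delta> k - \<Delta> j \<le> (1/2 - \<epsilon>) * (real k - real j) + C0" using \<Delta>diff[of j k] by linarith
      moreover have "max (real j) (\<tau> k) - \<tau> k \<ge> 0" by simp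
      moreover have "(1/2 - \<epsilon>) * (real k - real j) = (real k - real j) / 2 - \<epsilon> * (real k - real j)"
        by (simp add: left_diff_distrib)
      moreover have "- 2 * \<epsilon> * \<bar>real j - real k\<bar> = - 2 * (\<epsilon> * (real k - real j))" using False by simp
      ultimately show ?thesis using aux'[OF K0, where d = "real k - real j" and a = "max (real j) (\<tau> k) - \<tau> k"] by (simp only: minus_diff_eq)
    qed
    then show ?thesis using S sq by linarith
  qed
  show ?thesis by (rule that[OF main])
qed

section \<open>Lagrange polynomials and inverses of finite sections\<close>

definition lag :: "nat \<Rightarrow> nat \<Rightarrow> complex poly" where
  "lag n k = (\<Prod>i\<in>{..<n}-{k}. smult (1 / (\<omega> k - \<omega> i)) [:- \<omega> i, 1:])"

lemma poly_lag: "poly (lag n k) z = (\<Prod>i\<in>{..<n}-{k}. (z - \<omega> i) / (\<omega> k - \<omega> i))"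
  by (simp add: lag_def poly_prod diff_divide_distrib)

lemma poly_lag_nodes:
  assumes "j < n" "k < n"
  shows "poly (lag n k) (\<omega> j) = (if j = k then 1 else 0)"
proof (cases "j = k")
  case True
  have "(\<Prod>i\<in>{..<n}-{k}. (\<omega> k - \<omega> i) / (\<omega> k - \<omega> i)) = (\<Prod>i\<in>{..<n}-{k}. 1)"
    using inj_\<omega> by (intro prod.cong refl) (auto dest: injD)
  then show ?thesis using True by (simp add: poly_lag)
next
  case False
  then show ?thesis using assms by (auto simp: poly_lag)
qed

lemma degree_lag:
  assumes "k < n"
  shows "degree (lag n k) < n"
proof -
  have "degree (lag n k) \<le> (\<Sum>i\<in>{..<n}-{k}. degree (smult (1 / (\<omega> k - \<omega> i)) [:- \<omega> i, 1:]))"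
    unfolding lag_def by (rule degree_prod_sum_le[unfolded o_def]) simp
  also have "\<dots> \<le> (\<Sum>i\<in>{..<n}-{k}. 1)" by (intro sum_mono) simp
  also have "\<dots> < n" using assms by simp
  finally show ?thesis .
qed

lemma lagrange_interpolation:
  assumes "\<And>l. l \<ge> n \<Longrightarrow> coeff Q l = 0"
  shows "Q = (\<Sum>k<n. smult (poly Q (\<omega> k)) (lag n k))"
proof (rule ccontr)
  define R where "R = Q - (\<Sum>k<n. smult (poly Q (\<omega> k)) (lag n k))"
  assume "Q \<noteq> (\<Sum>k<n. smult (poly Q (\<omega> k)) (lag n k))"
  then have R: "R \<noteq> 0" by (simp add: R_def)
  have coeffR: "coeff R l = 0" if "l \<ge> n" for l
  proof -
    have "coeff (lag n k) l = 0" if "k < n" for k using degree_lag[OF that] \<open>l \<ge> n\<close> by (simp add: coeff_eq_0)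
    then show ?thesis using assms that by (simp add: R_def coeff_sum)
  qed
  have deg: "degree R < n" using coeffR R by (metis leading_coeff_0_iff linorder_not_less)
  have "poly R (\<omega> j) = 0" if "j < n" for j
  proof -
    have "(\<Sum>k<n. poly Q (\<omega> k) * poly (lag n k) (\<omega> j)) = (\<Sum>k<n. if k = j then poly Q (\<omega> j) else 0)"
      using poly_lag_nodes[OF that] by (intro sum.cong refl) auto
    also have "\<dots> = poly Q (\<omega> j)" using that by simp
    finally show ?thesis by (simp add: R_def poly_sum)
  qed
  then have "\<omega> ` {..<n} \<subseteq> {x. poly R x = 0}" by auto
  then have "card (\<omega> ` {..<n}) \<le> card {x. poly R x = 0}" by (rule card_mono[OF poly_roots_finite[OF R]])
  also have "\<dots> \<le> degree R" by (rule card_poly_roots_bound[OF R])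
  finally show False using deg card_image[of \<omega> "{..<n}"] inj_\<omega> by (simp add: inj_on_subset)
qed

definition lagmat :: "nat \<Rightarrow> nat \<Rightarrow> nat \<Rightarrow> complex" where
  "lagmat n k j = coeffs_of (lag n k) j * exp (\<beta> * (\<tau> k)\<^sup>2)"

lemma lagmat_bound:
  obtains C where "0 < C" "\<And>n j k. k < n \<Longrightarrow> cmod (lagmat n k j) \<le> C * exp (- (2 * \<beta> * \<epsilon>) * \<bar>real j - real k\<bar>)"
proof -
  have b2: "2 * \<beta> > 0" using \<beta>_pos by simp
  obtain K1 where K1: "0 < K1" "\<And>t n. (\<Sum>i<n. exp (- (2*\<beta>) * \<bar>\<tau> i - t\<bar>)) \<le> K1"
    using spread_exp_sum_finite[OF spread_\<tau> b2] by blast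
  obtain C1 where C1: "\<And>n j k. \<lbrakk>j < n; k < n\<rbrakk> \<Longrightarrow>
     (\<tau> k)\<^sup>2 - (real j)\<^sup>2 + 2 * (\<Sum>i\<in>{..<n}-{k}. max (real j) (\<tau> i) - max (\<tau> k) (\<tau> i)) \<le> - 2 * \<epsilon> * \<bar>real j - real k\<bar> + C1"
    using lagrange_exponent by blast
  have K1': "(\<Sum>i\<in>{..<n}-{k}. exp (- (2*\<beta>) * \<bar>\<tau> i - t\<bar>)) \<le> K1" for t n k
    by (rule order_trans[OF sum_mono2 K1(2)[of t n]]) auto
  \<comment> \<open>One constant for both kinds of factors in the denominator. If x \<le> 1/2, then
    1 - x \<ge> exp (- 2x) and \<open>L\<close> is at least 2. If x > 1/2, separation provides the
    factor \<open>s\<close>, and exp (- L x) \<le> s because 2x > 1.\<close>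
  define L where "L = 2 - 2 * ln s"
  have L: "L \<ge> 2" using s by (simp add: L_def)
  have low: "(\<Prod>i\<in>{..<n}-{k}. max (exp (2*\<beta>*\<tau> k)) (exp (2*\<beta>*\<tau> i))) * exp (- L * K1) \<le> (\<Prod>i\<in>{..<n}-{k}. cmod (\<omega> k - \<omega> i))" for n k
  proof -
    define x where "x i = exp (- (2*\<beta>) * \<bar>\<tau> i - \<tau> k\<bar>)" for i
    have "max (exp (2*\<beta>*\<tau> k)) (exp (2*\<beta>*\<tau> i)) * exp (- L * x i) \<le> cmod (\<omega> k - \<omega> i)" if "i \<noteq> k" for i
    proof (cases "x i \<le> 1/2")
      case True
      have x0: "x i > 0" by (simp add: x_def)
      have m: "max (exp (2*\<beta>*\<tau> k)) (exp (2*\<beta>*\<tau> i)) * x i = min (exp (2*\<beta>*\<tau> k)) (exp (2*\<beta>*\<tau> i))"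
        using b2 unfolding x_def by (auto simp: max_def min_def exp_add[symmetric] abs_if algebra_simps)
      have "exp (- L * x i) \<le> 1 - x i"
      proof -
        have "1 + 2 * x i \<le> exp (2 * x i)" by (rule exp_ge_add_one_self)
        moreover have "1 \<le> (1 - x i) * (1 + 2 * x i)" using True x0 by (simp add: algebra_simps mult_left_le)
        ultimately have "1 \<le> (1 - x i) * exp (2 * x i)"
          using True mult_left_mono[of "1 + 2 * x i" "exp (2 * x i)" "1 - x i"] by linarith
        then have "exp (- 2 * x i) \<le> 1 - x i" by (simp add: exp_minus field_simps)
        moreover have "exp (- L * x i) \<le> exp (- 2 * x i)" using L x0 by simp
        ultimately show ?thesis by linarith
      qed
      then have "max (exp (2*\<beta>*\<tau> k)) (exp (2*\<beta>*\<tau> i)) * exp (- L * x i) \<le>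
          max (exp (2*\<beta>*\<tau> k)) (exp (2*\<beta>*\<tau> i)) * (1 - x i)" by (intro mult_left_mono) (auto simp: max_def)
      also have "\<dots> = max (exp (2*\<beta>*\<tau> k)) (exp (2*\<beta>*\<tau> i)) - min (exp (2*\<beta>*\<tau> k)) (exp (2*\<beta>*\<tau> i))"
        using m by (simp add: right_diff_distrib)
      also have "\<dots> \<le> cmod (\<omega> k - \<omega> i)"
        using norm_triangle_ineq2[of "\<omega> k" "\<omega> i"] norm_triangle_ineq3[of "\<omega> k" "\<omega> i"] unfolding norm_\<omega> by linarith
      finally show ?thesis .
    next
      case False
      then have "1 \<le> 2 * x i" by simp
      then have "(- ln s) * 1 \<le> (- ln s) * (2 * x i)" using s by (intro mult_left_mono) auto
      moreover have "x i > 0" by (simp add: x_def)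
      ultimately have "- L * x i \<le> ln s" unfolding L_def by (simp add: algebra_simps)
      then have "exp (- L * x i) \<le> s" using s by (metis exp_le_cancel_iff exp_ln)
      then have "max (exp (2*\<beta>*\<tau> k)) (exp (2*\<beta>*\<tau> i)) * exp (- L * x i) \<le>
          max (exp (2*\<beta>*\<tau> k)) (exp (2*\<beta>*\<tau> i)) * s" by (intro mult_left_mono) (auto simp: max_def)
      also have "\<dots> \<le> cmod (\<omega> k - \<omega> i)" using sep[of k i] that by (simp add: norm_\<omega> mult.commute)
      finally show ?thesis .
    qed
    then have "(\<Prod>i\<in>{..<n}-{k}. max (exp (2*\<beta>*\<tau> k)) (exp (2*\<beta>*\<tau> i)) * exp (- L * x i)) \<le> (\<Prod>i\<in>{..<n}-{k}. cmod (\<omega> k - \<omega> i))"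
      by (intro prod_mono) (auto simp: max_def)
    moreover have "exp (- L * K1) \<le> (\<Prod>i\<in>{..<n}-{k}. exp (- L * x i))"
    proof -
      have "L * (\<Sum>i\<in>{..<n}-{k}. x i) \<le> L * K1" unfolding x_def using L K1' by (intro mult_left_mono) auto
      then show ?thesis by (simp add: exp_sum[symmetric] sum_negf sum_distrib_left)
    qed
    then have "(\<Prod>i\<in>{..<n}-{k}. max (exp (2*\<beta>*\<tau> k)) (exp (2*\<beta>*\<tau> i))) * exp (- L * K1) \<le>
      (\<Prod>i\<in>{..<n}-{k}. max (exp (2*\<beta>*\<tau> k)) (exp (2*\<beta>*\<tau> i))) * (\<Prod>i\<in>{..<n}-{k}. exp (- L * x i))"
      by (intro mult_left_mono prod_nonneg) (auto simp: max_def)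
    ultimately show ?thesis by (simp add: prod.distrib)
  qed
  have mx: "(\<Prod>i\<in>I. max (exp (2*\<beta>*t)) (exp (2*\<beta>*\<tau> i))) = exp (2*\<beta> * (\<Sum>i\<in>I. max t (\<tau> i)))"
    if "finite I" for I t
  proof -
    have "max (exp (2*\<beta>*t)) (exp (2*\<beta>*\<tau> i)) = exp (2*\<beta>*max t (\<tau> i))" for i
      using b2 by (auto simp: max_def)
    then show ?thesis using that by (simp add: exp_sum[symmetric] sum_distrib_left)
  qed
  define C where "C = exp (K1 + L * K1) * exp (\<beta> * C1)"
  have "cmod (lagmat n k j) \<le> C * exp (- (2 * \<beta> * \<epsilon>) * \<bar>real j - real k\<bar>)" if kn: "k < n" for n j k
  proof (cases "j < n")
    case False
    then have "coeff (lag n k) j = 0" using degree_lag[OF kn] by (simp add: coeff_eq_0)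
    then show ?thesis by (simp add: lagmat_def coeffs_of_def C_def)
  next
    case True
    let ?I = "{..<n} - {k}"
    define r where "r = exp (2*\<beta>*real j)"
    have r0: "0 < r" by (simp add: r_def)
    define S1 where "S1 = (\<Sum>i\<in>?I. max (real j) (\<tau> i))"
    define S2 where "S2 = (\<Sum>i\<in>?I. max (\<tau> k) (\<tau> i))"
    have "cmod (poly (lag n k) z) \<le> exp (2*\<beta>*S1) * exp K1 / (exp (2*\<beta>*S2) * exp (- L * K1))" if z: "cmod z = r" for z
    proof -
      have "cmod (poly (lag n k) z) = (\<Prod>i\<in>?I. cmod (z - \<omega> i)) / (\<Prod>i\<in>?I. cmod (\<omega> k - \<omega> i))"
        by (simp add: poly_lag prod_norm[symmetric] norm_divide prod_dividef)
      also have "\<dots> \<le> exp (2*\<beta>*S1) * exp K1 / (exp (2*\<beta>*S2) * exp (- L * K1))"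
      proof (rule frac_le)
        show "(\<Prod>i\<in>?I. cmod (z - \<omega> i)) \<le> exp (2*\<beta>*S1) * exp K1"
          unfolding S1_def using z by (intro prod_dist_le K1') (auto simp: r_def)
        show "exp (2*\<beta>*S2) * exp (- L * K1) \<le> (\<Prod>i\<in>?I. cmod (\<omega> k - \<omega> i))"
          using low[of k n] by (simp add: mx S2_def)
      qed auto
      finally show ?thesis .
    qed
    then have "cmod (coeff (lag n k) j) * r ^ j \<le> exp (2*\<beta>*S1) * exp K1 / (exp (2*\<beta>*S2) * exp (- L * K1))"
      by (rule poly_coeff_le[OF _ r0])
    also have "\<dots> = exp (K1 + L * K1) * exp (2*\<beta>*(S1 - S2))"
      by (simp add: exp_add[symmetric] exp_diff[symmetric] algebra_simps)
    finally have c: "cmod (coeff (lag n k) j) * r ^ j \<le> exp (K1 + L * K1) * exp (2*\<beta>*(S1 - S2))" .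
    have rj: "r ^ j = exp (2 * \<beta> * (real j)\<^sup>2)" unfolding r_def exp_of_nat_mult[symmetric]
      by (simp add: power2_eq_square mult_ac)
    have "cmod (lagmat n k j) = (cmod (coeff (lag n k) j) * r ^ j) * exp (\<beta> * ((\<tau> k)\<^sup>2 - (real j)\<^sup>2))"
      unfolding lagmat_def coeffs_of_def norm_mult rj
      by (simp add: mult.assoc exp_add[symmetric] algebra_simps)
    also have "\<dots> \<le> (exp (K1 + L * K1) * exp (2*\<beta>*(S1 - S2))) * exp (\<beta> * ((\<tau> k)\<^sup>2 - (real j)\<^sup>2))"
      using c by (intro mult_right_mono) auto
    also have "\<dots> = exp (K1 + L * K1) * exp (\<beta> * ((\<tau> k)\<^sup>2 - (real j)\<^sup>2 + 2 * (S1 - S2)))"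
      by (simp add: mult.assoc exp_add[symmetric] algebra_simps)
    also have "\<dots> \<le> exp (K1 + L * K1) * exp (\<beta> * (- 2 * \<epsilon> * \<bar>real j - real k\<bar> + C1))"
    proof -
      have "(\<tau> k)\<^sup>2 - (real j)\<^sup>2 + 2 * (S1 - S2) \<le> - 2 * \<epsilon> * \<bar>real j - real k\<bar> + C1"
        using C1[OF True kn] by (simp add: S1_def S2_def sum_subtractf)
      then show ?thesis using \<beta>_pos by (intro mult_left_mono) auto
    qed
    also have "\<dots> = C * exp (- (2 * \<beta> * \<epsilon>) * \<bar>real j - real k\<bar>)"
      by (simp add: C_def mult.assoc exp_add[symmetric] algebra_simps)
    finally show ?thesis .
  qed
  moreover have "0 < C" by (simp add: C_def)
  ultimately show ?thesis using that by blast
qed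

definition \<sigma> where "\<sigma> = \<beta> * \<epsilon>"

lemma \<sigma>_pos: "0 < \<sigma>"
  using \<beta>_pos \<epsilon> by (simp add: \<sigma>_def)

lemma lagmat_interpolation:
  fixes b :: "nat \<Rightarrow> complex"
  assumes "\<And>l. l \<ge> n \<Longrightarrow> b l = 0"
  shows "b j = (\<Sum>k<n. val b k * lagmat n k j)"
proof -
  define Q where "Q = (\<Sum>l<n. monom (b l * exp (- \<beta> * (real l)\<^sup>2)) l)"
  have cQ: "coeff Q l = b l * exp (- \<beta> * (real l)\<^sup>2)" for l
    using assms[of l] by (cases "l < n") (auto simp: Q_def coeff_sum coeff_monom)
  have b: "b = coeffs_of Q"
    by (rule ext) (simp add: coeffs_of_def cQ mult.assoc flip: of_real_mult exp_add)
  have "Q = (\<Sum>k<n. smult (poly Q (\<omega> k)) (lag n k))"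
    by (rule lagrange_interpolation) (simp add: cQ assms)
  then have "coeff Q j = (\<Sum>k<n. poly Q (\<omega> k) * coeff (lag n k) j)"
    by (metis (no_types, lifting) coeff_smult coeff_sum sum.cong)
  then have "b j = (\<Sum>k<n. poly Q (\<omega> k) * coeff (lag n k) j) * exp (\<beta> * (real j)\<^sup>2)"
    by (simp add: b coeffs_of_def)
  also have "\<dots> = (\<Sum>k<n. val b k * lagmat n k j)"
    unfolding sum_distrib_right b val_coeffs_of lagmat_def
    by (intro sum.cong refl) (simp add: coeffs_of_def mult_ac exp_minus_inverse flip: of_real_mult)
  finally show ?thesis .
qed

lemma val_lagmat_sum:
  assumes "k < n"
  shows "val (\<lambda>j. \<Sum>i<n. c i * lagmat n i j) k = c k"
proof -
  define Q where "Q = (\<Sum>i<n. smult (c i * exp (\<beta> * (\<tau> i)\<^sup>2)) (lag n i))"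
  have "(\<lambda>j. \<Sum>i<n. c i * lagmat n i j) = coeffs_of Q"
    by (rule ext) (simp add: coeffs_of_def lagmat_def Q_def coeff_sum sum_distrib_left sum_distrib_right mult_ac)
  then have "val (\<lambda>j. \<Sum>i<n. c i * lagmat n i j) k = poly Q (\<omega> k) * exp (- \<beta> * (\<tau> k)\<^sup>2)"
    by (simp add: val_coeffs_of)
  also have "poly Q (\<omega> k) = (\<Sum>i<n. if i = k then c k * exp (\<beta> * (\<tau> k)\<^sup>2) else 0)"
    unfolding Q_def poly_sum poly_smult using poly_lag_nodes[OF assms] by (intro sum.cong refl) auto
  also have "\<dots> = c k * exp (\<beta> * (\<tau> k)\<^sup>2)" using assms by simp
  finally show ?thesis by (simp add: exp_minus_inverse mult.assoc flip: of_real_mult exp_add)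
qed

text \<open>Finite sections are inverted exactly by \<open>lagmat\<close>, so \<open>b\<close> is
  cut off at n first. The cut changes the value at node k by at most a multiple of exp (- \<sigma>
  (n - \<tau> k)). Of the decay rate 2\<sigma> of \<open>lagmat\<close>, one half beats the growth
  of this error in k, the other makes the sum converge, and the whole error tends to 0 with
  n.\<close>

lemma val_lower_bound:
  obtains C where "0 < C" "\<And>b M j. (\<And>l. cmod (b l) \<le> M) \<Longrightarrow>
    cmod (b j) \<le> C * (\<Sum>k. exp (- (2 * \<sigma>) * \<bar>real j - real k\<bar>) * cmod (val b k))"
proof -
  obtain C where C: "0 < C" "\<And>n j k. k < n \<Longrightarrow> cmod (lagmat n k j) \<le> C * exp (- (2 * \<beta> * \<epsilon>) * \<bar>real j - real k\<bar>)"
    using lagmat_bound by blast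
  have lm: "cmod (lagmat n k j) \<le> C * exp (- (2 * \<sigma>) * \<bar>real j - real k\<bar>)" if "k < n" for n k j
    using C(2)[OF that, of j] by (simp add: \<sigma>_def mult.assoc)
  obtain Cv where Cv: "0 < Cv" "\<And>b M k. (\<And>l. cmod (b l) \<le> M) \<Longrightarrow> cmod (val b k) \<le> Cv * M"
    using val_bounded by blast
  obtain K1 where K1: "0 < K1" "\<And>t. (\<Sum>l. exp (- \<sigma> * \<bar>real l - t\<bar>)) \<le> K1"
    using spread_exp_sum[OF spread_real \<sigma>_pos] by blast
  obtain K2 where K2: "0 < K2" "\<And>t n. (\<Sum>l<n. exp (- \<sigma> * \<bar>real l - t\<bar>)) \<le> K2"
    using spread_exp_sum_finite[OF spread_real \<sigma>_pos] by blast
  define G where "G = exp ((2*\<sigma>)\<^sup>2 / (4*\<beta>))"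
  have main: "cmod (b j) \<le> C * (\<Sum>k. exp (- (2 * \<sigma>) * \<bar>real j - real k\<bar>) * cmod (val b k))"
    if b: "\<And>l. cmod (b l) \<le> M" for b M j
  proof -
    have M: "0 \<le> M" using b[of 0] norm_ge_zero order_trans by blast
    define V where "V = (\<Sum>k. exp (- (2 * \<sigma>) * \<bar>real j - real k\<bar>) * cmod (val b k))"
    have Vs: "summable (\<lambda>k. exp (- (2 * \<sigma>) * \<bar>real j - real k\<bar>) * cmod (val b k))"
    proof (rule summable_comparison_test_ev[OF always_eventually, OF allI])
      show "summable (\<lambda>k. exp (- (2 * \<sigma>) * \<bar>real k - real j\<bar>) * (Cv * M))"
        by (intro summable_mult2 spread_exp_summable spread_real) (simp add: \<sigma>_pos)
      show "norm (exp (- (2 * \<sigma>) * \<bar>real j - real k\<bar>) * cmod (val b k)) \<le> exp (- (2 * \<sigma>) * \<bar>real k - real j\<bar>) * (Cv * M)" for k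
        using Cv(2)[of b M k, OF b] by (simp add: abs_minus_commute)
    qed
    define D where "D = C * (G * M * K1 * exp (\<sigma> * K)) * K2"
    have ineq: "cmod (b j) \<le> C * V + D * exp (- \<sigma> * (real n - real j))" if n: "j < n" for n
    proof -
      define bn where "bn l = (if l < n then b l else 0)" for l
      have bn: "cmod (bn l) \<le> M" for l using b[of l] M by (simp add: bn_def)
      have tail: "cmod (b l - bn l) \<le> M" for l using b[of l] M by (simp add: bn_def)
      have vd: "cmod (val bn k) \<le> cmod (val b k) + G * M * K1 * exp (- \<sigma> * (real n - \<tau> k))" for k
      proof -
        have "cmod (val (\<lambda>l. b l - bn l) k) \<le> (\<Sum>l. exp (- \<beta> * (real l - \<tau> k)\<^sup>2) * cmod (b l - bn l))"
          by (rule val_le[OF tail])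
        also have "\<dots> \<le> (\<Sum>l. (G * M * exp (- \<sigma> * (real n - \<tau> k))) * exp (- \<sigma> * \<bar>real l - \<tau> k\<bar>))"
        proof (rule suminf_le[OF _ val_summable[OF tail]])
          show "summable (\<lambda>l. (G * M * exp (- \<sigma> * (real n - \<tau> k))) * exp (- \<sigma> * \<bar>real l - \<tau> k\<bar>))"
            by (intro summable_mult spread_exp_summable spread_real \<sigma>_pos)
          fix l
          show "exp (- \<beta> * (real l - \<tau> k)\<^sup>2) * cmod (b l - bn l) \<le> (G * M * exp (- \<sigma> * (real n - \<tau> k))) * exp (- \<sigma> * \<bar>real l - \<tau> k\<bar>)"
          proof (cases "l < n")
            case True
            then show ?thesis using M by (simp add: bn_def G_def)
          next
            case False
            have "exp (- \<beta> * (real l - \<tau> k)\<^sup>2) \<le> G * exp (- (2 * \<sigma>) * \<bar>real l - \<tau> k\<bar>)"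
              unfolding G_def by (rule gauss_le[OF \<beta>_pos])
            also have "\<dots> \<le> G * (exp (- \<sigma> * (real n - \<tau> k)) * exp (- \<sigma> * \<bar>real l - \<tau> k\<bar>))"
              using False \<sigma>_pos by (intro mult_left_mono exp_dist_shift) (auto simp: G_def)
            finally have "exp (- \<beta> * (real l - \<tau> k)\<^sup>2) * cmod (b l - bn l) \<le>
                G * (exp (- \<sigma> * (real n - \<tau> k)) * exp (- \<sigma> * \<bar>real l - \<tau> k\<bar>)) * M"
              using tail[of l] by (intro mult_mono) (auto simp: G_def)
            then show ?thesis by (simp only: mult_ac)
          qed
        qed
        also have "\<dots> = (G * M * exp (- \<sigma> * (real n - \<tau> k))) * (\<Sum>l. exp (- \<sigma> * \<bar>real l - \<tau> k\<bar>))"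
          by (intro suminf_mult spread_exp_summable spread_real \<sigma>_pos)
        also have "\<dots> \<le> (G * M * exp (- \<sigma> * (real n - \<tau> k))) * K1"
          using M by (intro mult_left_mono K1) (auto simp: G_def)
        finally have "cmod (val b k - val bn k) \<le> G * M * K1 * exp (- \<sigma> * (real n - \<tau> k))"
          using val_diff[of b M bn M k, OF b bn] by (simp add: mult_ac)
        moreover have "cmod (val bn k) \<le> cmod (val b k) + cmod (val b k - val bn k)"
          using norm_triangle_ineq4[of "val b k" "val b k - val bn k"] by simp
        ultimately show ?thesis by linarith
      qed
      have "b j = bn j" using n by (simp add: bn_def)
      also have "bn j = (\<Sum>k<n. val bn k * lagmat n k j)"
        by (rule lagmat_interpolation) (simp add: bn_def)
      finally have "cmod (b j) \<le> (\<Sum>k<n. cmod (val bn k) * cmod (lagmat n k j))"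
        by (metis (no_types, lifting) norm_mult norm_sum sum.cong)
      also have "\<dots> \<le> (\<Sum>k<n. C * (exp (- (2 * \<sigma>) * \<bar>real j - real k\<bar>) * cmod (val b k)) +
           C * (G * M * K1 * exp (\<sigma> * K)) * exp (- \<sigma> * (real n - real j)) * exp (- \<sigma> * \<bar>real k - real j\<bar>))"
      proof (rule sum_mono)
        fix k assume k: "k \<in> {..<n}"
        let ?e = "exp (- (2 * \<sigma>) * \<bar>real j - real k\<bar>)"
        have "cmod (val bn k) * cmod (lagmat n k j) \<le>
           (cmod (val b k) + G * M * K1 * exp (- \<sigma> * (real n - \<tau> k))) * (C * ?e)"
          using k M K1 by (intro mult_mono vd lm) (auto simp: G_def)
        also have "\<dots> = C * (?e * cmod (val b k)) + C * (G * M * K1) * (exp (- \<sigma> * (real n - \<tau> k)) * ?e)"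
          by (simp add: algebra_simps)
        also have "exp (- \<sigma> * (real n - \<tau> k)) * ?e \<le> exp (\<sigma> * K) * exp (- \<sigma> * (real n - real j)) * exp (- \<sigma> * \<bar>real k - real j\<bar>)"
        proof -
          have "real n - real j - \<bar>real k - real j\<bar> - K \<le> real n - \<tau> k" using dev[of k] by linarith
          then have "\<sigma> * (real n - real j - \<bar>real k - real j\<bar> - K) \<le> \<sigma> * (real n - \<tau> k)"
            using \<sigma>_pos by (intro mult_left_mono) auto
          then show ?thesis by (simp add: exp_add[symmetric] algebra_simps abs_minus_commute)
        qed
        then have "C * (G * M * K1) * (exp (- \<sigma> * (real n - \<tau> k)) * ?e) \<le>
          C * (G * M * K1) * (exp (\<sigma> * K) * exp (- \<sigma> * (real n - real j)) * exp (- \<sigma> * \<bar>real k - real j\<bar>))"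
          using C M K1 by (intro mult_left_mono) (auto simp: G_def)
        finally show "cmod (val bn k) * cmod (lagmat n k j) \<le> C * (?e * cmod (val b k)) +
          C * (G * M * K1 * exp (\<sigma> * K)) * exp (- \<sigma> * (real n - real j)) * exp (- \<sigma> * \<bar>real k - real j\<bar>)"
          by (simp add: mult_ac)
      qed
      also have "\<dots> = C * (\<Sum>k<n. exp (- (2 * \<sigma>) * \<bar>real j - real k\<bar>) * cmod (val b k)) +
          C * (G * M * K1 * exp (\<sigma> * K)) * exp (- \<sigma> * (real n - real j)) * (\<Sum>k<n. exp (- \<sigma> * \<bar>real k - real j\<bar>))"
        by (simp only: sum.distrib sum_distrib_left)
      also have "\<dots> \<le> C * V + C * (G * M * K1 * exp (\<sigma> * K)) * exp (- \<sigma> * (real n - real j)) * K2"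
        unfolding V_def using C M K1 by (intro add_mono mult_left_mono K2 sum_le_suminf[OF Vs]) (auto simp: G_def)
      finally show ?thesis by (simp add: D_def mult_ac)
    qed
    have "(\<lambda>n. C * V + D * exp (- \<sigma> * (real n - real j))) \<longlonglongrightarrow> C * V"
      using \<sigma>_pos by real_asymp
    then show ?thesis unfolding V_def[symmetric]
      by (rule LIMSEQ_le_const) (use ineq in \<open>auto intro!: exI[of _ "Suc j"]\<close>)
  qed
  show ?thesis by (rule that[OF C(1)]) (rule main)
qed

text \<open>The approximants \<open>B n\<close> solve the first n equations. They converge
  coordinatewise because the difference of two of them has value 0 at the first n nodes, and
  \<open>val_lower_bound\<close> sees the remaining values only through exp (- 2\<sigma> |j - k|)
  with k \<ge> n.\<close>

lemma val_surjective:
  obtains C where "0 < C" "\<And>c M. (\<And>k. cmod (c k) \<le> M) \<Longrightarrow> \<exists>b. (\<forall>k. val b k = c k) \<and>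
    (\<forall>j. cmod (b j) \<le> C * (\<Sum>k. exp (- (2 * \<sigma>) * \<bar>real j - real k\<bar>) * cmod (c k)))"
proof -
  obtain C where C: "0 < C" "\<And>n j k. k < n \<Longrightarrow> cmod (lagmat n k j) \<le> C * exp (- (2 * \<beta> * \<epsilon>) * \<bar>real j - real k\<bar>)"
    using lagmat_bound by blast
  have lm: "cmod (lagmat n k j) \<le> C * exp (- (2 * \<sigma>) * \<bar>real j - real k\<bar>)" if "k < n" for n k j
    using C(2)[OF that, of j] by (simp add: \<sigma>_def mult.assoc)
  obtain Cl where Cl: "0 < Cl" "\<And>b M j. (\<And>l. cmod (b l) \<le> M) \<Longrightarrow>
    cmod (b j) \<le> Cl * (\<Sum>k. exp (- (2 * \<sigma>) * \<bar>real j - real k\<bar>) * cmod (val b k))"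
    using val_lower_bound by blast
  obtain Cv where Cv: "0 < Cv" "\<And>b M k. (\<And>l. cmod (b l) \<le> M) \<Longrightarrow> cmod (val b k) \<le> Cv * M"
    using val_bounded by blast
  have \<sigma>2: "2 * \<sigma> > 0" using \<sigma>_pos by simp
  obtain K1 where K1: "0 < K1" "\<And>t. (\<Sum>l. exp (- \<sigma> * \<bar>real l - t\<bar>)) \<le> K1"
    using spread_exp_sum[OF spread_real \<sigma>_pos] by blast
  obtain K2 where K2: "0 < K2" "\<And>t. (\<Sum>l. exp (- (2*\<sigma>) * \<bar>real l - t\<bar>)) \<le> K2"
    using spread_exp_sum[OF spread_real \<sigma>2] by blast
  have main: "\<exists>b. (\<forall>k. val b k = c k) \<and>
    (\<forall>j. cmod (b j) \<le> C * (\<Sum>k. exp (- (2 * \<sigma>) * \<bar>real j - real k\<bar>) * cmod (c k)))"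
    if c: "\<And>k. cmod (c k) \<le> M" for c M
  proof -
    have M: "0 \<le> M" using c[of 0] norm_ge_zero order_trans by blast
    have ks: "summable (\<lambda>k. exp (- (2 * \<sigma>) * \<bar>real j - real k\<bar>))" for j
      using spread_exp_summable[OF spread_real \<sigma>2, of "real j"] by (simp add: abs_minus_commute)
    have kS: "(\<Sum>k. exp (- (2 * \<sigma>) * \<bar>real j - real k\<bar>)) \<le> K2" for j
      using K2(2)[of "real j"] by (simp add: abs_minus_commute)
    have ks1: "summable (\<lambda>k. exp (- \<sigma> * \<bar>real j - real k\<bar>))" for j
      using spread_exp_summable[OF spread_real \<sigma>_pos, of "real j"] by (simp add: abs_minus_commute)
    have kS1: "(\<Sum>k. exp (- \<sigma> * \<bar>real j - real k\<bar>)) \<le> K1" for j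
      using K1(2)[of "real j"] by (simp add: abs_minus_commute)
    have sm: "summable (\<lambda>k. exp (- (2 * \<sigma>) * \<bar>real j - real k\<bar>) * u k)"
      if "\<And>k. 0 \<le> u k" "\<And>k. u k \<le> B" for u B j
    proof (rule summable_comparison_test_ev[OF always_eventually, OF allI])
      show "summable (\<lambda>k. exp (- (2 * \<sigma>) * \<bar>real j - real k\<bar>) * B)" by (rule summable_mult2[OF ks])
      show "norm (exp (- (2 * \<sigma>) * \<bar>real j - real k\<bar>) * u k) \<le> exp (- (2 * \<sigma>) * \<bar>real j - real k\<bar>) * B" for k
        using that by simp
    qed
    define W where "W j = (\<Sum>k. exp (- (2 * \<sigma>) * \<bar>real j - real k\<bar>) * cmod (c k))" for j
    have Ws: "summable (\<lambda>k. exp (- (2 * \<sigma>) * \<bar>real j - real k\<bar>) * cmod (c k))" for j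
      by (rule sm[OF norm_ge_zero c])
    have WM: "W j \<le> K2 * M" for j
    proof -
      have "W j \<le> (\<Sum>k. exp (- (2 * \<sigma>) * \<bar>real j - real k\<bar>) * M)"
        unfolding W_def using c by (intro suminf_le Ws summable_mult2 ks mult_left_mono) auto
      also have "\<dots> = (\<Sum>k. exp (- (2 * \<sigma>) * \<bar>real j - real k\<bar>)) * M" by (rule suminf_mult2[OF ks, symmetric])
      also have "\<dots> \<le> K2 * M" using kS M by (intro mult_right_mono) auto
      finally show ?thesis .
    qed
    define B where "B n j = (\<Sum>k<n. c k * lagmat n k j)" for n j
    have BW: "cmod (B n j) \<le> C * W j" for n j
    proof -
      have "cmod (B n j) \<le> (\<Sum>k<n. cmod (c k * lagmat n k j))" unfolding B_def by (rule norm_sum)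
      also have "\<dots> \<le> (\<Sum>k<n. C * (exp (- (2 * \<sigma>) * \<bar>real j - real k\<bar>) * cmod (c k)))"
      proof (rule sum_mono)
        fix k assume "k \<in> {..<n}"
        then have "cmod (c k) * cmod (lagmat n k j) \<le> cmod (c k) * (C * exp (- (2 * \<sigma>) * \<bar>real j - real k\<bar>))"
          by (intro mult_left_mono lm) auto
        then show "cmod (c k * lagmat n k j) \<le> C * (exp (- (2 * \<sigma>) * \<bar>real j - real k\<bar>) * cmod (c k))"
          by (simp only: norm_mult mult_ac)
      qed
      also have "\<dots> = C * (\<Sum>k<n. exp (- (2 * \<sigma>) * \<bar>real j - real k\<bar>) * cmod (c k))" by (rule sum_distrib_left[symmetric])
      also have "\<dots> \<le> C * W j" unfolding W_def using C by (intro mult_left_mono sum_le_suminf[OF Ws]) auto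
      finally show ?thesis .
    qed
    define B0 where "B0 = C * (K2 * M)"
    have BB: "cmod (B n j) \<le> B0" for n j
      using BW[of n j] mult_left_mono[OF WM[of j], of C] C unfolding B0_def by linarith
    define D where "D = Cl * (Cv * (2 * B0)) * K1"
    have D0: "D \<ge> 0" using Cl Cv C K1 K2 M by (simp add: D_def B0_def)
    have cauchy: "cmod (B n j - B m j) \<le> D * exp (- \<sigma> * (real n - real j))" if "n \<le> m" for n m j
    proof -
      define d where "d l = B n l - B m l" for l
      have db: "cmod (d l) \<le> 2 * B0" for l
        unfolding d_def using norm_triangle_ineq4[of "B n l" "B m l"] BB[of n l] BB[of m l] by linarith
      have vd: "cmod (val d k) \<le> Cv * (2 * B0)" for k using Cv(2)[of d "2*B0" k, OF db] .
      have vd0: "val d k = 0" if "k < n" for k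
        unfolding d_def using val_diff[of "B n" B0 "B m" B0 k, OF BB BB] that \<open>n \<le> m\<close>
          val_lagmat_sum[of k n c] val_lagmat_sum[of k m c] by (simp add: B_def[abs_def])
      have "cmod (d j) \<le> Cl * (\<Sum>k. exp (- (2 * \<sigma>) * \<bar>real j - real k\<bar>) * cmod (val d k))"
        by (rule Cl(2)[OF db])
      also have "\<dots> \<le> Cl * (\<Sum>k. (Cv * (2 * B0) * exp (- \<sigma> * (real n - real j))) * exp (- \<sigma> * \<bar>real j - real k\<bar>))"
      proof (intro mult_left_mono suminf_le sm summable_mult ks1)
        fix k
        show "exp (- (2 * \<sigma>) * \<bar>real j - real k\<bar>) * cmod (val d k) \<le>
           (Cv * (2 * B0) * exp (- \<sigma> * (real n - real j))) * exp (- \<sigma> * \<bar>real j - real k\<bar>)"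
        proof (cases "k < n")
          case True
          then show ?thesis using vd0 Cv C K2 M by (simp add: B0_def)
        next
          case False
          then have "exp (- (2 * \<sigma>) * \<bar>real j - real k\<bar>) \<le> exp (- \<sigma> * (real n - real j)) * exp (- \<sigma> * \<bar>real j - real k\<bar>)"
            using exp_dist_shift[of n "real k" \<sigma> "real j"] \<sigma>_pos by (simp add: abs_minus_commute)
          then have "exp (- (2 * \<sigma>) * \<bar>real j - real k\<bar>) * cmod (val d k) \<le>
            (exp (- \<sigma> * (real n - real j)) * exp (- \<sigma> * \<bar>real j - real k\<bar>)) * (Cv * (2 * B0))"
            using vd by (intro mult_mono) auto
          then show ?thesis by (simp only: mult_ac)
        qed
      qed (use Cl vd in auto)
      also have "\<dots> = Cl * ((Cv * (2 * B0) * exp (- \<sigma> * (real n - real j))) * (\<Sum>k. exp (- \<sigma> * \<bar>real j - real k\<bar>)))"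
        by (subst suminf_mult[OF ks1]) simp
      also have "\<dots> \<le> Cl * ((Cv * (2 * B0) * exp (- \<sigma> * (real n - real j))) * K1)"
        using Cl Cv C K2 M by (intro mult_left_mono kS1) (auto simp: B0_def)
      finally show ?thesis by (simp add: d_def D_def mult_ac)
    qed
    have conv: "convergent (\<lambda>n. B n j)" for j
    proof (rule Cauchy_convergent, rule CauchyI')
      fix e :: real assume e: "e > 0"
      have "(\<lambda>n. D * exp (- \<sigma> * (real n - real j))) \<longlonglongrightarrow> 0" using \<sigma>_pos by real_asymp
      then have "eventually (\<lambda>n. D * exp (- \<sigma> * (real n - real j)) < e) sequentially"
        using e by (auto dest: order_tendstoD)
      then obtain n0 where n0: "\<And>n. n \<ge> n0 \<Longrightarrow> D * exp (- \<sigma> * (real n - real j)) < e"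
        by (auto simp: eventually_sequentially)
      show "\<exists>n0. \<forall>n\<ge>n0. \<forall>m>n. dist (B n j) (B m j) < e"
      proof (intro exI[of _ n0] allI impI)
        fix n m assume "n0 \<le> n" "n < m"
        then show "dist (B n j) (B m j) < e"
          using le_less_trans[OF cauchy[of n m j] n0[of n]] by (simp add: dist_norm)
      qed
    qed
    define b where "b j = lim (\<lambda>n. B n j)" for j
    have lim: "(\<lambda>n. B n j) \<longlonglongrightarrow> b j" for j
      using conv[of j] unfolding b_def by (simp add: convergent_LIMSEQ_iff)
    have bW: "cmod (b j) \<le> C * W j" for j
      by (rule LIMSEQ_le_const2[OF tendsto_norm[OF lim]]) (use BW in auto)
    have bB: "cmod (b j) \<le> B0" for j
      by (rule LIMSEQ_le_const2[OF tendsto_norm[OF lim]]) (use BB in auto)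
    have diff: "cmod (b j - B n j) \<le> D * exp (- \<sigma> * (real n - real j))" for n j
    proof (rule LIMSEQ_le_const2[where X = "\<lambda>m. cmod (B m j - B n j)"])
      show "(\<lambda>m. cmod (B m j - B n j)) \<longlonglongrightarrow> cmod (b j - B n j)"
        by (intro tendsto_intros lim)
      show "\<exists>N. \<forall>m\<ge>N. cmod (B m j - B n j) \<le> D * exp (- \<sigma> * (real n - real j))"
        using cauchy[of n _ j] by (intro exI[of _ n]) (auto simp: norm_minus_commute)
    qed
    have "val b k = c k" for k
    proof -
      \<comment> \<open>The convergence of \<open>B n\<close> deteriorates like exp (\<sigma> l) in
        the coordinate l. The Gaussian row absorbs this, so the k-th equation survives the
        limit.\<close>
      have es: "summable (\<lambda>l. exp (- \<beta> * (real l - \<tau> k)\<^sup>2) * (1 * exp (\<sigma> * real l)))"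
        by (rule gauss_exp_summable[of _ 1 \<sigma>]) auto
      define E where "E = (\<Sum>l. exp (- \<beta> * (real l - \<tau> k)\<^sup>2) * (1 * exp (\<sigma> * real l)))"
      have "cmod (val b k - c k) \<le> (D * E) * exp (- \<sigma> * real n)" if n: "k < n" for n
      proof -
        have dB: "cmod (b l - B n l) \<le> 2 * B0" for l
          using norm_triangle_ineq4[of "b l" "B n l"] bB[of l] BB[of n l] by linarith
        have "val b k - c k = val (\<lambda>l. b l - B n l) k"
          using val_diff[of b B0 "B n" B0 k, OF bB BB] val_lagmat_sum[OF n, of c] by (simp add: B_def[abs_def])
        then have "cmod (val b k - c k) \<le> (\<Sum>l. exp (- \<beta> * (real l - \<tau> k)\<^sup>2) * cmod (b l - B n l))"
          using val_le[of "\<lambda>l. b l - B n l" "2*B0" k, OF dB] by simp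
        also have "\<dots> \<le> (\<Sum>l. (D * exp (- \<sigma> * real n)) * (exp (- \<beta> * (real l - \<tau> k)\<^sup>2) * (1 * exp (\<sigma> * real l))))"
        proof (rule suminf_le[OF _ val_summable[OF dB] summable_mult[OF es]])
          fix l
          have "exp (- \<sigma> * (real n - real l)) = exp (- \<sigma> * real n) * exp (\<sigma> * real l)"
            by (simp add: exp_add[symmetric] algebra_simps)
          then have "exp (- \<beta> * (real l - \<tau> k)\<^sup>2) * cmod (b l - B n l) \<le>
             exp (- \<beta> * (real l - \<tau> k)\<^sup>2) * (D * (exp (- \<sigma> * real n) * exp (\<sigma> * real l)))"
            using diff[of l n] by (intro mult_left_mono) auto
          then show "exp (- \<beta> * (real l - \<tau> k)\<^sup>2) * cmod (b l - B n l) \<le>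
             (D * exp (- \<sigma> * real n)) * (exp (- \<beta> * (real l - \<tau> k)\<^sup>2) * (1 * exp (\<sigma> * real l)))"
            by (simp only: mult_ac mult_1)
        qed
        also have "\<dots> = (D * exp (- \<sigma> * real n)) * E" unfolding E_def by (rule suminf_mult[OF es])
        finally show ?thesis by (simp only: mult_ac)
      qed
      moreover have "(\<lambda>n. (D * E) * exp (- \<sigma> * real n)) \<longlonglongrightarrow> 0" using \<sigma>_pos by real_asymp
      ultimately have "cmod (val b k - c k) \<le> 0"
        by (intro LIMSEQ_le_const[where X="\<lambda>n. (D * E) * exp (- \<sigma> * real n)"]) (auto intro!: exI[of _ "Suc k"])
      then show ?thesis by simp
    qed
    then show ?thesis using bW unfolding W_def by blast
  qed
  show ?thesis by (rule that[OF C(1)]) (rule main)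
qed

end

section \<open>Exponential decay of the dual system\<close>

text \<open>Elimination of one unknown per equation. It supplies the dimension count behind the
  lower bound for \<tau>.\<close>

lemma homogeneous_system:
  fixes M :: "'a \<Rightarrow> 'b \<Rightarrow> complex"
  assumes "finite J" "finite I" "card J < card I"
  shows "\<exists>c. (\<exists>i\<in>I. c i \<noteq> 0) \<and> (\<forall>j\<in>J. (\<Sum>i\<in>I. c i * M i j) = 0)"
  using assms
proof (induction J arbitrary: I M rule: finite_induct)
  case empty
  then have "I \<noteq> {}" by auto
  then show ?case by (intro exI[of _ "\<lambda>_. 1"]) auto
next
  case (insert j J)
  show ?case
  proof (cases "\<forall>i\<in>I. M i j = 0")
    case True
    have "card J < card I" using insert by simp
    from insert.IH[OF insert.prems(1) this, of M] obtain c where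
      "\<exists>i\<in>I. c i \<noteq> 0" "\<forall>j\<in>J. (\<Sum>i\<in>I. c i * M i j) = 0" by blast
    then show ?thesis using True by (intro exI[of _ c]) auto
  next
    case False
    then obtain i0 where i0: "i0 \<in> I" "M i0 j \<noteq> 0" by blast
    define M' where "M' i j' = M i j' - M i j / M i0 j * M i0 j'" for i j'
    have "card J < card (I - {i0})" using insert i0 by simp
    from insert.IH[OF _ this, of M'] insert.prems(1) obtain c where
      c: "\<exists>i\<in>I-{i0}. c i \<noteq> 0" "\<And>j. j\<in>J \<Longrightarrow> (\<Sum>i\<in>I-{i0}. c i * M' i j) = 0" by auto
    define t where "t = - (\<Sum>i\<in>I-{i0}. c i * M i j) / M i0 j"
    have sum: "(\<Sum>i\<in>I. (if i = i0 then t else c i) * M i j') = t * M i0 j' + (\<Sum>i\<in>I-{i0}. c i * M i j')" for j'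
      using insert.prems(1) i0 by (subst sum.remove[of I i0]) (auto intro!: sum.cong)
    show ?thesis
    proof (intro exI[of _ "\<lambda>i. if i = i0 then t else c i"] conjI ballI)
      show "\<exists>i\<in>I. (if i = i0 then t else c i) \<noteq> 0" using c(1) by auto
      fix j' assume "j' \<in> insert j J"
      then consider "j' = j" | "j' \<in> J" by auto
      then show "(\<Sum>i\<in>I. (if i = i0 then t else c i) * M i j') = 0"
      proof cases
        case 1
        then show ?thesis unfolding sum using i0 by (simp add: t_def)
      next
        case 2
        have "(\<Sum>i\<in>I-{i0}. c i * M i j') = (\<Sum>i\<in>I-{i0}. c i * M' i j' + (c i * M i j) * (M i0 j' / M i0 j))"
          by (intro sum.cong refl) (simp add: M'_def algebra_simps)
        also have "\<dots> = (\<Sum>i\<in>I-{i0}. c i * M i j) * (M i0 j' / M i0 j)"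
          using c(2)[OF 2] by (simp add: sum.distrib sum_distrib_right sum_divide_distrib)
        also have "\<dots> = - t * M i0 j'" using i0 by (simp add: t_def field_simps)
        finally show ?thesis unfolding sum by simp
      qed
    qed
  qed
qed

section \<open>Maximum principle and division by zeros\<close>

lemma max_modulus_disc:
  assumes "h holomorphic_on UNIV" "\<And>z. cmod z = R \<Longrightarrow> cmod (h z) \<le> B" "cmod a \<le> R" "0 < R"
  shows "cmod (h a) \<le> B"
proof (rule maximum_modulus_frontier[of h "cball 0 R"])
  show "h holomorphic_on interior (cball 0 R)" using assms(1) holomorphic_on_subset by blast
  show "continuous_on (closure (cball 0 R)) h"
    using assms(1) holomorphic_on_imp_continuous_on continuous_on_subset by blast
qed (use assms in \<open>auto\<close>)

text \<open>
  The factors with $|w_i| \le r$ are replaced by $r - \bar w_i z / r$, which has the same modulus on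
  the circle and the value $r$ at the origin.
\<close>

lemma prod_max_le_circle:
  fixes w :: "'a \<Rightarrow> complex"
  assumes "0 < r"
  obtains z where "cmod z = r" "(\<Prod>i\<in>I. max r (cmod (w i))) \<le> (\<Prod>i\<in>I. cmod (z - w i))"
proof -
  define F where "F z = (\<Prod>i\<in>I. if cmod (w i) \<le> r then of_real r - cnj (w i) * z / of_real r else z - w i)" for z
  have h: "F holomorphic_on UNIV" unfolding F_def
  proof (intro holomorphic_on_prod)
    fix i
    show "(\<lambda>z. if cmod (w i) \<le> r then of_real r - cnj (w i) * z / of_real r else z - w i) holomorphic_on UNIV"
      by (cases "cmod (w i) \<le> r") (auto intro!: holomorphic_intros simp: assms)
  qed
  have F0: "cmod (F 0) = (\<Prod>i\<in>I. max r (cmod (w i)))"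
    unfolding F_def prod_norm[symmetric] using assms by (intro prod.cong refl) (auto simp: max_def)
  have Fr: "cmod (F z) = (\<Prod>i\<in>I. cmod (z - w i))" if z: "cmod z = r" for z
    unfolding F_def prod_norm[symmetric]
  proof (intro prod.cong refl)
    fix i
    have "of_real r - cnj (w i) * z / of_real r = (z / of_real r) * cnj (z - w i)"
    proof -
      have "z * cnj z = of_real r * of_real r" using complex_norm_square[of z] z by (simp add: power2_eq_square)
      then show ?thesis using assms by (simp add: field_simps)
    qed
    then have "cmod (of_real r - cnj (w i) * z / of_real r) = cmod (z - w i)"
      using z assms by (simp add: norm_mult norm_divide del: complex_cnj_diff)
    then show "cmod (if cmod (w i) \<le> r then of_real r - cnj (w i) * z / of_real r else z - w i) = cmod (z - w i)"
      by simp
  qed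
  show ?thesis
  proof (rule ccontr)
    assume no: "\<not> thesis"
    have "continuous_on (sphere 0 r) (\<lambda>z. cmod (F z))"
      using h by (intro continuous_on_norm) (meson holomorphic_on_imp_continuous_on continuous_on_subset subset_UNIV)
    moreover have "sphere (0::complex) r \<noteq> {}" using assms by simp
    ultimately obtain z where z: "z \<in> sphere 0 r" "\<And>y. y \<in> sphere 0 r \<Longrightarrow> cmod (F y) \<le> cmod (F z)"
      using continuous_attains_sup[OF compact_sphere] by blast
    have "cmod (F 0) \<le> cmod (F z)"
      by (rule max_modulus_disc[OF h, of r]) (use z assms in auto)
    then show False using no that[of z] z(1) unfolding F0 by (auto simp: Fr)
  qed
qed

lemma entire_divide_zeros:
  assumes "finite I" "g holomorphic_on UNIV" "inj_on w I" "\<And>i. i \<in> I \<Longrightarrow> g (w i) = 0"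
  shows "\<exists>h. h holomorphic_on UNIV \<and> (\<forall>z. g z = h z * (\<Prod>i\<in>I. z - w i))"
  using assms
proof (induction I rule: finite_induct)
  case empty
  then show ?case by auto
next
  case (insert i I)
  then obtain h where h: "h holomorphic_on UNIV" "\<And>z. g z = h z * (\<Prod>i\<in>I. z - w i)" by auto
  have "(\<Prod>i'\<in>I. w i - w i') \<noteq> 0" using insert by (auto simp: inj_on_def)
  moreover have "g (w i) = 0" using insert by simp
  ultimately have h0: "h (w i) = 0" using h(2)[of "w i"] by simp
  define k where "k z = (if z = w i then deriv h (w i) else (h z - h (w i)) / (z - w i))" for z
  have "k holomorphic_on UNIV" unfolding k_def by (rule pole_lemma_open[OF h(1)]) simp
  moreover have "h z = k z * (z - w i)" for z by (simp add: k_def h0)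
  ultimately show ?case using h(2) insert by (intro exI[of _ k]) (simp add: mult_ac)
qed

text \<open>This is what the necessity argument retains of the bounded inverse once \<tau> is known
  to be spread. In \<open>lower\<close> a finite bound \<open>M\<close> is presupposed without
  entering the conclusion: it is an a priori estimate, for sequences already known to lie in
  l^p.\<close>

locale stable_nodes = gauss_nodes +
  fixes p :: ennreal and CL :: real
  assumes p: "0 < p" and spread_\<tau>: "spread \<tau>" and CL: "0 < CL"
    and lower: "\<And>b M N. \<lbrakk>lp_bound p M (\<lambda>l. cmod (b l)); 0 \<le> M; lp_bound p N (\<lambda>k. cmod (val b k)); 0 \<le> N\<rbrakk>
       \<Longrightarrow> lp_bound p (CL * N) (\<lambda>l. cmod (b l))"
    and onto: "\<And>k. \<exists>b M. 0 \<le> M \<and> lp_bound p M (\<lambda>l. cmod (b l)) \<and> (\<forall>i. val b i = (if i = k then 1 else 0))"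
begin

definition dual :: "nat \<Rightarrow> nat \<Rightarrow> complex" where
  "dual k = (SOME b. \<exists>M. 0 \<le> M \<and> lp_bound p M (\<lambda>l. cmod (b l)) \<and> (\<forall>i. val b i = (if i = k then 1 else 0)))"

lemma dual:
  shows "\<exists>M. 0 \<le> M \<and> lp_bound p M (\<lambda>l. cmod (dual k l))" "val (dual k) i = (if i = k then 1 else 0)"
proof -
  have "\<exists>M. 0 \<le> M \<and> lp_bound p M (\<lambda>l. cmod (dual k l)) \<and> (\<forall>i. val (dual k) i = (if i = k then 1 else 0))"
    unfolding dual_def by (rule someI_ex[OF onto])
  then show "\<exists>M. 0 \<le> M \<and> lp_bound p M (\<lambda>l. cmod (dual k l))" "val (dual k) i = (if i = k then 1 else 0)" by blast+
qed

text \<open>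
  Conjugation by the exponential weight $e^{\eta\psi}$ with a $1$-Lipschitz function $\psi$ changes
  the matrix by $O(\eta)$ only, so the lower bound survives for small $\eta$.
\<close>

lemma dual_decay:
  obtains C \<eta> where "0 < C" "0 < \<eta>" "\<And>k j. cmod (dual k j) \<le> C * exp (- (2 * \<eta>) * \<bar>real j - \<tau> k\<bar>)"
proof -
  obtain CK where CK: "0 < CK" and kern: "\<And>u v M \<eta>. \<lbrakk>lp_bound p M u; \<And>k. 0 \<le> u k; \<And>k. 0 \<le> v k; 0 \<le> M; 0 \<le> \<eta>;
     \<And>k. v k \<le> \<eta> * (\<Sum>l. exp (- 1 * \<bar>\<tau> k - real l\<bar>) * u l)\<rbrakk> \<Longrightarrow> lp_bound p (\<eta> * CK * M) v"
    using lp_bound_exp_kernel[OF p spread_\<tau> spread_real zero_less_one] by blast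
  obtain Ka where Ka: "0 < Ka" and add: "\<And>u v M N. \<lbrakk>lp_bound p M u; lp_bound p N v; \<And>k. 0 \<le> u k; \<And>k. 0 \<le> v k;
     0 \<le> M; 0 \<le> N\<rbrakk> \<Longrightarrow> lp_bound p (Ka * (M + N)) (\<lambda>k. u k + v k)"
    using lp_bound_add[OF p] by blast
  define G where "G = exp (3\<^sup>2 / (4*\<beta>))"
  have G: "G > 0" by (simp add: G_def)
  \<comment> \<open>Small enough that the perturbation, after passing through the kernel estimate,
    the quasi-triangle inequality and the lower bound, is at most half of the norm of
    \<open>c\<close> and can be absorbed.\<close>
  define \<eta> where "\<eta> = min 1 (1 / (2 * CL * Ka * G * CK))"
  have \<eta>: "0 < \<eta>" "\<eta> \<le> 1" using CL Ka G CK by (auto simp: \<eta>_def)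
  have \<eta>2: "CL * (Ka * (\<eta> * G * CK)) \<le> 1/2"
  proof -
    have "\<eta> \<le> 1 / (2 * CL * Ka * G * CK)" by (simp add: \<eta>_def)
    then have "\<eta> * (2 * CL * Ka * G * CK) \<le> 1" using CL Ka G CK by (simp add: pos_le_divide_eq)
    then show ?thesis by (simp add: mult_ac)
  qed
  have main: "cmod (dual k j) \<le> (2 * CL * Ka) * exp (- \<eta> * \<bar>real j - \<tau> k\<bar>)" for k j
  proof -
    define R where "R = \<bar>real j - \<tau> k\<bar>"
    \<comment> \<open>Truncation at \<open>R\<close> keeps the weight bounded, so \<open>c\<close>
      stays in l^p and \<open>lower\<close> applies. Since R = |j - \<tau> k|, the weight at the
      coordinate \<open>j\<close> of interest is still the full one.\<close>
    define \<psi> where "\<psi> t = min \<bar>t - \<tau> k\<bar> R" for t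
    define c where "c l = exp (\<eta> * \<psi> (real l)) * dual k l" for l
    obtain Mb where Mb: "0 \<le> Mb" "lp_bound p Mb (\<lambda>l. cmod (dual k l))" using dual(1) by blast
    have bM: "cmod (dual k l) \<le> Mb" for l using lp_bound_component[OF p Mb(2,1)] by simp
    have cle: "cmod (c l) \<le> exp (\<eta> * R) * cmod (dual k l)" for l
      unfolding c_def norm_mult using \<eta> by (intro mult_right_mono) (auto simp: \<psi>_def)
    have "lp_bound p (exp (\<eta> * R) * Mb) (\<lambda>l. cmod (c l))"
      by (rule lp_bound_mono[OF p lp_bound_scale[OF p Mb(2), of "exp (\<eta> * R)"]]) (use cle Mb in auto)
    then have clp: "c \<in> lp_space p UNIV" using lp_bound_iff[OF p, of "exp (\<eta> * R) * Mb" c] Mb by simp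
    define N where "N = lp_norm p UNIV c"
    have N0: "N \<ge> 0" unfolding N_def by (rule lp_norm_nonneg[OF clp])
    have cN: "lp_bound p N (\<lambda>l. cmod (c l))" unfolding N_def by (rule lp_boundI[OF p clp])
    have cM: "cmod (c l) \<le> N" for l using lp_bound_component[OF p cN N0] by simp
    define S where "S i = (\<Sum>l. exp (- 1 * \<bar>\<tau> i - real l\<bar>) * cmod (c l))" for i
    have Ss: "summable (\<lambda>l. exp (- 1 * \<bar>\<tau> i - real l\<bar>) * cmod (c l))" for i
    proof (rule summable_comparison_test_ev[OF always_eventually, OF allI])
      show "summable (\<lambda>l. exp (- 1 * \<bar>real l - \<tau> i\<bar>) * N)"
        by (intro summable_mult2 spread_exp_summable spread_real) simp
      show "norm (exp (- 1 * \<bar>\<tau> i - real l\<bar>) * cmod (c l)) \<le> exp (- 1 * \<bar>real l - \<tau> i\<bar>) * N" for l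
        using cM[of l] by (simp add: abs_minus_commute)
    qed
    have vc: "cmod (val c i) \<le> (if i = k then 1 else 0) + \<eta> * G * S i" for i
    proof -
      define e where "e = complex_of_real (exp (\<eta> * \<psi> (\<tau> i)))"
      have eb: "cmod (e * dual k l) \<le> cmod e * Mb" for l using bM[of l] by (simp add: norm_mult mult_left_mono)
      have db: "cmod (c l - e * dual k l) \<le> N + cmod e * Mb" for l
        using norm_triangle_ineq4[of "c l" "e * dual k l"] cM[of l] eb[of l] by linarith
      have "val c i - e * val (dual k) i = val (\<lambda>l. c l - e * dual k l) i"
        using val_diff[of c N "\<lambda>l. e * dual k l" "cmod e * Mb" i, OF cM eb] val_scale[of "dual k" Mb e i, OF bM] by simp
      then have "cmod (val c i - e * val (dual k) i) \<le> (\<Sum>l. exp (- \<beta> * (real l - \<tau> i)\<^sup>2) * cmod (c l - e * dual k l))"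
        using val_le[of "\<lambda>l. c l - e * dual k l", OF db, of i] by simp
      also have "\<dots> \<le> (\<Sum>l. (\<eta> * G) * (exp (- 1 * \<bar>\<tau> i - real l\<bar>) * cmod (c l)))"
      proof (rule suminf_le[OF _ val_summable[OF db] summable_mult[OF Ss]])
        fix l
        define d where "d = \<bar>real l - \<tau> i\<bar>"
        have d0: "d \<ge> 0" by (simp add: d_def)
        have \<psi>d: "\<bar>\<psi> (\<tau> i) - \<psi> (real l)\<bar> \<le> d" unfolding \<psi>_def d_def by linarith
        \<comment> \<open>Using the weight at \<tau> i for the whole row i instead of the weight at
          l changes each entry by this relative amount, which is small with \<eta> because
          \<open>\<psi>\<close> is 1-Lipschitz.\<close>
        have eq: "c l - e * dual k l = c l * of_real (1 - exp (\<eta> * (\<psi> (\<tau> i) - \<psi> (real l))))"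
        proof -
          have "exp (\<eta> * \<psi> (\<tau> i)) = exp (\<eta> * \<psi> (real l)) * exp (\<eta> * (\<psi> (\<tau> i) - \<psi> (real l)))"
            by (simp add: exp_add[symmetric] algebra_simps)
          then show ?thesis unfolding c_def e_def by (simp add: algebra_simps)
        qed
        have "\<bar>1 - exp (\<eta> * (\<psi> (\<tau> i) - \<psi> (real l)))\<bar> \<le> exp (\<eta> * d) - 1"
        proof -
          define y where "y = \<eta> * (\<psi> (\<tau> i) - \<psi> (real l))"
          have y: "\<bar>y\<bar> \<le> \<eta> * d" unfolding y_def abs_mult using \<psi>d \<eta> by (simp add: mult_left_mono)
          have "exp y \<le> exp (\<eta> * d)" using y by simp
          moreover have "1 + y \<le> exp y" "1 + \<eta> * d \<le> exp (\<eta> * d)" by (rule exp_ge_add_one_self)+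
          ultimately show ?thesis using y unfolding y_def[symmetric] by linarith
        qed
        \<comment> \<open>The growth exp (2d) is affordable: the Gaussian is estimated at rate 3,
          and rate 1 is left for the kernel.\<close>
        also have "\<dots> \<le> \<eta> * exp (2 * d)"
        proof -
          have "1 - \<eta> * d \<le> exp (- (\<eta> * d))" using exp_ge_add_one_self[of "- (\<eta> * d)"] by simp
          then have "(1 - \<eta> * d) * exp (\<eta> * d) \<le> exp (- (\<eta> * d)) * exp (\<eta> * d)" by (intro mult_right_mono) auto
          then have "exp (\<eta> * d) - 1 \<le> \<eta> * d * exp (\<eta> * d)" by (simp add: exp_add[symmetric] algebra_simps)
          also have "\<dots> \<le> \<eta> * exp d * exp d"
          proof (intro mult_mono)
            show "d \<le> exp d" using exp_ge_add_one_self[of d] by linarith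
            show "exp (\<eta> * d) \<le> exp d" using \<eta> d0 by (simp add: mult_left_le_one_le)
          qed (use \<eta> d0 in auto)
          also have "\<dots> = \<eta> * exp (2 * d)" by (simp add: exp_add[symmetric] mult.assoc)
          finally show ?thesis .
        qed
        finally have "cmod (c l - e * dual k l) \<le> cmod (c l) * (\<eta> * exp (2 * d))"
          unfolding eq norm_mult norm_of_real by (intro mult_left_mono) auto
        moreover have "exp (- \<beta> * (real l - \<tau> i)\<^sup>2) \<le> G * exp (- 3 * d)"
          unfolding G_def d_def by (rule gauss_le[OF \<beta>_pos])
        ultimately have "exp (- \<beta> * (real l - \<tau> i)\<^sup>2) * cmod (c l - e * dual k l) \<le> (G * exp (- 3 * d)) * (cmod (c l) * (\<eta> * exp (2 * d)))"
          using G by (intro mult_mono) auto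
        also have "\<dots> = (\<eta> * G) * ((exp (- 3 * d) * exp (2 * d)) * cmod (c l))" by (simp only: mult_ac)
        also have "exp (- 3 * d) * exp (2 * d) = exp (- 1 * \<bar>\<tau> i - real l\<bar>)"
          unfolding exp_add[symmetric] by (simp add: d_def abs_minus_commute)
        finally show "exp (- \<beta> * (real l - \<tau> i)\<^sup>2) * cmod (c l - e * dual k l) \<le> (\<eta> * G) * (exp (- 1 * \<bar>\<tau> i - real l\<bar>) * cmod (c l))" .
      qed
      also have "\<dots> = \<eta> * G * S i" unfolding S_def by (rule suminf_mult[OF Ss])
      finally have "cmod (val c i - e * val (dual k) i) \<le> \<eta> * G * S i" .
      moreover have "cmod (e * val (dual k) i) \<le> (if i = k then 1 else 0)"
        unfolding dual(2) e_def by (simp add: \<psi>_def R_def)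
      ultimately show ?thesis using norm_triangle_ineq2[of "val c i" "e * val (dual k) i"] by linarith
    qed
    have S0: "S i \<ge> 0" for i unfolding S_def by (intro suminf_nonneg Ss) auto
    have "lp_bound p (\<eta> * G * CK * N) (\<lambda>i. \<eta> * G * S i)"
      by (rule kern[OF cN]) (use \<eta> G S0 N0 in \<open>auto simp: S_def\<close>)
    then have "lp_bound p (Ka * (1 + \<eta> * G * CK * N)) (\<lambda>i. (if i = k then 1 else 0) + \<eta> * G * S i)"
      by (intro add lp_bound_unit p) (use \<eta> G S0 N0 CK in auto)
    then have "lp_bound p (Ka * (1 + \<eta> * G * CK * N)) (\<lambda>i. cmod (val c i))"
      by (rule lp_bound_mono[OF p]) (use vc Ka \<eta> G CK N0 in auto)
    then have "lp_bound p (CL * (Ka * (1 + \<eta> * G * CK * N))) (\<lambda>l. cmod (c l))"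
      by (rule lower[OF cN N0]) (use Ka \<eta> G CK N0 in auto)
    then have "N \<le> CL * (Ka * (1 + \<eta> * G * CK * N))"
      using lp_bound_iff[OF p, of "CL * (Ka * (1 + \<eta> * G * CK * N))" c] CL Ka \<eta> G CK N0 by (simp add: N_def)
    also have "\<dots> = CL * Ka + (CL * (Ka * (\<eta> * G * CK))) * N" by (simp add: algebra_simps)
    also have "\<dots> \<le> CL * Ka + 1/2 * N" using \<eta>2 N0 by (intro add_left_mono mult_right_mono)
    finally have "N \<le> 2 * CL * Ka" by simp
    moreover have "cmod (c j) = exp (\<eta> * \<bar>real j - \<tau> k\<bar>) * cmod (dual k j)"
      by (simp add: c_def \<psi>_def R_def norm_mult)
    ultimately have "exp (\<eta> * \<bar>real j - \<tau> k\<bar>) * cmod (dual k j) \<le> 2 * CL * Ka" using cM[of j] by linarith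
    then show ?thesis by (simp add: exp_minus field_simps)
  qed
  show ?thesis
  proof (rule that[of "2 * CL * Ka" "\<eta>/2"])
    show "cmod (dual k j) \<le> 2 * CL * Ka * exp (- (2 * (\<eta>/2)) * \<bar>real j - \<tau> k\<bar>)" for k j
      using main[of k j] by simp
  qed (use CL Ka \<eta> in auto)
qed

section \<open>Expansion of finitely supported sequences in the dual system\<close>

lemma val_sum:
  assumes "finite I" "\<And>i l. i \<in> I \<Longrightarrow> cmod (f i l) \<le> B i"
  shows "val (\<lambda>l. \<Sum>i\<in>I. f i l) k = (\<Sum>i\<in>I. val (f i) k)"
  using assms
proof (induction I rule: finite_induct)
  case empty
  show ?case using val_scale[of "\<lambda>_. 0" 0 0 k] by simp
next
  case (insert i I)
  have "cmod (\<Sum>i\<in>I. f i l) \<le> (\<Sum>i\<in>I. B i)" for l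
    by (rule sum_norm_le) (use insert in auto)
  then have "val (\<lambda>l. f i l + (\<Sum>i\<in>I. f i l)) k = val (f i) k + val (\<lambda>l. \<Sum>i\<in>I. f i l) k"
    using insert.prems by (intro val_add[of _ "B i" _ "\<Sum>i\<in>I. B i"]) auto
  then show ?case using insert by simp
qed

lemma dual_bounded: obtains M where "\<And>l. cmod (dual k l) \<le> M" "lp_bound p M (\<lambda>l. cmod (dual k l))" "0 \<le> M"
proof -
  obtain M where M: "0 \<le> M" "lp_bound p M (\<lambda>l. cmod (dual k l))" using dual(1) by blast
  show ?thesis by (rule that[OF lp_bound_component[OF p M(2,1)] M(2,1)]) simp
qed

lemma val_dual_combination:
  assumes "finite I"
  shows "val (\<lambda>l. \<Sum>i\<in>I. c i * dual i l) k = (if k \<in> I then c k else 0)"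
    "\<exists>M. \<forall>l. cmod (\<Sum>i\<in>I. c i * dual i l) \<le> M"
    "\<exists>M\<ge>0. lp_bound p M (\<lambda>l. cmod (\<Sum>i\<in>I. c i * dual i l))"
proof -
  have "\<exists>M. (\<forall>l. cmod (dual i l) \<le> M) \<and> lp_bound p M (\<lambda>l. cmod (dual i l)) \<and> 0 \<le> M" for i
    using dual_bounded[of i] by blast
  then obtain B where "\<forall>i. (\<forall>l. cmod (dual i l) \<le> B i) \<and> lp_bound p (B i) (\<lambda>l. cmod (dual i l)) \<and> 0 \<le> B i"
    using choice[of "\<lambda>i M. (\<forall>l. cmod (dual i l) \<le> M) \<and> lp_bound p M (\<lambda>l. cmod (dual i l)) \<and> 0 \<le> M"] by blast
  then have B: "\<And>i l. cmod (dual i l) \<le> B i" "\<And>i. lp_bound p (B i) (\<lambda>l. cmod (dual i l))" "\<And>i. 0 \<le> B i"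
    by auto
  have cB: "cmod (c i * dual i l) \<le> cmod (c i) * B i" for i l
    using B(1)[of i l] by (simp add: norm_mult mult_left_mono)
  have "val (\<lambda>l. \<Sum>i\<in>I. c i * dual i l) k = (\<Sum>i\<in>I. val (\<lambda>l. c i * dual i l) k)"
    by (rule val_sum[OF assms cB])
  also have "\<dots> = (\<Sum>i\<in>I. if i = k then c k else 0)"
  proof (intro sum.cong refl)
    fix i
    show "val (\<lambda>l. c i * dual i l) k = (if i = k then c k else 0)"
      using val_scale[of "dual i" "B i" "c i" k, OF B(1)] by (simp add: dual(2))
  qed
  finally show "val (\<lambda>l. \<Sum>i\<in>I. c i * dual i l) k = (if k \<in> I then c k else 0)"
    using assms by simp
  show "\<exists>M. \<forall>l. cmod (\<Sum>i\<in>I. c i * dual i l) \<le> M"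
    by (rule exI[of _ "\<Sum>i\<in>I. cmod (c i) * B i"]) (auto intro: sum_norm_le cB)
  obtain K where K: "0 < K" "\<And>u v M N. \<lbrakk>lp_bound p M u; lp_bound p N v; \<And>k. 0 \<le> u k; \<And>k. 0 \<le> v k;
     0 \<le> M; 0 \<le> N\<rbrakk> \<Longrightarrow> lp_bound p (K * (M + N)) (\<lambda>k. u k + v k)"
    using lp_bound_add[OF p] by blast
  show "\<exists>M\<ge>0. lp_bound p M (\<lambda>l. cmod (\<Sum>i\<in>I. c i * dual i l))"
    using assms
  proof (induction I rule: finite_induct)
    case empty
    show ?case by (rule exI[of _ 0]) (auto simp: lp_bound_def)
  next
    case (insert i I)
    then obtain M where M: "M \<ge> 0" "lp_bound p M (\<lambda>l. cmod (\<Sum>i\<in>I. c i * dual i l))" by blast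
    have 1: "lp_bound p (cmod (c i) * B i) (\<lambda>l. cmod (c i) * cmod (dual i l))"
      by (rule lp_bound_scale[OF p B(2)]) (use B(3) in auto)
    have 2: "lp_bound p (K * (cmod (c i) * B i + M)) (\<lambda>l. cmod (c i) * cmod (dual i l) + cmod (\<Sum>i\<in>I. c i * dual i l))"
      using 1 M B(3) by (intro K) auto
    have "lp_bound p (K * (cmod (c i) * B i + M)) (\<lambda>l. cmod (\<Sum>i\<in>insert i I. c i * dual i l))"
      by (rule lp_bound_mono[OF p 2])
         (use insert K M B(3) in \<open>auto simp: norm_mult[symmetric] intro: norm_triangle_ineq\<close>)
    moreover have "K * (cmod (c i) * B i + M) \<ge> 0" using K M B(3) by simp
    ultimately show ?case by blast
  qed
qed

lemma \<tau>_at_top: "filterlim \<tau> at_top sequentially"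
proof -
  obtain \<kappa> C where \<kappa>: "\<kappa> > 0" and x: "\<And>i j. i \<le> j \<Longrightarrow> \<kappa> * (real j - real i) - C \<le> \<tau> j - \<tau> i"
    using spread_\<tau> unfolding spread_def by blast
  have "filterlim (\<lambda>n. \<kappa> * real n + (\<tau> 0 - C)) at_top sequentially" using \<kappa> by real_asymp
  then show ?thesis
    by (rule filterlim_at_top_mono) (use x[of 0] in \<open>auto intro!: always_eventually simp: algebra_simps\<close>)
qed

text \<open>Behind this is the expansion of \<open>b\<close> as the sum of
  \<open>val b k * dual k\<close>, combined with the decay of the dual system. For p = \<infinity>
  finite combinations are not dense, hence the restriction to finitely supported \<open>b\<close>:
  their values decay exponentially, and then the remainder after m terms is small by
  \<open>lower\<close>.\<close>

lemma finite_support_bound: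
  obtains C \<eta> where "0 < C" "0 < \<eta>" "\<And>k j. cmod (dual k j) \<le> C * exp (- (2 * \<eta>) * \<bar>real j - \<tau> k\<bar>)"
    "\<And>b n j. \<forall>l\<ge>n. b l = 0 \<Longrightarrow> summable (\<lambda>k. exp (- (2 * \<eta>) * \<bar>real j - \<tau> k\<bar>) * cmod (val b k))"
    "\<And>b n j. \<forall>l\<ge>n. b l = 0 \<Longrightarrow>
      cmod (b j) \<le> C * (\<Sum>k. exp (- (2 * \<eta>) * \<bar>real j - \<tau> k\<bar>) * cmod (val b k))"
proof -
  obtain C \<eta> where C: "0 < C" "0 < \<eta>" "\<And>k j. cmod (dual k j) \<le> C * exp (- (2 * \<eta>) * \<bar>real j - \<tau> k\<bar>)"
    using dual_decay by blast
  have \<eta>2: "2 * \<eta> > 0" using C by simp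
  obtain CK where CK: "0 < CK" and kern: "\<And>u v M \<eta>. \<lbrakk>lp_bound p M u; \<And>k. 0 \<le> u k; \<And>k. 0 \<le> v k; 0 \<le> M; 0 \<le> \<eta>;
     \<And>k. v k \<le> \<eta> * (\<Sum>l. exp (- 1 * \<bar>\<tau> k - real l\<bar>) * u l)\<rbrakk> \<Longrightarrow> lp_bound p (\<eta> * CK * M) v"
    using lp_bound_exp_kernel[OF p spread_\<tau> spread_real zero_less_one] by blast
  obtain Ka where Ka: "0 < Ka" and add: "\<And>u v M N. \<lbrakk>lp_bound p M u; lp_bound p N v; \<And>k. 0 \<le> u k; \<And>k. 0 \<le> v k;
     0 \<le> M; 0 \<le> N\<rbrakk> \<Longrightarrow> lp_bound p (Ka * (M + N)) (\<lambda>k. u k + v k)"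
    using lp_bound_add[OF p] by blast
  obtain Cv where Cv: "0 < Cv" "\<And>b M k. (\<And>l. cmod (b l) \<le> M) \<Longrightarrow> cmod (val b k) \<le> Cv * M"
    using val_bounded by blast
  define G where "G = exp (2\<^sup>2 / (4*\<beta>))"
  have main: "summable (\<lambda>k. exp (- (2 * \<eta>) * \<bar>real j - \<tau> k\<bar>) * cmod (val b k)) \<and>
      cmod (b j) \<le> C * (\<Sum>k. exp (- (2 * \<eta>) * \<bar>real j - \<tau> k\<bar>) * cmod (val b k))"
    if fin: "\<And>l. l \<ge> n \<Longrightarrow> b l = 0" for b n j
  proof -
    define Mb where "Mb = (\<Sum>l<n. cmod (b l))"
    have bM: "cmod (b l) \<le> Mb" for l
    proof (cases "l < n")
      case True
      then show ?thesis unfolding Mb_def by (intro member_le_sum) auto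
    qed (use fin in \<open>auto simp: Mb_def sum_nonneg\<close>)
    have Mb: "Mb \<ge> 0" by (simp add: Mb_def sum_nonneg)
    have s: "summable (\<lambda>k. exp (- (2 * \<eta>) * \<bar>real j - \<tau> k\<bar>) * cmod (val b k))"
    proof (rule summable_comparison_test_ev[OF always_eventually, OF allI])
      show "summable (\<lambda>k. exp (- (2 * \<eta>) * \<bar>\<tau> k - real j\<bar>) * (Cv * Mb))"
        by (intro summable_mult2 spread_exp_summable spread_\<tau> \<eta>2)
      show "norm (exp (- (2 * \<eta>) * \<bar>real j - \<tau> k\<bar>) * cmod (val b k)) \<le> exp (- (2 * \<eta>) * \<bar>\<tau> k - real j\<bar>) * (Cv * Mb)" for k
        using Cv(2)[of b Mb k, OF bM] by (simp add: abs_minus_commute)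
    qed
    define V where "V = (\<Sum>k. exp (- (2 * \<eta>) * \<bar>real j - \<tau> k\<bar>) * cmod (val b k))"
    define E where "E = G * exp (2 * real n) * Mb"
    have E0: "E \<ge> 0" using Mb by (simp add: E_def G_def)
    have vdec: "cmod (val b i) \<le> E * exp (- 2 * \<bar>\<tau> i\<bar>)" for i
    proof -
      have "cmod (val b i) \<le> (\<Sum>l. exp (- \<beta> * (real l - \<tau> i)\<^sup>2) * cmod (b l))" by (rule val_le[OF bM])
      also have "\<dots> = (\<Sum>l<n. exp (- \<beta> * (real l - \<tau> i)\<^sup>2) * cmod (b l))"
        by (rule suminf_finite) (use fin in auto)
      also have "\<dots> \<le> (\<Sum>l<n. (G * exp (2 * real n) * exp (- 2 * \<bar>\<tau> i\<bar>)) * cmod (b l))"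
      proof (intro sum_mono mult_right_mono)
        fix l assume l: "l \<in> {..<n}"
        have "exp (- \<beta> * (real l - \<tau> i)\<^sup>2) \<le> G * exp (- 2 * \<bar>real l - \<tau> i\<bar>)"
          unfolding G_def by (rule gauss_le[OF \<beta>_pos])
        also have "\<dots> \<le> G * exp (2 * real n + - 2 * \<bar>\<tau> i\<bar>)"
        proof (intro mult_left_mono)
          have "real l \<le> real n" using l by auto
          moreover have "\<bar>\<tau> i\<bar> \<le> \<bar>real l - \<tau> i\<bar> + real l"
            using abs_triangle_ineq4[of "real l" "real l - \<tau> i"] by simp
          moreover have "- 2 * y \<le> 2 * b + - 2 * x" if "a \<le> b" "x \<le> y + a" for a b x y :: real
            using that by linarith
          ultimately have "- 2 * \<bar>real l - \<tau> i\<bar> \<le> 2 * real n + - 2 * \<bar>\<tau> i\<bar>" by blast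
          then show "exp (- 2 * \<bar>real l - \<tau> i\<bar>) \<le> exp (2 * real n + - 2 * \<bar>\<tau> i\<bar>)" by simp
        qed (simp add: G_def)
        finally show "exp (- \<beta> * (real l - \<tau> i)\<^sup>2) \<le> G * exp (2 * real n) * exp (- 2 * \<bar>\<tau> i\<bar>)"
          by (simp only: exp_add mult.assoc)
      qed simp
      also have "\<dots> = E * exp (- 2 * \<bar>\<tau> i\<bar>)"
        unfolding E_def Mb_def sum_distrib_left[symmetric] by (simp only: mult_ac)
      finally show ?thesis .
    qed
    have ineq: "cmod (b j) \<le> CL * (E * CK) * exp (- \<tau> m) + C * V" for m
    proof -
      define g where "g l = (\<Sum>k<m. val b k * dual k l)" for l
      define d where "d l = b l - g l" for l
      obtain Mg where Mg: "\<And>l. cmod (g l) \<le> Mg" unfolding g_def using val_dual_combination(2)[of "{..<m}" "val b"] by auto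
      obtain Mg' where Mg': "Mg' \<ge> 0" "lp_bound p Mg' (\<lambda>l. cmod (g l))"
        unfolding g_def using val_dual_combination(3)[of "{..<m}" "val b"] by auto
      have vg: "val g i = (if i < m then val b i else 0)" for i
        unfolding g_def[abs_def] using val_dual_combination(1)[of "{..<m}" "val b" i] by simp
      have vd: "val d i = (if i < m then 0 else val b i)" for i
        unfolding d_def using val_diff[of b Mb g Mg i, OF bM Mg] vg by simp
      have "\<exists>M\<ge>0. lp_bound p M (\<lambda>l. cmod (b l))"
        by (rule lp_bound_finite_support[of p _ n, OF p norm_ge_zero]) (simp add: fin)
      then obtain M1 where M1: "M1 \<ge> 0" "lp_bound p M1 (\<lambda>l. cmod (b l))" by blast
      have dlp: "lp_bound p (Ka * (M1 + Mg')) (\<lambda>l. cmod (d l))"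
        by (rule lp_bound_mono[OF p add[OF M1(2) Mg'(2)]])
           (use M1 Mg' Ka in \<open>auto simp: d_def intro: norm_triangle_ineq4\<close>)
      have dlp0: "0 \<le> Ka * (M1 + Mg')" using Ka M1 Mg' by simp
      \<comment> \<open>The kernel estimate is applied to the unit vector at 0, whose image is exp
        (- |\<tau> i|); this bounds that sequence in every l^p. The factor exp (- \<tau> m) is the
        second half of the decay of the values, beyond index m.\<close>
      have "lp_bound p ((E * exp (- \<tau> m)) * CK * 1) (\<lambda>i. cmod (val d i))"
      proof (rule kern[OF lp_bound_unit[OF p, of 0]])
        fix i
        have "(\<Sum>l. exp (- 1 * \<bar>\<tau> i - real l\<bar>) * (if l = 0 then 1 else 0)) = exp (- \<bar>\<tau> i\<bar>)"
          by (subst suminf_finite[of "{0}"]) auto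
        moreover have "cmod (val d i) \<le> (E * exp (- \<tau> m)) * exp (- \<bar>\<tau> i\<bar>)"
        proof (cases "i < m")
          case True
          then show ?thesis using E0 by (simp add: vd)
        next
          case False
          then have "\<tau> m \<le> \<tau> i" using mono_\<tau> by simp
          then have "exp (- 2 * \<bar>\<tau> i\<bar>) \<le> exp (- \<tau> m) * exp (- \<bar>\<tau> i\<bar>)"
            unfolding exp_add[symmetric] by simp
          then have "E * exp (- 2 * \<bar>\<tau> i\<bar>) \<le> E * (exp (- \<tau> m) * exp (- \<bar>\<tau> i\<bar>))"
            using E0 by (intro mult_left_mono) auto
          then show ?thesis using vdec[of i] False by (simp add: vd mult.assoc)
        qed
        ultimately show "cmod (val d i) \<le> (E * exp (- \<tau> m)) * (\<Sum>l. exp (- 1 * \<bar>\<tau> i - real l\<bar>) * (if l = 0 then 1 else 0))"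
          by simp
      qed (use E0 in auto)
      then have "lp_bound p (CL * ((E * exp (- \<tau> m)) * CK * 1)) (\<lambda>l. cmod (d l))"
        by (rule lower[OF dlp dlp0]) (use E0 CK in auto)
      then have dj: "cmod (d j) \<le> CL * ((E * exp (- \<tau> m)) * CK * 1)"
        by (rule lp_bound_component[OF p]) (use E0 CK CL in auto)
      have "cmod (g j) \<le> (\<Sum>k<m. cmod (val b k * dual k j))" unfolding g_def by (rule norm_sum)
      also have "\<dots> \<le> (\<Sum>k<m. C * (exp (- (2 * \<eta>) * \<bar>real j - \<tau> k\<bar>) * cmod (val b k)))"
      proof (intro sum_mono)
        fix k
        have "cmod (val b k) * cmod (dual k j) \<le> cmod (val b k) * (C * exp (- (2 * \<eta>) * \<bar>real j - \<tau> k\<bar>))"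
          by (intro mult_left_mono C) auto
        then show "cmod (val b k * dual k j) \<le> C * (exp (- (2 * \<eta>) * \<bar>real j - \<tau> k\<bar>) * cmod (val b k))"
          by (simp only: norm_mult mult_ac)
      qed
      also have "\<dots> = C * (\<Sum>k<m. exp (- (2 * \<eta>) * \<bar>real j - \<tau> k\<bar>) * cmod (val b k))"
        by (rule sum_distrib_left[symmetric])
      also have "\<dots> \<le> C * V" unfolding V_def using C by (intro mult_left_mono sum_le_suminf[OF s]) auto
      finally have "cmod (g j) \<le> C * V" .
      moreover have "cmod (b j) \<le> cmod (d j) + cmod (g j)"
        using norm_triangle_ineq[of "d j" "g j"] by (simp add: d_def)
      ultimately show ?thesis using dj by (simp add: mult_ac)
    qed
    have "((\<lambda>x::real. exp (- x)) \<longlongrightarrow> 0) at_top" by real_asymp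
    from filterlim_compose[OF this \<tau>_at_top] have "(\<lambda>m. exp (- \<tau> m)) \<longlonglongrightarrow> 0" .
    then have "(\<lambda>m. CL * (E * CK) * exp (- \<tau> m) + C * V) \<longlonglongrightarrow> CL * (E * CK) * 0 + C * V"
      by (intro tendsto_intros)
    then have "cmod (b j) \<le> CL * (E * CK) * 0 + C * V"
      by (rule LIMSEQ_le_const) (use ineq in auto)
    then show ?thesis using s by (simp add: V_def)
  qed
  show ?thesis
  proof (rule that[OF C(1,2,3)])
    fix b :: "nat \<Rightarrow> complex" and n j assume "\<forall>l\<ge>n. b l = 0"
    then have *: "summable (\<lambda>k. exp (- (2 * \<eta>) * \<bar>real j - \<tau> k\<bar>) * cmod (val b k)) \<and>
      cmod (b j) \<le> C * (\<Sum>k. exp (- (2 * \<eta>) * \<bar>real j - \<tau> k\<bar>) * cmod (val b k))"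
      by (intro main[of n b j]) auto
    show "summable (\<lambda>k. exp (- (2 * \<eta>) * \<bar>real j - \<tau> k\<bar>) * cmod (val b k))"
      "cmod (b j) \<le> C * (\<Sum>k. exp (- (2 * \<eta>) * \<bar>real j - \<tau> k\<bar>) * cmod (val b k))"
      using * by blast+
  qed
qed

text \<open>If \<tau> n lies far below n, the n + 1 dual vectors of index at most n are almost
  supported on the n coordinates below n, and a nontrivial combination vanishing on these
  coordinates is too small for its own values. If \<tau> n lies far above n, a polynomial of degree
  n vanishing at the first n nodes has its other values at nodes far from the indices of all its
  coefficients, which contradicts the expansion in the dual system.\<close>

lemma deviation_bounded: "\<exists>K. \<forall>n. \<bar>\<tau> n - real n\<bar> \<le> K"
proof -
  obtain C \<eta> where C: "0 < C" "0 < \<eta>" "\<And>k j. cmod (dual k j) \<le> C * exp (- (2 * \<eta>) * \<bar>real j - \<tau> k\<bar>)"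
    and fs: "\<And>b n j. \<forall>l\<ge>n. b l = 0 \<Longrightarrow> summable (\<lambda>k. exp (- (2 * \<eta>) * \<bar>real j - \<tau> k\<bar>) * cmod (val b k))"
    "\<And>b n j. \<forall>l\<ge>n. b l = 0 \<Longrightarrow>
      cmod (b j) \<le> C * (\<Sum>k. exp (- (2 * \<eta>) * \<bar>real j - \<tau> k\<bar>) * cmod (val b k))"
    using finite_support_bound by blast
  obtain Cv where Cv: "0 < Cv" "\<And>b M k. (\<And>l. cmod (b l) \<le> M) \<Longrightarrow> cmod (val b k) \<le> Cv * M"
    using val_bounded by blast
  obtain K1 where K1: "0 < K1" "\<And>t. (\<Sum>l. exp (- \<eta> * \<bar>\<tau> l - t\<bar>)) \<le> K1"
    using spread_exp_sum[OF spread_\<tau> C(2)] by blast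
  obtain K2 where K2: "0 < K2" "\<And>t n. (\<Sum>l<n. exp (- \<eta> * \<bar>\<tau> l - t\<bar>)) \<le> K2"
    using spread_exp_sum_finite[OF spread_\<tau> C(2)] by blast
  have "((\<lambda>x. C * Cv * (K1 + K2) * exp (- \<eta> * x)) \<longlongrightarrow> 0) at_top" using C by real_asymp
  then have "eventually (\<lambda>x. C * Cv * (K1 + K2) * exp (- \<eta> * x) < 1) at_top"
    by (rule order_tendstoD) simp
  then obtain K where K: "\<And>x. x \<ge> K \<Longrightarrow> C * Cv * (K1 + K2) * exp (- \<eta> * x) < 1"
    unfolding eventually_at_top_linorder by blast
  have Ksmall: "C * Cv * K1 * exp (- \<eta> * K) < 1" "C * Cv * K2 * exp (- \<eta> * K) < 1"
  proof -
    have "C * Cv * K1 * exp (- \<eta> * K) \<le> C * Cv * (K1 + K2) * exp (- \<eta> * K)"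
      "C * Cv * K2 * exp (- \<eta> * K) \<le> C * Cv * (K1 + K2) * exp (- \<eta> * K)"
      using C Cv K1 K2 by (auto intro!: mult_right_mono mult_left_mono)
    then show "C * Cv * K1 * exp (- \<eta> * K) < 1" "C * Cv * K2 * exp (- \<eta> * K) < 1"
      using K[of K] by linarith+
  qed
  have split: "exp (- (2 * \<eta>) * d) \<le> exp (- \<eta> * K) * exp (- \<eta> * d)" if "K \<le> d" for d
    using that C(2) by (simp add: exp_add[symmetric] mult_left_mono)
  have low: "real n - K \<le> \<tau> n" for n
  proof (rule ccontr)
    assume "\<not> real n - K \<le> \<tau> n"
    then have tn: "\<tau> n < real n - K" by simp
    obtain c where c: "\<exists>i\<in>{..n}. c i \<noteq> 0" "\<forall>j\<in>{..<n}. (\<Sum>i\<in>{..n}. c i * dual i j) = 0"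
      using homogeneous_system[of "{..<n}" "{..n}" dual] by auto
    define B where "B = Max ((\<lambda>i. cmod (c i)) ` {..n})"
    have cB: "cmod (c i) \<le> B" if "i \<le> n" for i unfolding B_def using that by (intro Max_ge) auto
    have "B \<in> (\<lambda>i. cmod (c i)) ` {..n}" unfolding B_def by (intro Max_in) auto
    then obtain k0 where k0: "k0 \<le> n" "B = cmod (c k0)" by auto
    have B0: "B > 0"
    proof -
      obtain i where "i \<le> n" "c i \<noteq> 0" using c(1) by auto
      then have "0 < cmod (c i)" by simp
      then show ?thesis using cB[OF \<open>i \<le> n\<close>] by linarith
    qed
    define v where "v j = (\<Sum>i\<in>{..n}. c i * dual i j)" for j
    have vB: "cmod (v j) \<le> C * K2 * exp (- \<eta> * K) * B" for j
    proof (cases "j < n")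
      case True
      then show ?thesis using c(2) C K2 B0 by (simp add: v_def)
    next
      case False
      have "cmod (v j) \<le> (\<Sum>i\<in>{..n}. cmod (c i * dual i j))" unfolding v_def by (rule norm_sum)
      also have "\<dots> \<le> (\<Sum>i\<in>{..n}. (B * C * exp (- \<eta> * K)) * exp (- \<eta> * \<bar>\<tau> i - real j\<bar>))"
      proof (rule sum_mono)
        fix i assume i: "i \<in> {..n}"
        have "\<tau> i \<le> \<tau> n" using i mono_\<tau> by simp
        then have "K \<le> \<bar>real j - \<tau> i\<bar>" using tn False by linarith
        then have "cmod (c i) * cmod (dual i j) \<le> B * (C * (exp (- \<eta> * K) * exp (- \<eta> * \<bar>real j - \<tau> i\<bar>)))"
          using i B0 C by (intro mult_mono cB order_trans[OF C(3)] mult_left_mono split) auto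
        then show "cmod (c i * dual i j) \<le> (B * C * exp (- \<eta> * K)) * exp (- \<eta> * \<bar>\<tau> i - real j\<bar>)"
          by (simp only: norm_mult mult.assoc abs_minus_commute)
      qed
      also have "\<dots> = (B * C * exp (- \<eta> * K)) * (\<Sum>i<Suc n. exp (- \<eta> * \<bar>\<tau> i - real j\<bar>))"
        unfolding lessThan_Suc_atMost by (rule sum_distrib_left[symmetric])
      also have "\<dots> \<le> (B * C * exp (- \<eta> * K)) * K2" using B0 C by (intro mult_left_mono K2) auto
      finally show ?thesis by (simp only: mult_ac)
    qed
    \<comment> \<open>Evaluation at the largest coefficient recovers \<open>B\<close>, which is
      thereby bounded by itself times a factor below 1.\<close>
    have "val v k0 = c k0" unfolding v_def[abs_def] using val_dual_combination(1)[of "{..n}" c k0] k0 by simp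
    then have "B \<le> Cv * (C * K2 * exp (- \<eta> * K) * B)" using Cv(2)[of v _ k0, OF vB] k0 by simp
    also have "\<dots> = (C * Cv * K2 * exp (- \<eta> * K)) * B" by (simp only: mult_ac)
    also have "\<dots> < 1 * B" using Ksmall(2) B0 by (intro mult_strict_right_mono)
    finally show False by simp
  qed
  have up: "\<tau> n \<le> real n + K" for n
  proof (rule ccontr)
    assume "\<not> \<tau> n \<le> real n + K"
    then have tn: "\<tau> n > real n + K" by simp
    define Q where "Q = (\<Prod>k<n. [:- \<omega> k, 1:])"
    have deg: "degree Q = n" unfolding Q_def by (subst degree_prod_eq_sum_degree) auto
    have Q0: "Q \<noteq> 0" unfolding Q_def by simp
    define b where "b = coeffs_of Q"
    have fin: "b l = 0" if "l \<ge> Suc n" for l using that deg by (simp add: b_def coeffs_of_def coeff_eq_0)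
    have bn: "b n \<noteq> 0" using Q0 deg by (auto simp: b_def coeffs_of_def)
    define B where "B = Max ((\<lambda>i. cmod (b i)) ` {..n})"
    have "B \<in> (\<lambda>i. cmod (b i)) ` {..n}" unfolding B_def by (intro Max_in) auto
    then obtain j where j: "j \<le> n" "B = cmod (b j)" by auto
    have bB': "cmod (b i) \<le> B" if "i \<le> n" for i unfolding B_def using that by (intro Max_ge) auto
    have B0: "B > 0" using bB'[of n] bn by (metis le_refl less_le_trans zero_less_norm_iff)
    have bB: "cmod (b i) \<le> B" for i using bB'[of i] fin[of i] B0 by (cases "i \<le> n") auto
    have v0: "val b k = 0" if "k < n" for k
      unfolding b_def val_coeffs_of Q_def poly_prod using that by auto
    have s2: "summable (\<lambda>k. (exp (- \<eta> * K) * (Cv * B)) * exp (- \<eta> * \<bar>\<tau> k - real j\<bar>))"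
      by (intro summable_mult spread_exp_summable spread_\<tau> C(2))
    have "B \<le> C * (\<Sum>k. exp (- (2 * \<eta>) * \<bar>real j - \<tau> k\<bar>) * cmod (val b k))"
      using fs(2)[of "Suc n" b j] fin j by simp
    also have "\<dots> \<le> C * (\<Sum>k. (exp (- \<eta> * K) * (Cv * B)) * exp (- \<eta> * \<bar>\<tau> k - real j\<bar>))"
    proof (intro mult_left_mono suminf_le s2)
      show "summable (\<lambda>k. exp (- (2 * \<eta>) * \<bar>real j - \<tau> k\<bar>) * cmod (val b k))"
        using fs(1)[of "Suc n" b j] fin by simp
      fix k
      show "exp (- (2 * \<eta>) * \<bar>real j - \<tau> k\<bar>) * cmod (val b k) \<le> (exp (- \<eta> * K) * (Cv * B)) * exp (- \<eta> * \<bar>\<tau> k - real j\<bar>)"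
      proof (cases "k < n")
        case True
        then show ?thesis using v0 Cv B0 by simp
      next
        case False
        then have "\<tau> n \<le> \<tau> k" using mono_\<tau> by simp
        then have "K \<le> \<bar>real j - \<tau> k\<bar>" using tn j(1) by linarith
        then have "exp (- (2 * \<eta>) * \<bar>real j - \<tau> k\<bar>) * cmod (val b k) \<le> (exp (- \<eta> * K) * exp (- \<eta> * \<bar>real j - \<tau> k\<bar>)) * (Cv * B)"
          using Cv(2)[of b B k, OF bB] by (intro mult_mono split) auto
        then show ?thesis by (simp only: mult_ac abs_minus_commute)
      qed
    qed (use C in auto)
    also have "\<dots> = C * ((exp (- \<eta> * K) * (Cv * B)) * (\<Sum>k. exp (- \<eta> * \<bar>\<tau> k - real j\<bar>)))"
      by (subst suminf_mult[OF spread_exp_summable[OF spread_\<tau> C(2)]]) simp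
    also have "\<dots> \<le> C * ((exp (- \<eta> * K) * (Cv * B)) * K1)"
      using C Cv B0 by (intro mult_left_mono K1) auto
    also have "\<dots> = (C * Cv * K1 * exp (- \<eta> * K)) * B" by (simp only: mult_ac)
    also have "\<dots> < 1 * B" using Ksmall(1) B0 by (intro mult_strict_right_mono)
    finally show False by simp
  qed
  have "\<bar>\<tau> n - real n\<bar> \<le> K" for n using low[of n] up[of n] by linarith
  then show ?thesis by blast
qed

end

section \<open>Averages of the deviations\<close>

context gauss_nodes
begin

text \<open>On the circle of parameter \<open>t\<close> the monomials concentrate at index t, at the
  scale exp (\<beta> t^2). If the coefficients concentrate at \<open>u\<close>, the two
  localisations combine to the gain exp (- \<eta> |t - u|): half of the rate 2\<eta> is spent on the
  distance from t to u, half on summation.\<close>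

lemma gauss_series_circle_le:
  assumes "\<And>l. cmod (b l) \<le> E * exp (- (2 * \<eta>) * \<bar>real l - u\<bar>)"
    and "0 < \<eta>" "0 \<le> E" "cmod z = exp (2 * \<beta> * t)"
    and "\<And>x. (\<Sum>l. exp (- \<eta> * \<bar>real l - x\<bar>)) \<le> K"
  shows "cmod (gauss_series \<beta> 0 b z) \<le> exp (\<beta> * t\<^sup>2) * (E * exp (\<eta>\<^sup>2 / (4*\<beta>)) * K * exp (- \<eta> * \<bar>t - u\<bar>))"
proof -
  have b: "cmod (b l) \<le> E" for l
  proof -
    have "E * exp (- (2 * \<eta>) * \<bar>real l - u\<bar>) \<le> E * 1" using assms by (intro mult_left_mono) auto
    then show ?thesis using assms(1)[of l] by simp
  qed
  have eq: "cmod (b l) * (exp (- \<beta> * (real l + 0)\<^sup>2) * cmod z ^ l) =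
      exp (\<beta> * t\<^sup>2) * (exp (- \<beta> * (real l - t)\<^sup>2) * cmod (b l))" for l
    using gauss_monomial[of \<beta> l 0 t] by (simp add: assms(4))
  have ks: "summable (\<lambda>l. exp (- \<eta> * \<bar>real l - u\<bar>))" by (intro spread_exp_summable spread_real assms)
  have "cmod (gauss_series \<beta> 0 b z) \<le> (\<Sum>l. cmod (b l) * (exp (- \<beta> * (real l + 0)\<^sup>2) * cmod z ^ l))"
    by (rule gauss_series_sums(2)[OF \<beta>_pos b])
  also have "\<dots> = exp (\<beta> * t\<^sup>2) * (\<Sum>l. exp (- \<beta> * (real l - t)\<^sup>2) * cmod (b l))"
    unfolding eq by (rule suminf_mult[OF val_summable[OF b]])
  also have "(\<Sum>l. exp (- \<beta> * (real l - t)\<^sup>2) * cmod (b l)) \<le>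
      (\<Sum>l. (E * exp (\<eta>\<^sup>2 / (4*\<beta>)) * exp (- \<eta> * \<bar>t - u\<bar>)) * exp (- \<eta> * \<bar>real l - u\<bar>))"
  proof (rule suminf_le[OF _ val_summable[OF b] summable_mult[OF ks]])
    fix l
    have "\<eta> * \<bar>t - u\<bar> \<le> \<eta> * (\<bar>real l - t\<bar> + \<bar>real l - u\<bar>)" using assms(2) by (intro mult_left_mono) auto
    then have e: "exp (- \<eta> * \<bar>real l - t\<bar>) * exp (- (2 * \<eta>) * \<bar>real l - u\<bar>) \<le> exp (- \<eta> * \<bar>t - u\<bar>) * exp (- \<eta> * \<bar>real l - u\<bar>)"
      unfolding exp_add[symmetric] by (simp add: algebra_simps)
    have "exp (- \<beta> * (real l - t)\<^sup>2) * cmod (b l) \<le>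
       (exp (\<eta>\<^sup>2 / (4*\<beta>)) * exp (- \<eta> * \<bar>real l - t\<bar>)) * (E * exp (- (2 * \<eta>) * \<bar>real l - u\<bar>))"
      by (intro mult_mono gauss_le \<beta>_pos assms(1)) auto
    also have "\<dots> = (E * exp (\<eta>\<^sup>2 / (4*\<beta>))) * (exp (- \<eta> * \<bar>real l - t\<bar>) * exp (- (2 * \<eta>) * \<bar>real l - u\<bar>))"
      by (simp only: mult_ac)
    also have "\<dots> \<le> (E * exp (\<eta>\<^sup>2 / (4*\<beta>))) * (exp (- \<eta> * \<bar>t - u\<bar>) * exp (- \<eta> * \<bar>real l - u\<bar>))"
      using assms(3) by (intro mult_left_mono e) auto
    finally show "exp (- \<beta> * (real l - t)\<^sup>2) * cmod (b l) \<le>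
       (E * exp (\<eta>\<^sup>2 / (4*\<beta>)) * exp (- \<eta> * \<bar>t - u\<bar>)) * exp (- \<eta> * \<bar>real l - u\<bar>)"
      by (simp only: mult.assoc)
  qed
  also have "\<dots> = (E * exp (\<eta>\<^sup>2 / (4*\<beta>)) * exp (- \<eta> * \<bar>t - u\<bar>)) * (\<Sum>l. exp (- \<eta> * \<bar>real l - u\<bar>))"
    by (rule suminf_mult[OF ks])
  also have "\<dots> \<le> (E * exp (\<eta>\<^sup>2 / (4*\<beta>)) * exp (- \<eta> * \<bar>t - u\<bar>)) * K"
    using assms(3) by (intro mult_left_mono assms(5)) auto
  finally show ?thesis by (simp add: mult_ac)
qed

end

lemma sum_real_interval: "j \<le> m \<Longrightarrow> 2 * (\<Sum>i=j..<m. real i) = real m * real m - real m - (real j * real j - real j)"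
proof (induction m)
  case (Suc m)
  then show ?case by (cases "j = Suc m") (auto simp: algebra_simps)
qed simp

context stable_nodes
begin

text \<open>The polynomial with zeros \<omega> 0, ..., \<omega> (m - 1) has values at the later
  nodes that are Gaussian about m, so its coefficients decay away from m. On the circle of parameter
  j this makes it small by a factor exp (- (\<eta>/2) (m - j)), whereas by
  \<open>prod_max_le_circle\<close> it must somewhere reach the product of the maxima. Comparing
  logarithms bounds the sum of \<tau> over [j, m) from above.\<close>

lemma upper_average:
  "\<exists>e>0. \<exists>C. \<forall>j m. j \<le> m \<longrightarrow> (\<Sum>i=j..<m. \<tau> i - real i) \<le> (1/2 - e) * (real m - real j) + C"
proof -
  obtain C \<eta> where C: "0 < C" "0 < \<eta>" "\<And>k j. cmod (dual k j) \<le> C * exp (- (2 * \<eta>) * \<bar>real j - \<tau> k\<bar>)"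
    and fs: "\<And>b n j. \<forall>l\<ge>n. b l = 0 \<Longrightarrow> summable (\<lambda>k. exp (- (2 * \<eta>) * \<bar>real j - \<tau> k\<bar>) * cmod (val b k))"
    "\<And>b n j. \<forall>l\<ge>n. b l = 0 \<Longrightarrow>
      cmod (b j) \<le> C * (\<Sum>k. exp (- (2 * \<eta>) * \<bar>real j - \<tau> k\<bar>) * cmod (val b k))"
    using finite_support_bound by blast
  have b2: "2 * \<beta> > 0" and \<eta>h: "\<eta> / 2 > 0" using \<beta>_pos C by auto
  obtain K1 where K1: "0 < K1" "\<And>t. (\<Sum>l. exp (- \<eta> * \<bar>\<tau> l - t\<bar>)) \<le> K1"
    using spread_exp_sum[OF spread_\<tau> C(2)] by blast
  obtain K2 where K2: "0 < K2" "\<And>t n. (\<Sum>l<n. exp (- (2*\<beta>) * \<bar>\<tau> l - t\<bar>)) \<le> K2"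
    using spread_exp_sum_finite[OF spread_\<tau> b2] by blast
  obtain K3 where K3: "0 < K3" "\<And>t. (\<Sum>l. exp (- (\<eta>/2) * \<bar>real l - t\<bar>)) \<le> K3"
    using spread_exp_sum[OF spread_real \<eta>h] by blast
  define G where "G = exp (\<eta>\<^sup>2 / (4*\<beta>))"
  define A where "A = C * (exp K2 * G) * K1"
  define A' where "A' = A * exp ((\<eta>/2)\<^sup>2 / (4*\<beta>)) * K3"
  have A: "A > 0" "A' > 0" using C K1 K3 by (auto simp: A_def A'_def G_def)
  \<comment> \<open>The gain on the circle has rate \<eta>/2, and the sum of the deviations appears
    with the factor 2\<beta>.\<close>
  define e where "e = \<eta> / (4 * \<beta>)"
  have main: "(\<Sum>i=j..<m. \<tau> i - real i) \<le> (1/2 - e) * (real m - real j) + ln A' / (2*\<beta>)" if jm: "j \<le> m" for j m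
  proof -
    define Q where "Q = (\<Prod>k<m. [:- \<omega> k, 1:])"
    have pQ: "poly Q z = (\<Prod>k<m. z - \<omega> k)" for z unfolding Q_def poly_prod by simp
    have deg: "degree Q = m" unfolding Q_def by (subst degree_prod_eq_sum_degree) auto
    define b where "b = coeffs_of Q"
    have fin: "\<forall>l\<ge>Suc m. b l = 0" using deg by (simp add: b_def coeffs_of_def coeff_eq_0)
    have vb: "cmod (val b k) \<le> (exp K2 * G * exp (\<beta> * (real m)\<^sup>2)) * exp (- \<eta> * \<bar>\<tau> k - real m\<bar>)" for k
    proof (cases "k < m")
      case True
      then have "val b k = 0" unfolding b_def val_coeffs_of pQ by auto
      then show ?thesis by (simp add: G_def)
    next
      case False
      have "(\<Prod>i<m. cmod (\<omega> k - \<omega> i)) \<le> exp (2*\<beta> * (\<Sum>i<m. max (\<tau> k) (\<tau> i))) * exp K2"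
        by (rule prod_dist_le[OF K2(2)]) (auto simp: norm_\<omega>)
      also have "(\<Sum>i<m. max (\<tau> k) (\<tau> i)) = (\<Sum>i<m. \<tau> k)"
        using False mono_\<tau> by (intro sum.cong refl) (auto simp: max_absorb1)
      finally have "cmod (poly Q (\<omega> k)) \<le> exp (2*\<beta>*(real m * \<tau> k)) * exp K2"
        unfolding pQ prod_norm by simp
      then have "cmod (val b k) \<le> exp (2*\<beta>*(real m * \<tau> k)) * exp K2 * exp (- \<beta> * (\<tau> k)\<^sup>2)"
        unfolding b_def val_coeffs_of norm_mult by (intro mult_mono) auto
      \<comment> \<open>For k \<ge> m the polynomial is of size exp (2\<beta> m \<tau> k) at node k.
        Against the normalisation exp (- \<beta> (\<tau> k)^2) this is a Gaussian about m of
        amplitude exp (\<beta> m^2).\<close>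
      also have "\<dots> = exp K2 * exp (\<beta> * (real m)\<^sup>2) * exp (- \<beta> * (\<tau> k - real m)\<^sup>2)"
        unfolding exp_add[symmetric] by (simp add: power2_eq_square algebra_simps)
      also have "\<dots> \<le> exp K2 * exp (\<beta> * (real m)\<^sup>2) * (G * exp (- \<eta> * \<bar>\<tau> k - real m\<bar>))"
        unfolding G_def by (intro mult_left_mono gauss_le \<beta>_pos) auto
      finally show ?thesis by (simp only: mult_ac)
    qed
    have bl: "cmod (b l) \<le> (A * exp (\<beta> * (real m)\<^sup>2)) * exp (- (2 * (\<eta>/2)) * \<bar>real l - real m\<bar>)" for l
    proof -
      let ?E = "exp K2 * G * exp (\<beta> * (real m)\<^sup>2)"
      have s: "summable (\<lambda>k. (?E * exp (- \<eta> * \<bar>real l - real m\<bar>)) * exp (- \<eta> * \<bar>\<tau> k - real l\<bar>))"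
        by (intro summable_mult spread_exp_summable spread_\<tau> C(2))
      have "cmod (b l) \<le> C * (\<Sum>k. exp (- (2 * \<eta>) * \<bar>real l - \<tau> k\<bar>) * cmod (val b k))"
        by (rule fs(2)[OF fin])
      also have "\<dots> \<le> C * (\<Sum>k. (?E * exp (- \<eta> * \<bar>real l - real m\<bar>)) * exp (- \<eta> * \<bar>\<tau> k - real l\<bar>))"
      proof (intro mult_left_mono suminf_le s fs(1)[OF fin])
        fix k
        have "\<eta> * \<bar>real l - real m\<bar> \<le> \<eta> * (\<bar>real l - \<tau> k\<bar> + \<bar>\<tau> k - real m\<bar>)"
          using C by (intro mult_left_mono) auto
        then have e: "exp (- (2 * \<eta>) * \<bar>real l - \<tau> k\<bar>) * exp (- \<eta> * \<bar>\<tau> k - real m\<bar>) \<le>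
           exp (- \<eta> * \<bar>real l - real m\<bar>) * exp (- \<eta> * \<bar>\<tau> k - real l\<bar>)"
          unfolding exp_add[symmetric] by (simp add: algebra_simps abs_minus_commute)
        have "exp (- (2 * \<eta>) * \<bar>real l - \<tau> k\<bar>) * cmod (val b k) \<le>
           exp (- (2 * \<eta>) * \<bar>real l - \<tau> k\<bar>) * (?E * exp (- \<eta> * \<bar>\<tau> k - real m\<bar>))"
          by (intro mult_left_mono vb) auto
        also have "\<dots> = ?E * (exp (- (2 * \<eta>) * \<bar>real l - \<tau> k\<bar>) * exp (- \<eta> * \<bar>\<tau> k - real m\<bar>))"
          by (simp only: mult_ac)
        also have "\<dots> \<le> ?E * (exp (- \<eta> * \<bar>real l - real m\<bar>) * exp (- \<eta> * \<bar>\<tau> k - real l\<bar>))"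
          by (intro mult_left_mono e) (auto simp: G_def)
        finally show "exp (- (2 * \<eta>) * \<bar>real l - \<tau> k\<bar>) * cmod (val b k) \<le> (?E * exp (- \<eta> * \<bar>real l - real m\<bar>)) * exp (- \<eta> * \<bar>\<tau> k - real l\<bar>)"
          by (simp only: mult.assoc)
      qed (use C in auto)
      also have "\<dots> = C * ((?E * exp (- \<eta> * \<bar>real l - real m\<bar>)) * (\<Sum>k. exp (- \<eta> * \<bar>\<tau> k - real l\<bar>)))"
        by (subst suminf_mult[OF spread_exp_summable[OF spread_\<tau> C(2)]]) simp
      also have "\<dots> \<le> C * ((?E * exp (- \<eta> * \<bar>real l - real m\<bar>)) * K1)"
        using C by (intro mult_left_mono K1) (auto simp: G_def)
      also have "\<dots> = (A * exp (\<beta> * (real m)\<^sup>2)) * exp (- (2 * (\<eta>/2)) * \<bar>real l - real m\<bar>)"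
        unfolding A_def by simp
      finally show ?thesis .
    qed
    obtain z where z: "cmod z = exp (2*\<beta>*real j)" "(\<Prod>i<m. max (exp (2*\<beta>*real j)) (cmod (\<omega> i))) \<le> (\<Prod>i<m. cmod (z - \<omega> i))"
      using prod_max_le_circle[of "exp (2*\<beta>*real j)" \<omega> "{..<m}"] by auto
    have "(\<Prod>i<m. max (exp (2*\<beta>*real j)) (cmod (\<omega> i))) = exp (2*\<beta> * (\<Sum>i<m. max (real j) (\<tau> i)))"
      unfolding sum_distrib_left by (subst exp_sum, simp, intro prod.cong refl) (use \<beta>_pos in \<open>auto simp: norm_\<omega> max_def\<close>)
    moreover have "real j * real j + (\<Sum>i=j..<m. \<tau> i) \<le> (\<Sum>i<m. max (real j) (\<tau> i))"
    proof -
      have "(\<Sum>i<m. max (real j) (\<tau> i)) = (\<Sum>i\<in>{0..<j}. max (real j) (\<tau> i)) + (\<Sum>i=j..<m. max (real j) (\<tau> i))"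
        unfolding atLeast0LessThan[symmetric] by (rule sum.atLeastLessThan_concat[OF le0 jm, symmetric])
      moreover have "(\<Sum>i\<in>{0..<j}. real j) \<le> (\<Sum>i\<in>{0..<j}. max (real j) (\<tau> i))" by (intro sum_mono) auto
      moreover have "(\<Sum>i=j..<m. \<tau> i) \<le> (\<Sum>i=j..<m. max (real j) (\<tau> i))" by (intro sum_mono) auto
      ultimately show ?thesis by simp
    qed
    moreover have "(\<Prod>i<m. cmod (z - \<omega> i)) = cmod (gauss_series \<beta> 0 b z)"
      unfolding b_def gauss_series_coeffs_of pQ prod_norm ..
    moreover have "cmod (gauss_series \<beta> 0 b z) \<le> exp (\<beta> * (real j)\<^sup>2) *
       ((A * exp (\<beta> * (real m)\<^sup>2)) * exp ((\<eta>/2)\<^sup>2 / (4*\<beta>)) * K3 * exp (- (\<eta>/2) * \<bar>real j - real m\<bar>))"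
      by (rule gauss_series_circle_le[OF bl \<eta>h _ z(1) K3(2)]) (use A in simp)
    moreover have "\<dots> = exp (ln A' + \<beta> * (real j)\<^sup>2 + \<beta> * (real m)\<^sup>2 - (\<eta>/2) * \<bar>real j - real m\<bar>)"
    proof -
      have lnA: "exp (ln A') = A * exp ((\<eta>/2)\<^sup>2 / (4*\<beta>)) * K3" using A(2) unfolding A'_def by (rule exp_ln)
      have "exp (ln A' + \<beta> * (real j)\<^sup>2 + \<beta> * (real m)\<^sup>2 - (\<eta>/2) * \<bar>real j - real m\<bar>) =
        exp (ln A') * exp (\<beta> * (real j)\<^sup>2) * exp (\<beta> * (real m)\<^sup>2) * exp (- (\<eta>/2) * \<bar>real j - real m\<bar>)"
        unfolding exp_add[symmetric] by simp
      then show ?thesis unfolding lnA by (simp only: mult_ac)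
    qed
    moreover have "exp (2*\<beta>*(real j * real j + (\<Sum>i=j..<m. \<tau> i))) \<le> exp (2*\<beta> * (\<Sum>i<m. max (real j) (\<tau> i)))"
      using calculation(2) \<beta>_pos by simp
    ultimately have "exp (2*\<beta>*(real j * real j + (\<Sum>i=j..<m. \<tau> i))) \<le>
        exp (ln A' + \<beta> * (real j)\<^sup>2 + \<beta> * (real m)\<^sup>2 - (\<eta>/2) * \<bar>real j - real m\<bar>)" using z(2) by linarith
    then have le: "2*\<beta>*(real j * real j + (\<Sum>i=j..<m. \<tau> i)) \<le> ln A' + \<beta> * (real j)\<^sup>2 + \<beta> * (real m)\<^sup>2 - (\<eta>/2) * \<bar>real j - real m\<bar>"
      by simp
    define X where "X = (\<Sum>i=j..<m. \<tau> i - real i)"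
    \<comment> \<open>Twice the sum of the integers in [j, m) falls short of m^2 - j^2 by m - j;
      this linear term is the origin of the bound 1/2.\<close>
    have "2 * (\<Sum>i=j..<m. \<tau> i) = 2 * X + 2 * (\<Sum>i=j..<m. real i)" by (simp add: X_def sum_subtractf)
    then have "2 * (\<Sum>i=j..<m. \<tau> i) = 2 * X + (real m * real m - real m - (real j * real j - real j))"
      unfolding sum_real_interval[OF jm] .
    then have eqY: "2*\<beta>*(real j * real j + (\<Sum>i=j..<m. \<tau> i)) = \<beta> * (2 * (real j * real j) + (2 * X + (real m * real m - real m - (real j * real j - real j))))"
      by (metis (no_types, opaque_lifting) distrib_left mult.assoc mult.left_commute)
    have ab: "\<bar>real j - real m\<bar> = real m - real j" using jm by simp
    have "\<beta> * (2 * (real j * real j) + (2 * X + (real m * real m - real m - (real j * real j - real j)))) \<le>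
       ln A' + \<beta> * (real j)\<^sup>2 + \<beta> * (real m)\<^sup>2 - (\<eta>/2) * (real m - real j)" using le unfolding eqY ab .
    then have "2 * \<beta> * X \<le> \<beta> * (real m - real j) - (\<eta>/2) * (real m - real j) + ln A'"
      by (simp add: power2_eq_square algebra_simps)
    then have "X \<le> (\<beta> * (real m - real j) - (\<eta>/2) * (real m - real j) + ln A') / (2 * \<beta>)"
      using \<beta>_pos by (simp add: field_simps)
    also have "\<dots> = (1/2 - e) * (real m - real j) + ln A' / (2*\<beta>)"
      using \<beta>_pos by (simp add: e_def field_simps)
    finally show ?thesis by (simp add: X_def)
  qed
  moreover have "e > 0" using C \<beta>_pos by (simp add: e_def)
  ultimately show ?thesis by blast
qed

text \<open>The dual function of node k, divided by the linear factors of the other nodes below m,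
  is entire. On a circle just outside these nodes its size is bounded through the decay of the dual
  coefficients, at \<omega> k the dual function is known from its normalisation, and the maximum
  principle compares the two. The gain exp (- \<eta> (m - k)) on the circle gives the strict
  margin.\<close>

lemma lower_average:
  "\<exists>e>0. \<exists>C. \<forall>k m. k \<le> m \<longrightarrow> - (\<Sum>i=k..<m. \<tau> i - real i) \<le> (1/2 - e) * (real m - real k) + C"
proof -
  obtain C \<eta> where C: "0 < C" "0 < \<eta>" "\<And>k j. cmod (dual k j) \<le> C * exp (- (2 * \<eta>) * \<bar>real j - \<tau> k\<bar>)"
    using dual_decay by blast
  obtain Kd where Kd: "\<And>n. \<bar>\<tau> n - real n\<bar> \<le> Kd" using deviation_bounded by blast
  have b2: "2 * \<beta> > 0" using \<beta>_pos by auto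
  obtain K2 where K2: "0 < K2" "\<And>t n. (\<Sum>l<n. exp (- (2*\<beta>) * \<bar>\<tau> l - t\<bar>)) \<le> K2"
    using spread_exp_sum_finite[OF spread_\<tau> b2] by blast
  obtain K3 where K3: "0 < K3" "\<And>t. (\<Sum>l. exp (- \<eta> * \<bar>real l - t\<bar>)) \<le> K3"
    using spread_exp_sum[OF spread_real C(2)] by blast
  define A where "A = C * exp (\<eta>\<^sup>2 / (4*\<beta>)) * K3"
  have A: "A > 0" using C K3 by (simp add: A_def)
  \<comment> \<open>Lowering the parameter by \<open>a\<close> halves the modulus. A node at least
    that far inside the circle has x \<le> 1/2, so its factor loses at most exp (- 2x) against the
    radius.\<close>
  define a where "a = ln 2 / (2*\<beta>)"
  have a: "a \<ge> 0" using \<beta>_pos by (simp add: a_def)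
  \<comment> \<open>Then m + \<kappa> - a bounds \<tau> i for all i < m, by the bound
    \<open>Kd\<close> for the deviations.\<close>
  define \<kappa> where "\<kappa> = Kd + a"
  define L3 where "L3 = ln A + 3 * K2"
  define e where "e = \<eta> / (2 * \<beta>)"
  define C0 where "C0 = (L3 + \<beta> * (2 * Kd + (\<kappa> + 1)\<^sup>2)) / (2 * \<beta>)"
  have main: "- (\<Sum>i=k..<m. \<tau> i - real i) \<le> (1/2 - e) * (real m - real k) + C0" if km: "k < m" for k m
  proof -
    define s where "s = real m + \<kappa>"
    define R where "R = exp (2*\<beta> * s)"
    define I where "I = {..<m} - {k}"
    have I: "finite I" by (simp add: I_def)
    have cI: "real (card I) = real m - 1" using km by (simp add: I_def)
    have I_sum: "(\<Sum>i\<in>I. exp (- (2*\<beta>) * \<bar>\<tau> i - t\<bar>)) \<le> K2" for t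
      unfolding I_def by (rule order_trans[OF sum_mono2 K2(2)[of t m]]) auto
    define g where "g = gauss_series \<beta> 0 (dual k)"
    obtain M where M: "\<And>l. cmod (dual k l) \<le> M" using dual_bounded by blast
    have gh: "g holomorphic_on UNIV" unfolding g_def by (rule gauss_series_entire(1)[OF \<beta>_pos M])
    have g\<omega>: "g (\<omega> i) * exp (- \<beta> * (\<tau> i)\<^sup>2) = (if i = k then 1 else 0)" for i
      using dual(2)[of k i] by (simp add: val_def g_def)
    have g0: "g (\<omega> i) = 0" if "i \<in> I" for i using g\<omega>[of i] that by (auto simp: I_def)
    have "cmod (g (\<omega> k)) * exp (- \<beta> * (\<tau> k)\<^sup>2) = 1"
      using arg_cong[OF g\<omega>[of k], of cmod] by (simp add: norm_mult)
    then have gk: "cmod (g (\<omega> k)) = exp (\<beta> * (\<tau> k)\<^sup>2)" by (simp add: exp_minus field_simps)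
    have "inj_on \<omega> I" using inj_\<omega> by (rule inj_on_subset) simp
    then obtain h where h: "h holomorphic_on UNIV" "\<And>z. g z = h z * (\<Prod>i\<in>I. z - \<omega> i)"
      using entire_divide_zeros[OF I gh, of \<omega>] g0 by blast
    define B where "B = exp (\<beta> * s\<^sup>2) * (A * exp (- \<eta> * \<bar>s - \<tau> k\<bar>)) * (exp (- (2*\<beta> * s * (real m - 1))) * exp (2 * K2))"
    have ti: "\<tau> i \<le> s - a" if "i < m" for i
      using Kd[of i] that unfolding s_def \<kappa>_def by (simp add: abs_le_iff)
    have circ: "cmod (h z) \<le> B" if z: "cmod z = R" for z
    proof -
      have gz: "cmod (g z) \<le> exp (\<beta> * s\<^sup>2) * (A * exp (- \<eta> * \<bar>s - \<tau> k\<bar>))"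
        unfolding g_def A_def using C z K3
        by (intro gauss_series_circle_le) (auto simp: R_def)
      have low: "exp (2*\<beta> * s * (real m - 1)) * exp (- 2 * K2) \<le> (\<Prod>i\<in>I. cmod (z - \<omega> i))"
      proof -
        define x where "x i = exp (- (2*\<beta>) * \<bar>\<tau> i - s\<bar>)" for i
        have "exp (2*\<beta> * s) * exp (- 2 * x i) \<le> cmod (z - \<omega> i)" if i: "i \<in> I" for i
        proof -
          have ts: "\<tau> i \<le> s - a" using ti i by (simp add: I_def)
          then have "2*\<beta> * a \<le> 2*\<beta> * \<bar>\<tau> i - s\<bar>" using b2 a by (intro mult_left_mono) auto
          then have "ln 2 \<le> 2*\<beta> * \<bar>\<tau> i - s\<bar>" using \<beta>_pos by (simp add: a_def)
          then have "x i \<le> exp (- ln 2)" unfolding x_def by simp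
          then have x: "x i \<le> 1/2" "0 < x i" by (auto simp: exp_minus x_def)
          have "1 + 2 * x i \<le> exp (2 * x i)" by (rule exp_ge_add_one_self)
          moreover have "1 \<le> (1 - x i) * (1 + 2 * x i)" using x by (simp add: algebra_simps mult_left_le)
          ultimately have "1 \<le> (1 - x i) * exp (2 * x i)"
            using x mult_left_mono[of "1 + 2 * x i" "exp (2 * x i)" "1 - x i"] by linarith
          then have e1: "exp (- 2 * x i) \<le> 1 - x i" by (simp add: exp_minus field_simps)
          have "exp (2*\<beta> * s) * exp (- 2 * x i) \<le> exp (2*\<beta> * s) * (1 - x i)" by (intro mult_left_mono e1) auto
          also have "\<dots> = exp (2*\<beta> * s) - exp (2*\<beta> * s) * x i" by (simp add: algebra_simps)
          also have "exp (2*\<beta> * s) * x i = exp (2*\<beta>*\<tau> i)" unfolding x_def exp_add[symmetric]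
            using ts a by (simp add: algebra_simps)
          also have "exp (2*\<beta> * s) - exp (2*\<beta>*\<tau> i) \<le> cmod (z - \<omega> i)"
            using norm_triangle_ineq2[of z "\<omega> i"] z by (simp add: norm_\<omega> R_def)
          finally show ?thesis .
        qed
        then have "(\<Prod>i\<in>I. exp (2*\<beta> * s) * exp (- 2 * x i)) \<le> (\<Prod>i\<in>I. cmod (z - \<omega> i))"
          by (intro prod_mono) auto
        moreover have "(\<Prod>i\<in>I. exp (2*\<beta> * s) * exp (- 2 * x i)) = exp (2*\<beta> * s * (real m - 1)) * exp (- 2 * (\<Sum>i\<in>I. x i))"
          using I cI by (simp add: prod.distrib exp_sum[symmetric] sum_distrib_left exp_of_nat_mult[symmetric] sum_negf mult_ac sum_distrib_right)
        moreover have "exp (- 2 * K2) \<le> exp (- 2 * (\<Sum>i\<in>I. x i))" unfolding x_def using I_sum[of s] by simp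
        then have "exp (2*\<beta> * s * (real m - 1)) * exp (- 2 * K2) \<le> exp (2*\<beta> * s * (real m - 1)) * exp (- 2 * (\<Sum>i\<in>I. x i))"
          by (intro mult_left_mono) auto
        ultimately show ?thesis by linarith
      qed
      have "cmod (g z) = cmod (h z) * (\<Prod>i\<in>I. cmod (z - \<omega> i))" by (simp add: h(2) norm_mult prod_norm)
      then have "cmod (h z) * (exp (2*\<beta> * s * (real m - 1)) * exp (- 2 * K2)) \<le> cmod (g z)"
        using low by (simp add: mult_left_mono)
      then have "cmod (h z) * (exp (2*\<beta> * s * (real m - 1)) * exp (- 2 * K2)) \<le> exp (\<beta> * s\<^sup>2) * (A * exp (- \<eta> * \<bar>s - \<tau> k\<bar>))"
        using gz by linarith
      from mult_right_mono[OF this, of "exp (- (2*\<beta> * s * (real m - 1))) * exp (2 * K2)"]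
      have "cmod (h z) * ((exp (2*\<beta> * s * (real m - 1)) * exp (- 2 * K2)) * (exp (- (2*\<beta> * s * (real m - 1))) * exp (2 * K2))) \<le> B"
        unfolding B_def by (simp only: mult.assoc) simp
      moreover have "(exp (2*\<beta> * s * (real m - 1)) * exp (- 2 * K2)) * (exp (- (2*\<beta> * s * (real m - 1))) * exp (2 * K2)) = 1"
        unfolding exp_add[symmetric] by simp
      ultimately show ?thesis by (simp only: mult_1_right)
    qed
    have "cmod (h (\<omega> k)) \<le> B"
    proof (rule max_modulus_disc[OF h(1) circ])
      show "cmod (\<omega> k) \<le> R" using ti[OF km] a b2 by (simp add: norm_\<omega> R_def)
    qed (auto simp: R_def)
    moreover have "(\<Prod>i\<in>I. cmod (\<omega> k - \<omega> i)) \<le> exp (2*\<beta> * (\<Sum>i\<in>I. max (\<tau> k) (\<tau> i))) * exp K2"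
      by (rule prod_dist_le[OF I_sum]) (auto simp: norm_\<omega> I)
    moreover have "cmod (g (\<omega> k)) = cmod (h (\<omega> k)) * (\<Prod>i\<in>I. cmod (\<omega> k - \<omega> i))"
      by (simp add: h(2) norm_mult prod_norm)
    moreover have "0 \<le> B" using A by (simp add: B_def)
    ultimately have "exp (\<beta> * (\<tau> k)\<^sup>2) \<le> B * (exp (2*\<beta> * (\<Sum>i\<in>I. max (\<tau> k) (\<tau> i))) * exp K2)"
      unfolding gk[symmetric] by (auto intro!: mult_mono prod_nonneg)
    also have "(\<Sum>i\<in>I. max (\<tau> k) (\<tau> i)) = real k * \<tau> k + (\<Sum>i=Suc k..<m. \<tau> i)"
    proof -
      have "I = {..<k} \<union> {Suc k..<m}" using km by (auto simp: I_def)
      then have "(\<Sum>i\<in>I. max (\<tau> k) (\<tau> i)) = (\<Sum>i<k. max (\<tau> k) (\<tau> i)) + (\<Sum>i=Suc k..<m. max (\<tau> k) (\<tau> i))"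
        by (simp only:) (rule sum.union_disjoint, auto)
      also have "(\<Sum>i<k. max (\<tau> k) (\<tau> i)) = (\<Sum>i<k. \<tau> k)"
        by (intro sum.cong refl) (use mono_\<tau> in \<open>auto simp: max_absorb1\<close>)
      also have "(\<Sum>i=Suc k..<m. max (\<tau> k) (\<tau> i)) = (\<Sum>i=Suc k..<m. \<tau> i)"
        by (intro sum.cong refl) (use mono_\<tau> in \<open>auto simp: max_absorb2\<close>)
      finally show ?thesis by simp
    qed
    also have "B * (exp (2*\<beta> * (real k * \<tau> k + (\<Sum>i=Suc k..<m. \<tau> i))) * exp K2) =
      exp (\<beta> * s\<^sup>2 + ln A - \<eta> * \<bar>s - \<tau> k\<bar> - 2*\<beta> * s * (real m - 1) + 2 * K2 + 2*\<beta> * (real k * \<tau> k + (\<Sum>i=Suc k..<m. \<tau> i)) + K2)"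
    proof -
      have "exp (\<beta> * s\<^sup>2 + ln A - \<eta> * \<bar>s - \<tau> k\<bar> - 2*\<beta> * s * (real m - 1) + 2 * K2 + 2*\<beta> * (real k * \<tau> k + (\<Sum>i=Suc k..<m. \<tau> i)) + K2) =
        exp (\<beta> * s\<^sup>2) * (exp (ln A) * exp (- \<eta> * \<bar>s - \<tau> k\<bar>)) * (exp (- (2*\<beta> * s * (real m - 1))) * exp (2 * K2)) *
        (exp (2*\<beta> * (real k * \<tau> k + (\<Sum>i=Suc k..<m. \<tau> i))) * exp K2)"
        unfolding exp_add[symmetric] by simp
      then show ?thesis unfolding exp_ln[OF A] B_def by simp
    qed
    finally have "\<beta> * (\<tau> k)\<^sup>2 \<le> \<beta> * s\<^sup>2 + L3 - \<eta> * \<bar>s - \<tau> k\<bar> - 2*\<beta> * s * (real m - 1) + \<beta> * (2 * (real k * \<tau> k) + 2 * (\<Sum>i=Suc k..<m. \<tau> i))"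
      by (simp add: L3_def algebra_simps)
    moreover define X where "X = (\<Sum>i=k..<m. \<tau> i - real i)"
    have "2 * X = 2 * (\<Sum>i=k..<m. \<tau> i) - 2 * (\<Sum>i=k..<m. real i)" by (simp add: X_def sum_subtractf)
    then have "2 * (\<Sum>i=Suc k..<m. \<tau> i) = 2 * X - 2 * \<tau> k + (real m * real m - real m - (real k * real k - real k))"
      unfolding sum_real_interval[OF less_imp_le[OF km]] using km by (simp add: sum.atLeast_Suc_lessThan)
    moreover have "\<eta> * (real m - real k) \<le> \<eta> * \<bar>s - \<tau> k\<bar>"
    proof (intro mult_left_mono)
      have "\<tau> k \<le> real k + Kd" using Kd[of k] by (simp add: abs_le_iff)
      then have "real m - real k \<le> s - \<tau> k" unfolding s_def \<kappa>_def using a by simp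
      then show "real m - real k \<le> \<bar>s - \<tau> k\<bar>" by simp
    qed (use C in auto)
    ultimately have "\<beta> * (\<tau> k)\<^sup>2 \<le> \<beta> * s\<^sup>2 + L3 - \<eta> * (real m - real k) - 2*\<beta> * s * (real m - 1) +
       \<beta> * (2 * (real k * \<tau> k) + (2 * X - 2 * \<tau> k + (real m * real m - real m - (real k * real k - real k))))"
      by simp
    \<comment> \<open>Here s^2 - 2s (m - 1) is (\<kappa> + 1)^2 - (m - 1)^2, so the terms quadratic
      in m cancel against those of the sum of the integers.\<close>
    then have "\<beta> * ((\<tau> k - real k)\<^sup>2 + 2 * \<tau> k - 2 * X - real m + 2 * real m - 1 - (\<kappa> + 1)\<^sup>2 - real k) \<le> L3 - \<eta> * (real m - real k) + 2 * \<beta> * (real m - 1)"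
      unfolding s_def by (simp add: power2_eq_square algebra_simps)
    moreover have "\<beta> * (2 * (real k - Kd) - 2 * X - real m + 2 * real m - 1 - (\<kappa> + 1)\<^sup>2 - real k) \<le>
       \<beta> * ((\<tau> k - real k)\<^sup>2 + 2 * \<tau> k - 2 * X - real m + 2 * real m - 1 - (\<kappa> + 1)\<^sup>2 - real k)"
    proof (intro mult_left_mono)
      have "real k - Kd \<le> \<tau> k" using Kd[of k] by (simp add: abs_le_iff)
      moreover have aux: "2 * a \<le> q + 2 * t" if "a \<le> t" "0 \<le> q" for a q t :: real using that by linarith
      ultimately show "2 * (real k - Kd) - 2 * X - real m + 2 * real m - 1 - (\<kappa> + 1)\<^sup>2 - real k \<le>
         (\<tau> k - real k)\<^sup>2 + 2 * \<tau> k - 2 * X - real m + 2 * real m - 1 - (\<kappa> + 1)\<^sup>2 - real k"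
        by (intro diff_right_mono add_right_mono aux) simp_all
    qed (use \<beta>_pos in simp)
    ultimately have "2 * \<beta> * (- X) \<le> \<beta> * (real m - real k) - \<eta> * (real m - real k) + (L3 + \<beta> * (2 * Kd + (\<kappa> + 1)\<^sup>2))"
      using \<beta>_pos by (simp add: algebra_simps)
    then have "- X \<le> (\<beta> * (real m - real k) - \<eta> * (real m - real k) + (L3 + \<beta> * (2 * Kd + (\<kappa> + 1)\<^sup>2))) / (2 * \<beta>)"
      using \<beta>_pos by (simp add: field_simps)
    also have "\<dots> = (1/2 - e) * (real m - real k) + C0"
      using \<beta>_pos by (simp add: e_def C0_def field_simps)
    finally show ?thesis by (simp add: X_def)
  qed
  moreover have "e > 0" using C \<beta>_pos by (simp add: e_def)
  \<comment> \<open>With the absolute value the constant also serves the empty interval k =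
    m.\<close>
  moreover have "- (\<Sum>i=k..<m. \<tau> i - real i) \<le> (1/2 - e) * (real m - real k) + \<bar>C0\<bar>" if "k \<le> m" for k m
    using main[of k m] that by (cases "k = m") auto
  ultimately show ?thesis by blast
qed

end

section \<open>Separated sets and weights\<close>

lemma lp_reindex:
  assumes "bij_betw l UNIV I" "\<And>x. x \<notin> I \<Longrightarrow> c x = 0"
  shows "c \<in> lp_space p I \<longleftrightarrow> (\<lambda>k. c (l k)) \<in> lp_space p UNIV"
    "lp_norm p I c = lp_norm p UNIV (\<lambda>k. c (l k))"
proof -
  have I: "I = range l" using assms(1) by (simp add: bij_betw_def)
  have 1: "(\<lambda>x. cmod (c x)) ` I = range (\<lambda>k. cmod (c (l k)))" unfolding I by auto
  have 2: "((\<lambda>k. cmod (c (l k)) powr P) summable_on UNIV) = ((\<lambda>x. cmod (c x) powr P) summable_on I)" for P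
    using summable_on_reindex_bij_betw[OF assms(1), of "\<lambda>x. cmod (c x) powr P"] by simp
  have 3: "infsum (\<lambda>k. cmod (c (l k)) powr P) UNIV = infsum (\<lambda>x. cmod (c x) powr P) I" for P
    using infsum_reindex_bij_betw[OF assms(1), of "\<lambda>x. cmod (c x) powr P"] by simp
  show "c \<in> lp_space p I \<longleftrightarrow> (\<lambda>k. c (l k)) \<in> lp_space p UNIV"
    using assms(2) by (auto simp: lp_space_def 1 2)
  show "lp_norm p I c = lp_norm p UNIV (\<lambda>k. c (l k))"
    by (simp add: lp_norm_def 1 3)
qed

lemma pairwise_separated_card:
  assumes "0 < d"
  obtains K :: nat where "0 < K" and "\<And>S. \<lbrakk>S \<subseteq> cball (0::complex) 1; \<And>x y. x \<in> S \<Longrightarrow> y \<in> S \<Longrightarrow> x \<noteq> y \<Longrightarrow> d \<le> dist x y\<rbrakk>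
    \<Longrightarrow> finite S \<and> card S \<le> K"
proof -
  obtain A where A: "finite A" "cball (0::complex) 1 \<subseteq> (\<Union>x\<in>A. ball x (d/2))"
    using compact_cball[of "0::complex" 1] half_gt_zero[OF assms] unfolding compact_eq_totally_bounded by blast
  have "finite S \<and> card S \<le> Suc (card A)"
    if S: "S \<subseteq> cball (0::complex) 1" "\<And>x y. x \<in> S \<Longrightarrow> y \<in> S \<Longrightarrow> x \<noteq> y \<Longrightarrow> d \<le> dist x y" for S
  proof -
    have "\<forall>x\<in>S. \<exists>a\<in>A. x \<in> ball a (d/2)" using S(1) A(2) by blast
    then obtain f where f: "\<And>x. x \<in> S \<Longrightarrow> f x \<in> A \<and> x \<in> ball (f x) (d/2)" by metis
    have inj: "inj_on f S"
    proof (rule inj_onI, rule ccontr)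
      fix x y assume xy: "x \<in> S" "y \<in> S" "f x = f y" "x \<noteq> y"
      have "dist x y \<le> dist (f x) x + dist (f x) y" by (metis dist_commute dist_triangle)
      also have "\<dots> < d/2 + d/2" using f[OF xy(1)] f[OF xy(2)] xy(3) by simp
      finally show False using S(2)[OF xy(1,2,4)] by simp
    qed
    have sub: "f ` S \<subseteq> A" using f by auto
    then show ?thesis
      using inj A(1) card_inj_on_le[OF inj sub A(1)] finite_subset[OF sub A(1)] finite_imageD[OF _ inj] by auto
  qed
  then show ?thesis using that[of "Suc (card A)"] by blast
qed

text \<open>Among the points not yet chosen one of least modulus exists because discs contain
  finitely many points; a point never chosen would force all the chosen ones into one disc.\<close>

lemma enumerate_by_modulus:
  assumes "infinite \<Lambda>" "\<And>R. finite (\<Lambda> \<inter> cball (0::complex) R)"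
  obtains l :: "nat \<Rightarrow> complex" where "bij_betw l UNIV \<Lambda>" "\<And>k. cmod (l k) \<le> cmod (l (Suc k))"
proof -
  define nxt where "nxt F = (SOME x. x \<in> \<Lambda> - F \<and> (\<forall>y\<in>\<Lambda>-F. cmod x \<le> cmod y))" for F
  have nxt: "nxt F \<in> \<Lambda> - F \<and> (\<forall>y\<in>\<Lambda>-F. cmod (nxt F) \<le> cmod y)" if F: "finite F" for F
    unfolding nxt_def
  proof (rule someI_ex)
    have "infinite (\<Lambda> - F)" using assms(1) F by simp
    then obtain x0 where x0: "x0 \<in> \<Lambda> - F" by (metis ex_in_conv finite.emptyI)
    define T where "T = (\<Lambda> - F) \<inter> cball 0 (cmod x0)"
    have "finite T" by (rule finite_subset[OF _ assms(2)[of "cmod x0"]]) (auto simp: T_def)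
    moreover have "T \<noteq> {}" using x0 by (auto simp: T_def)
    ultimately obtain x where x: "x \<in> T" "\<And>y. y \<in> T \<Longrightarrow> cmod x \<le> cmod y"
      using arg_min_if_finite[of T cmod] by (metis not_le)
    have "cmod x \<le> cmod y" if "y \<in> \<Lambda> - F" for y
      using x that by (cases "cmod y \<le> cmod x0") (auto simp: T_def)
    then show "\<exists>x. x \<in> \<Lambda> - F \<and> (\<forall>y\<in>\<Lambda>-F. cmod x \<le> cmod y)" using x(1) by (auto simp: T_def)
  qed
  define S where "S = rec_nat {} (\<lambda>n F. insert (nxt F) F)"
  have S: "S 0 = {}" "S (Suc n) = insert (nxt (S n)) (S n)" for n by (simp_all add: S_def)
  define l where "l n = nxt (S n)" for n
  have fS: "finite (S n)" for n by (induction n) (auto simp: S)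
  have l: "l n \<in> \<Lambda>" "l n \<notin> S n" "\<And>y. y \<in> \<Lambda> - S n \<Longrightarrow> cmod (l n) \<le> cmod y" for n
    using nxt[OF fS[of n]] by (auto simp: l_def)
  have lS: "S n = l ` {..<n}" for n
    by (induction n) (auto simp: S l_def lessThan_Suc)
  have neq: "l m \<noteq> l n" if "m < n" for m n using l(2)[of n] that unfolding lS by (metis imageI lessThan_iff)
  have inj: "inj l" by (rule injI) (metis neq linorder_neqE_nat)
  have mono: "cmod (l k) \<le> cmod (l (Suc k))" for k
    by (rule l(3)) (use l(1)[of "Suc k"] l(2)[of "Suc k"] in \<open>auto simp: S\<close>)
  have "\<mu> \<in> range l" if \<mu>: "\<mu> \<in> \<Lambda>" for \<mu>
  proof (rule ccontr)
    assume no: "\<mu> \<notin> range l"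
    have "cmod (l n) \<le> cmod \<mu>" for n
      by (rule l(3)) (use no \<mu> in \<open>auto simp: lS\<close>)
    then have "range l \<subseteq> \<Lambda> \<inter> cball 0 (cmod \<mu>)" using l(1) by auto
    then have "finite (range l)" using assms(2) finite_subset by blast
    then show False using inj by (simp add: finite_image_iff)
  qed
  then have "range l = \<Lambda>" using l(1) by auto
  then show ?thesis using that inj mono by (simp add: bij_betw_def)
qed

text \<open>Together with \<open>d_log_ge\<close> this lets \<open>d_log\<close>-separation be
  replaced by a lower bound for |z - w| / max (|z|, |w|). The difference is split into an angular
  and a radial part, and the radial one is estimated by ln t \<le> t - 1.\<close>

lemma d_log_le:
  assumes "z \<noteq> 0" "w \<noteq> 0"
  shows "cmod (z - w) \<le> max (cmod z) (cmod w) * d_log z w"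
proof -
  have main: "cmod (z - w) \<le> cmod z * d_log z w" if le: "cmod w \<le> cmod z" and nz: "z \<noteq> 0" "w \<noteq> 0" for z w
  proof -
    have "z - w = of_real (cmod z) * (z / of_real (cmod z) - w / of_real (cmod w)) + of_real (cmod z - cmod w) * (w / of_real (cmod w))"
      using nz by (simp add: field_simps)
    then have "cmod (z - w) \<le> cmod (of_real (cmod z) * (z / of_real (cmod z) - w / of_real (cmod w))) +
        cmod (of_real (cmod z - cmod w) * (w / of_real (cmod w)))"
      by (metis norm_triangle_ineq)
    also have "\<dots> = cmod z * cmod (z / of_real (cmod z) - w / of_real (cmod w)) + \<bar>cmod z - cmod w\<bar>"
      unfolding norm_mult norm_of_real using nz by (simp add: norm_divide)
    also have "\<bar>cmod z - cmod w\<bar> \<le> cmod z * \<bar>ln (cmod z) - ln (cmod w)\<bar>"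
    proof -
      have "ln (cmod w / cmod z) \<le> cmod w / cmod z - 1" using nz by (intro ln_le_minus_one) simp
      then have "1 - cmod w / cmod z \<le> ln (cmod z) - ln (cmod w)" using nz by (simp add: ln_div)
      then have "cmod z * (1 - cmod w / cmod z) \<le> cmod z * (ln (cmod z) - ln (cmod w))" by (intro mult_left_mono) auto
      moreover have "cmod z * (1 - cmod w / cmod z) = cmod z - cmod w" using nz by (simp add: field_simps)
      moreover have "cmod z * (ln (cmod z) - ln (cmod w)) \<le> cmod z * \<bar>ln (cmod z) - ln (cmod w)\<bar>"
        by (intro mult_left_mono) auto
      ultimately show ?thesis using le by linarith
    qed
    finally show ?thesis by (simp add: d_log_def algebra_simps)
  qed
  have sym: "d_log z w = d_log w z" by (simp add: d_log_def norm_minus_commute abs_minus_commute)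
  show ?thesis using main[of w z] main[of z w] assms sym by (auto simp: max_def norm_minus_commute)
qed

lemma d_log_ge:
  assumes "z \<noteq> 0" "w \<noteq> 0" "0 < \<epsilon>" "\<epsilon> \<le> d_log z w"
  shows "min (1/2) (\<epsilon>/4) * max (cmod z) (cmod w) \<le> cmod (z - w)"
proof -
  have main: "min (1/2) (\<epsilon>/4) * cmod z \<le> cmod (z - w)"
    if le: "cmod w \<le> cmod z" and nz: "z \<noteq> 0" "w \<noteq> 0" and e: "\<epsilon> \<le> d_log z w" for z w
  \<comment> \<open>If the moduli differ by more than a factor 2, then |z - w| is already at least
    |z|/2, which gives the 1/2. Otherwise the logarithmic and the angular part are each at most 2t,
    which gives \<epsilon>/4.\<close>
  proof (cases "cmod w < cmod z / 2")
    case True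
    have "min (1/2) (\<epsilon>/4) * cmod z \<le> 1/2 * cmod z" by (intro mult_right_mono) auto
    also have "\<dots> \<le> cmod (z - w)" using True norm_triangle_ineq2[of z w] by linarith
    finally show ?thesis .
  next
    case False
    define t where "t = cmod (z - w) / cmod z"
    have zp: "cmod z > 0" "cmod w > 0" using nz by auto
    have diff: "cmod z - cmod w \<le> cmod (z - w)" by (rule norm_triangle_ineq2)
    have "ln (cmod z / cmod w) \<le> cmod z / cmod w - 1" using nz by (intro ln_le_minus_one) simp
    also have "\<dots> = (cmod z - cmod w) / cmod w" using zp by (simp add: field_simps)
    also have "\<dots> \<le> cmod (z - w) / (cmod z / 2)" using False diff zp le by (intro frac_le) auto
    also have "\<dots> = 2 * t" by (simp add: t_def)
    finally have 1: "\<bar>ln (cmod z) - ln (cmod w)\<bar> \<le> 2 * t" using le zp by (simp add: ln_div)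
    have "z / of_real (cmod z) - w / of_real (cmod w) = (z - w) / of_real (cmod z) + (w / of_real (cmod w)) * of_real ((cmod w - cmod z) / cmod z)"
      using nz by (simp add: field_simps)
    then have "cmod (z / of_real (cmod z) - w / of_real (cmod w)) \<le> cmod ((z - w) / of_real (cmod z)) + cmod ((w / of_real (cmod w)) * of_real ((cmod w - cmod z) / cmod z))"
      by (metis norm_triangle_ineq)
    also have "\<dots> = t + (cmod z - cmod w) / cmod z"
      unfolding norm_mult norm_of_real using nz le by (simp add: norm_divide t_def)
    also have "(cmod z - cmod w) / cmod z \<le> t" unfolding t_def using diff zp by (intro divide_right_mono) auto
    finally have "d_log z w \<le> 4 * t" using 1 by (simp add: d_log_def)
    then have "\<epsilon>/4 \<le> t" using e by simp
    then have "min (1/2) (\<epsilon>/4) \<le> t" by linarith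
    then show ?thesis using zp by (simp add: t_def pos_le_divide_eq)
  qed
  have sym: "d_log z w = d_log w z" by (simp add: d_log_def norm_minus_commute abs_minus_commute)
  show ?thesis using main[of w z] main[of z w] assms sym by (auto simp: max_def norm_minus_commute)
qed

section \<open>Weights of the restriction operator\<close>

definition fock_weight :: "ennreal \<Rightarrow> real \<Rightarrow> complex \<Rightarrow> real" where
  "fock_weight p \<alpha> z = (1 + cmod z) powr enn2real (2 / p) * exp (- \<alpha> * (log_plus (cmod z))\<^sup>2)"

text \<open>
  Ratio of the weight in the restriction operator to the homogeneous weight
  $|z|^{2/p} e^{-\alpha \log^2 |z|}$, for which the monomials become exact translated Gaussians.
\<close>

definition weight_ratio :: "ennreal \<Rightarrow> real \<Rightarrow> complex \<Rightarrow> real" where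
  "weight_ratio p \<alpha> z = fock_weight p \<alpha> z / (cmod z powr enn2real (2 / p) * exp (- \<alpha> * (ln (cmod z))\<^sup>2))"

lemma weight_ratio_ge_1:
  assumes "0 < \<alpha>" "z \<noteq> 0"
  shows "1 \<le> weight_ratio p \<alpha> z"
proof -
  have "cmod z powr enn2real (2 / p) * exp (- \<alpha> * (ln (cmod z))\<^sup>2) \<le> fock_weight p \<alpha> z"
    unfolding fock_weight_def
  proof (intro mult_mono powr_mono2)
    show "exp (- \<alpha> * (ln (cmod z))\<^sup>2) \<le> exp (- \<alpha> * (log_plus (cmod z))\<^sup>2)"
      using log_plus_sq_le[of "cmod z"] assms by simp
  qed auto
  moreover have "cmod z powr enn2real (2 / p) * exp (- \<alpha> * (ln (cmod z))\<^sup>2) > 0" using assms by simp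
  ultimately show ?thesis unfolding weight_ratio_def by (simp add: pos_le_divide_eq)
qed

text \<open>The ratio can blow up only near the origin, and nodes enumerated by modulus stay outside
  the open disc whose radius is the first modulus. With \<open>weight_ratio_ge_1\<close> this makes
  the passage between the operator and \<open>val\<close> harmless in every l^p.\<close>

lemma weight_ratio_le:
  assumes "0 < \<alpha>" "0 < \<rho>" "\<rho> \<le> cmod z"
  shows "weight_ratio p \<alpha> z \<le> (1 + 1/\<rho>) powr enn2real (2 / p) * exp (\<alpha> * (ln \<rho>)\<^sup>2)"
proof -
  have z: "cmod z > 0" using assms by linarith
  have "weight_ratio p \<alpha> z = ((1 + cmod z) / cmod z) powr enn2real (2 / p) *
      exp (\<alpha> * ((ln (cmod z))\<^sup>2 - (log_plus (cmod z))\<^sup>2))"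
    unfolding weight_ratio_def fock_weight_def using z
    by (simp add: powr_divide exp_diff exp_minus right_diff_distrib field_simps)
  also have "\<dots> \<le> (1 + 1/\<rho>) powr enn2real (2 / p) * exp (\<alpha> * (ln \<rho>)\<^sup>2)"
  proof (intro mult_mono powr_mono2)
    show "(1 + cmod z) / cmod z \<le> 1 + 1/\<rho>" using assms z by (simp add: field_simps)
    have "(ln (cmod z))\<^sup>2 - (log_plus (cmod z))\<^sup>2 \<le> (ln \<rho>)\<^sup>2"
    proof (cases "cmod z \<ge> 1")
      case True
      then show ?thesis by (simp add: log_plus_def)
    next
      case False
      have "ln \<rho> \<le> ln (cmod z)" "ln (cmod z) \<le> 0" using assms z False by auto
      then have "(ln (cmod z))\<^sup>2 \<le> (ln \<rho>)\<^sup>2" by (simp add: abs_le_square_iff[symmetric])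
      then show ?thesis by (smt (verit) zero_le_power2)
    qed
    then show "exp (\<alpha> * ((ln (cmod z))\<^sup>2 - (log_plus (cmod z))\<^sup>2)) \<le> exp (\<alpha> * (ln \<rho>)\<^sup>2)"
      using assms by simp
  qed (use z in auto)
  finally show ?thesis .
qed

text \<open>When (l + q)^2 is expanded, the mixed term 2 l q is a dilation of the variable and q^2 a
  constant; so the shift 2/p disappears from the matrix.\<close>

lemma gauss_series_rescale:
  assumes "0 < \<beta>" "\<And>l. cmod (b l) \<le> M"
  shows "gauss_series \<beta> q b z = of_real (exp (- \<beta> * q\<^sup>2)) * gauss_series \<beta> 0 b (z * of_real (exp (- 2 * \<beta> * q)))"
proof -
  have eq: "b l * exp (- \<beta> * (real l + q)\<^sup>2) * z ^ l =
     of_real (exp (- \<beta> * q\<^sup>2)) * (b l * exp (- \<beta> * (real l + 0)\<^sup>2) * (z * of_real (exp (- 2 * \<beta> * q))) ^ l)" for l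
  proof -
    have "exp (- \<beta> * (real l + q)\<^sup>2) = exp (- \<beta> * q\<^sup>2) * exp (- \<beta> * (real l + 0)\<^sup>2) * exp (- 2 * \<beta> * q) ^ l"
      unfolding exp_of_nat_mult[symmetric] exp_add[symmetric] by (simp add: power2_eq_square algebra_simps)
    then show ?thesis by (simp add: power_mult_distrib mult_ac)
  qed
  show ?thesis
    using gauss_series_sums(1)[of \<beta> b M 0 "z * of_real (exp (- 2 * \<beta> * q))", OF assms]
    unfolding gauss_series_def[of \<beta> q] eq by (simp add: sums_iff suminf_mult)
qed

lemma gauss_series_weight:
  assumes "0 < \<alpha>" "\<beta> = 1 / (4 * \<alpha>)" "q = enn2real (2 / p)" "z \<noteq> 0" "\<And>l. cmod (b l) \<le> M"
    and "t = 2 * \<alpha> * ln (cmod z) - q"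
  shows "gauss_series \<beta> q b z * fock_weight p \<alpha> z =
     weight_ratio p \<alpha> z * (gauss_series \<beta> 0 b (z * of_real (exp (- 2 * \<beta> * q))) * of_real (exp (- \<beta> * t\<^sup>2)))"
    "cmod (z * of_real (exp (- 2 * \<beta> * q))) = exp (2 * \<beta> * t)"
proof -
  have \<beta>: "\<beta> > 0" "4 * \<alpha> * \<beta> = 1" using assms by auto
  have "2 * \<beta> * (t + q) = (4 * \<alpha> * \<beta>) * ln (cmod z)" using assms(6) by simp
  then have ln: "ln (cmod z) = 2 * \<beta> * (t + q)" using \<beta> by simp
  have z: "cmod z = exp (2 * \<beta> * (t + q))" using assms(4) unfolding ln[symmetric] by simp
  have "\<alpha> * (ln (cmod z))\<^sup>2 = (4 * \<alpha> * \<beta>) * (\<beta> * (t + q)\<^sup>2)" unfolding ln by (simp add: power2_eq_square)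
  then have al: "\<alpha> * (ln (cmod z))\<^sup>2 = \<beta> * (t + q)\<^sup>2" using \<beta> by simp
  have "cmod z powr q * exp (- \<alpha> * (ln (cmod z))\<^sup>2) = exp (q * ln (cmod z)) * exp (- \<alpha> * (ln (cmod z))\<^sup>2)"
    using assms(4) by (simp add: powr_def)
  also have "\<dots> = exp (q * ln (cmod z) - \<alpha> * (ln (cmod z))\<^sup>2)" by (simp add: exp_add[symmetric])
  also have "q * ln (cmod z) - \<alpha> * (ln (cmod z))\<^sup>2 = \<beta> * q\<^sup>2 + - \<beta> * t\<^sup>2"
    unfolding al unfolding ln by (simp add: power2_eq_square algebra_simps)
  finally have hw: "cmod z powr q * exp (- \<alpha> * (ln (cmod z))\<^sup>2) = exp (\<beta> * q\<^sup>2) * exp (- \<beta> * t\<^sup>2)"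
    by (simp only: exp_add)
  have "fock_weight p \<alpha> z = weight_ratio p \<alpha> z * (exp (\<beta> * q\<^sup>2) * exp (- \<beta> * t\<^sup>2))"
    unfolding weight_ratio_def assms(3)[symmetric] hw by simp
  moreover have "complex_of_real (exp (- \<beta> * q\<^sup>2)) * complex_of_real (exp (\<beta> * q\<^sup>2)) = 1"
    by (simp flip: of_real_mult exp_add)
  ultimately show "gauss_series \<beta> q b z * fock_weight p \<alpha> z =
     weight_ratio p \<alpha> z * (gauss_series \<beta> 0 b (z * of_real (exp (- 2 * \<beta> * q))) * of_real (exp (- \<beta> * t\<^sup>2)))"
    using gauss_series_rescale[of \<beta> b M q z, OF \<beta>(1) assms(5)] by (simp add: mult_ac)
  show "cmod (z * of_real (exp (- 2 * \<beta> * q))) = exp (2 * \<beta> * t)"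
    unfolding norm_mult z by (simp add: exp_add[symmetric] algebra_simps)
qed

section \<open>Distance from a point to the zeros of a function\<close>

lemma norm_power_diff_le:
  fixes x y :: complex
  assumes "cmod x \<le> M" "cmod y \<le> M" "1 \<le> M"
  shows "cmod (x ^ n - y ^ n) \<le> real n * M ^ n * cmod (x - y)"
proof (induction n)
  case (Suc n)
  have "x ^ Suc n - y ^ Suc n = x * (x ^ n - y ^ n) + (x - y) * y ^ n" by (simp add: algebra_simps)
  then have "cmod (x ^ Suc n - y ^ Suc n) \<le> cmod x * cmod (x ^ n - y ^ n) + cmod (x - y) * cmod y ^ n"
    by (metis norm_mult norm_power norm_triangle_ineq)
  also have "\<dots> \<le> M * (real n * M ^ n * cmod (x - y)) + cmod (x - y) * M ^ n"
    using assms Suc by (intro add_mono mult_mono power_mono) auto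
  also have "\<dots> \<le> M * (real n * M ^ n * cmod (x - y)) + cmod (x - y) * M ^ Suc n"
    using assms by (intro add_left_mono mult_left_mono power_increasing) auto
  finally show ?case by (simp add: algebra_simps)
qed simp

text \<open>The quotient is u^(l - m), which moves away from 1 at most exponentially in |l - m|; the
  rate 2 comes from n 2^n \<le> 4^n \<le> e^(2n). For l < m the base is 1/u, and |u| \<ge> 1/2 costs
  the factor 2.\<close>

lemma norm_power_quotient_diff_le:
  fixes u :: complex
  assumes "cmod (u - 1) \<le> 1/2"
  shows "cmod (1 - u ^ l / u ^ m) \<le> 2 * exp (2 * \<bar>real l - real m\<bar>) * cmod (u - 1)"
proof -
  have u1: "cmod u \<le> 2" "1/2 \<le> cmod u"
    using norm_triangle_ineq2[of u 1] norm_triangle_ineq2[of 1 u] assms by (auto simp: norm_minus_commute)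
  then have u0: "u \<noteq> 0" by auto
  have pw: "real n * 2 ^ n \<le> exp (2 * real n)" for n
  proof -
    have "real n \<le> 2 ^ n" by (metis less_imp_le of_nat_less_two_power)
    then have "real n * 2 ^ n \<le> 2 ^ n * 2 ^ n" by (intro mult_right_mono) auto
    also have "\<dots> = (2::real) ^ (2 * n)" by (simp add: mult_2 power_add)
    also have "\<dots> \<le> exp 1 ^ (2 * n)" using exp_ge_add_one_self[of 1] by (intro power_mono) auto
    also have "\<dots> = exp (2 * real n)" unfolding exp_of_nat_mult[symmetric] by simp
    finally show ?thesis .
  qed
  show ?thesis
  proof (cases "m \<le> l")
    case True
    then have "u ^ l / u ^ m = u ^ (l - m)" using u0 by (simp add: power_diff)
    then have "cmod (1 - u ^ l / u ^ m) \<le> real (l - m) * 2 ^ (l - m) * cmod (1 - u)"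
      using norm_power_diff_le[of 1 2 u "l - m"] u1 by simp
    also have "\<dots> \<le> exp (2 * real (l - m)) * cmod (1 - u)" by (intro mult_right_mono pw) auto
    also have "\<dots> \<le> 2 * exp (2 * real (l - m)) * cmod (1 - u)" by (intro mult_right_mono) auto
    finally show ?thesis using True by (simp add: norm_minus_commute)
  next
    case False
    have "u ^ l / u ^ m = (1/u) ^ (m - l)" using u0 False by (simp add: power_diff power_one_over divide_simps)
    moreover have "cmod (1/u) \<le> 2" using u1 u0 by (simp add: norm_divide divide_simps)
    then have "cmod (1 ^ (m - l) - (1/u) ^ (m - l)) \<le> real (m - l) * 2 ^ (m - l) * cmod (1 - 1/u)"
      by (intro norm_power_diff_le) auto
    ultimately have "cmod (1 - u ^ l / u ^ m) \<le> real (m - l) * 2 ^ (m - l) * cmod (1 - 1/u)"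
      by (simp only: power_one)
    also have "cmod (1 - 1/u) = cmod (u - 1) / cmod u" using u0 by (simp add: norm_divide[symmetric] diff_divide_distrib)
    also have "\<dots> \<le> cmod (u - 1) / (1/2)" using u1 by (intro divide_left_mono) auto
    then have "real (m - l) * 2 ^ (m - l) * (cmod (u - 1) / cmod u) \<le> exp (2 * real (m - l)) * (2 * cmod (u - 1))"
      using pw[of "m - l"] by (intro mult_mono) auto
    finally show ?thesis using False by simp
  qed
qed

text \<open>
  In the first case the equation at $z'$ is divided by $(z'/z)^m$, where the Gaussian weights of
  the coefficients at $z$ are concentrated near $m$.
\<close>

lemma zero_separation:
  assumes "0 < \<alpha>" "\<beta> = 1 / (4 * \<alpha>)" "q = enn2real (2 / p)"
  obtains s where "0 < s" "\<And>b z z'. \<lbrakk>\<And>l. cmod (b l) \<le> M; z \<noteq> 0; gauss_series \<beta> q b z * fock_weight p \<alpha> z = 1;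
     gauss_series \<beta> q b z' = 0\<rbrakk> \<Longrightarrow> s * max 1 (cmod z) \<le> cmod (z - z')"
proof -
  have \<beta>: "\<beta> > 0" "4 * \<alpha> * \<beta> = 1" using assms by auto
  have q0: "q \<ge> 0" by (simp add: assms)
  define M' where "M' = max M 1"
  obtain K1 where K1: "0 < K1" "\<And>t. (\<Sum>l. exp (- 1 * \<bar>real l - t\<bar>)) \<le> K1"
    using spread_exp_sum[OF spread_real zero_less_one] by blast
  \<comment> \<open>Of the rate 3, the powers of z'/z consume 2, and 1 is left for
    summation.\<close>
  define G where "G = exp (3\<^sup>2 / (4*\<beta>))"
  define A where "A = 2 powr q * (2 * exp (2 * (q + 1)) * G * M' * K1)"
  have A0: "A > 0" using K1 by (simp add: A_def G_def M'_def)
  define S where "S = (\<Sum>l. exp (- \<beta> * (real l + q)\<^sup>2) * 4 ^ l)"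
  have Ss: "summable (\<lambda>l. exp (- \<beta> * (real l + q)\<^sup>2) * 4 ^ l)" by (rule gauss_weight_summable) (use \<beta> in auto)
  have S0: "S \<ge> 0" unfolding S_def by (intro suminf_nonneg Ss) auto
  define A2 where "A2 = 2 powr q * (M' * S) + 1"
  have A20: "A2 > 0" using S0 by (simp add: A2_def M'_def add_nonneg_pos)
  \<comment> \<open>1/2 covers points z' far from z, 1/A the case |z| \<ge> 1, and 1/A2 the unit
    disc, where z and z' both have modulus at most 2.\<close>
  define s where "s = min (1/2) (min (1 / A) (1 / A2))"
  have s0: "s > 0" using A0 A20 by (simp add: s_def)
  have main: "s * max 1 (cmod z) \<le> cmod (z - z')"
    if b: "\<And>l. cmod (b l) \<le> M" and z0: "z \<noteq> 0" and z1: "gauss_series \<beta> q b z * fock_weight p \<alpha> z = 1"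
      and z': "gauss_series \<beta> q b z' = 0" for b z z'
  proof (cases "1/2 * max 1 (cmod z) \<le> cmod (z - z')")
    case True
    have "s * max 1 (cmod z) \<le> 1/2 * max 1 (cmod z)" unfolding s_def by (intro mult_right_mono) auto
    then show ?thesis using True by linarith
  next
    case False
    have bM: "cmod (b l) \<le> M'" for l using b[of l] by (simp add: M'_def)
    show ?thesis
    proof (cases "1 \<le> cmod z")
      case True
      define u where "u = z' / z"
      have z'u: "z' = z * u" using z0 by (simp add: u_def)
      have "u - 1 = (z' - z) / z" using z0 by (simp add: u_def diff_divide_distrib)
      then have um: "cmod (u - 1) = cmod (z - z') / cmod z" by (simp add: norm_divide norm_minus_commute)
      have uh: "cmod (u - 1) \<le> 1/2" unfolding um using False True z0 by (subst pos_divide_le_eq) auto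
      have u0: "u \<noteq> 0" using uh by auto
      define t where "t = 2 * \<alpha> * ln (cmod z) - q"
      have tq: "t \<ge> - q" using True assms(1) by (simp add: t_def)
      \<comment> \<open>\<open>t\<close> may be negative, down to - q, and the truncated floor is
        then 0; the error stays below q + 1 in that case too.\<close>
      define m where "m = nat \<lfloor>t\<rfloor>"
      have mt: "\<bar>real m - t\<bar> \<le> q + 1" unfolding m_def using tq q0 by linarith
      define w where "w = z * of_real (exp (- 2 * \<beta> * q))"
      have nw: "cmod w = exp (2 * \<beta> * t)"
        unfolding w_def by (rule gauss_series_weight(2)[OF assms z0 b t_def])
      have e1: "gauss_series \<beta> q b z * fock_weight p \<alpha> z = weight_ratio p \<alpha> z * (gauss_series \<beta> 0 b w * of_real (exp (- \<beta> * t\<^sup>2)))"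
        unfolding w_def by (rule gauss_series_weight(1)[OF assms z0 b t_def])
      have wu: "z' * of_real (exp (- 2 * \<beta> * q)) = w * u" by (simp add: w_def z'u mult_ac)
      have "gauss_series \<beta> q b z' = of_real (exp (- \<beta> * q\<^sup>2)) * gauss_series \<beta> 0 b (z' * of_real (exp (- 2 * \<beta> * q)))"
        by (rule gauss_series_rescale[OF \<beta>(1) b])
      then have e2: "gauss_series \<beta> 0 b (w * u) = 0" using z' unfolding wu by simp
      have s1: "(\<lambda>l. b l * exp (- \<beta> * (real l + 0)\<^sup>2) * w ^ l) sums gauss_series \<beta> 0 b w"
        by (rule gauss_series_sums(1)[OF \<beta>(1) b])
      have s2: "(\<lambda>l. b l * exp (- \<beta> * (real l + 0)\<^sup>2) * (w * u) ^ l) sums 0"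
        using gauss_series_sums(1)[of \<beta> b M 0 "w * u", OF \<beta>(1) b] e2 by simp
      have "(\<lambda>l. b l * exp (- \<beta> * (real l + 0)\<^sup>2) * w ^ l - b l * exp (- \<beta> * (real l + 0)\<^sup>2) * (w * u) ^ l / u ^ m)
         sums (gauss_series \<beta> 0 b w - 0 / u ^ m)"
        by (intro sums_diff s1 sums_divide s2)
      then have s3: "(\<lambda>l. b l * exp (- \<beta> * (real l + 0)\<^sup>2) * w ^ l * (1 - u ^ l / u ^ m)) sums gauss_series \<beta> 0 b w"
        by (simp add: power_mult_distrib algebra_simps)
      have term_le: "norm (b l * exp (- \<beta> * (real l + 0)\<^sup>2) * w ^ l * (1 - u ^ l / u ^ m)) \<le>
         (exp (\<beta> * t\<^sup>2) * (2 * exp (2 * (q + 1)) * G * M' * cmod (u - 1))) * exp (- 1 * \<bar>real l - t\<bar>)" for l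
      proof -
        have lm: "exp (2 * \<bar>real l - real m\<bar>) \<le> exp (2 * (q + 1)) * exp (2 * \<bar>real l - t\<bar>)"
        proof -
          have "\<bar>real l - real m\<bar> \<le> \<bar>real l - t\<bar> + \<bar>real m - t\<bar>"
            using abs_triangle_ineq4[of "real l - t" "real m - t"] by simp
          then have "2 * \<bar>real l - real m\<bar> \<le> 2 * (\<bar>real l - t\<bar> + (q + 1))"
            by (intro mult_left_mono order_trans[OF _ add_left_mono[OF mt]]) auto
          then show ?thesis unfolding exp_add[symmetric] exp_le_cancel_iff by (simp add: algebra_simps)
        qed
        have g: "exp (- \<beta> * (real l - t)\<^sup>2) \<le> G * exp (- 3 * \<bar>real l - t\<bar>)"
          unfolding G_def by (rule gauss_le[OF \<beta>(1)])
        have "norm (b l * exp (- \<beta> * (real l + 0)\<^sup>2) * w ^ l * (1 - u ^ l / u ^ m)) =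
          cmod (b l) * (exp (- \<beta> * (real l + 0)\<^sup>2) * exp (2 * \<beta> * (t + 0)) ^ l) * cmod (1 - u ^ l / u ^ m)"
          by (simp add: norm_mult norm_power nw)
        also have "\<dots> = cmod (b l) * (exp (\<beta> * (t\<^sup>2 - 0\<^sup>2)) * exp (- \<beta> * (real l - t)\<^sup>2)) * cmod (1 - u ^ l / u ^ m)"
          unfolding gauss_monomial ..
        also have "\<dots> \<le> M' * (exp (\<beta> * (t\<^sup>2 - 0\<^sup>2)) * (G * exp (- 3 * \<bar>real l - t\<bar>))) *
           (2 * (exp (2 * (q + 1)) * exp (2 * \<bar>real l - t\<bar>)) * cmod (u - 1))"
          using norm_power_quotient_diff_le[OF uh, of l m] lm
          by (intro mult_mono bM g order_trans[OF norm_power_quotient_diff_le[OF uh]] mult_right_mono mult_left_mono)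
             (auto simp: M'_def G_def)
        also have "\<dots> = (exp (\<beta> * t\<^sup>2) * (2 * exp (2 * (q + 1)) * G * M' * cmod (u - 1))) * (exp (- 3 * \<bar>real l - t\<bar>) * exp (2 * \<bar>real l - t\<bar>))"
          by simp
        also have "exp (- 3 * \<bar>real l - t\<bar>) * exp (2 * \<bar>real l - t\<bar>) = exp (- 1 * \<bar>real l - t\<bar>)"
          unfolding exp_add[symmetric] by simp
        finally show ?thesis .
      qed
      have ks: "summable (\<lambda>l. exp (- 1 * \<bar>real l - t\<bar>))" by (intro spread_exp_summable spread_real) simp
      have "cmod (gauss_series \<beta> 0 b w) \<le> (\<Sum>l. (exp (\<beta> * t\<^sup>2) * (2 * exp (2 * (q + 1)) * G * M' * cmod (u - 1))) * exp (- 1 * \<bar>real l - t\<bar>))"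
        using norm_suminf_le[OF term_le summable_mult[OF ks]] s3 by (simp add: sums_iff)
      also have "\<dots> = (exp (\<beta> * t\<^sup>2) * (2 * exp (2 * (q + 1)) * G * M' * cmod (u - 1))) * (\<Sum>l. exp (- 1 * \<bar>real l - t\<bar>))"
        by (rule suminf_mult[OF ks])
      also have "\<dots> \<le> (exp (\<beta> * t\<^sup>2) * (2 * exp (2 * (q + 1)) * G * M' * cmod (u - 1))) * K1"
        by (intro mult_left_mono K1) (auto simp: G_def M'_def)
      finally have gb: "cmod (gauss_series \<beta> 0 b w) \<le> exp (\<beta> * t\<^sup>2) * ((2 * exp (2 * (q + 1)) * G * M' * K1) * cmod (u - 1))"
        by (simp only: mult_ac)
      have wr: "weight_ratio p \<alpha> z \<le> 2 powr q" using weight_ratio_le[OF assms(1), of 1 z p] True assms(3) by simp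
      have wr0: "weight_ratio p \<alpha> z \<ge> 1" by (rule weight_ratio_ge_1[OF assms(1) z0])
      have "1 = cmod (weight_ratio p \<alpha> z * (gauss_series \<beta> 0 b w * of_real (exp (- \<beta> * t\<^sup>2))))"
        using z1 unfolding e1 by simp
      also have "\<dots> = weight_ratio p \<alpha> z * (cmod (gauss_series \<beta> 0 b w) * exp (- \<beta> * t\<^sup>2))"
        using wr0 by (simp add: norm_mult)
      also have "\<dots> \<le> 2 powr q * ((exp (\<beta> * t\<^sup>2) * ((2 * exp (2 * (q + 1)) * G * M' * K1) * cmod (u - 1))) * exp (- \<beta> * t\<^sup>2))"
        using wr wr0 gb K1 by (intro mult_mono) (auto simp: G_def M'_def)
      also have "\<dots> = A * cmod (u - 1) * (exp (\<beta> * t\<^sup>2) * exp (- \<beta> * t\<^sup>2))" unfolding A_def by (simp only: mult_ac)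
      also have "exp (\<beta> * t\<^sup>2) * exp (- \<beta> * t\<^sup>2) = 1" by (simp add: exp_add[symmetric])
      finally have "1 \<le> A * cmod (u - 1)" by simp
      then have "1 / A \<le> cmod (u - 1)" using A0 by (simp add: pos_divide_le_eq mult.commute)
      moreover have "s \<le> 1 / A" by (simp add: s_def)
      ultimately have "s \<le> cmod (z - z') / cmod z" unfolding um by linarith
      then have "s * cmod z \<le> cmod (z - z')" using z0 by (simp add: pos_le_divide_eq)
      then show ?thesis using True by (simp add: max_def)
    next
      case small: False
      have zz: "cmod z \<le> 2" "cmod z' \<le> 2"
        using small False norm_triangle_ineq2[of z' z] by (auto simp: norm_minus_commute)
      have s1: "(\<lambda>l. b l * exp (- \<beta> * (real l + q)\<^sup>2) * z ^ l) sums gauss_series \<beta> q b z"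
        by (rule gauss_series_sums(1)[OF \<beta>(1) b])
      have s2: "(\<lambda>l. b l * exp (- \<beta> * (real l + q)\<^sup>2) * z' ^ l) sums 0"
        using gauss_series_sums(1)[of \<beta> b M q z', OF \<beta>(1) b] z' by simp
      have s3: "(\<lambda>l. b l * exp (- \<beta> * (real l + q)\<^sup>2) * (z ^ l - z' ^ l)) sums gauss_series \<beta> q b z"
        using sums_diff[OF s1 s2] by (simp add: algebra_simps)
      have term_le: "norm (b l * exp (- \<beta> * (real l + q)\<^sup>2) * (z ^ l - z' ^ l)) \<le> (M' * cmod (z - z')) * (exp (- \<beta> * (real l + q)\<^sup>2) * 4 ^ l)" for l
      proof -
        have "real l \<le> 2 ^ l" by (metis less_imp_le of_nat_less_two_power)
        then have "real l * 2 ^ l \<le> 2 ^ l * 2 ^ l" by (intro mult_right_mono) auto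
        then have "real l * 2 ^ l \<le> 4 ^ l" by (simp flip: power_mult_distrib)
        then have "real l * 2 ^ l * cmod (z - z') \<le> 4 ^ l * cmod (z - z')" by (intro mult_right_mono) auto
        then have pd: "cmod (z ^ l - z' ^ l) \<le> 4 ^ l * cmod (z - z')"
          using norm_power_diff_le[OF zz, of l] by linarith
        have "norm (b l * exp (- \<beta> * (real l + q)\<^sup>2) * (z ^ l - z' ^ l)) = cmod (b l) * exp (- \<beta> * (real l + q)\<^sup>2) * cmod (z ^ l - z' ^ l)"
          by (simp add: norm_mult)
        also have "\<dots> \<le> M' * exp (- \<beta> * (real l + q)\<^sup>2) * (4 ^ l * cmod (z - z'))"
          by (intro mult_mono bM pd) (auto simp: M'_def)
        finally show ?thesis by (simp only: mult_ac)
      qed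
      have "cmod (gauss_series \<beta> q b z) \<le> (\<Sum>l. (M' * cmod (z - z')) * (exp (- \<beta> * (real l + q)\<^sup>2) * 4 ^ l))"
        using norm_suminf_le[OF term_le summable_mult[OF Ss]] s3 by (simp add: sums_iff)
      also have "\<dots> = (M' * cmod (z - z')) * S" unfolding S_def by (rule suminf_mult[OF Ss])
      finally have gz: "cmod (gauss_series \<beta> q b z) \<le> (M' * cmod (z - z')) * S" .
      have "fock_weight p \<alpha> z \<le> 2 powr q * 1" unfolding fock_weight_def assms(3)[symmetric]
        using small assms(1) q0 by (intro mult_mono powr_mono2) auto
      moreover have fw0: "fock_weight p \<alpha> z \<ge> 0" by (simp add: fock_weight_def)
      ultimately have "1 \<le> ((M' * cmod (z - z')) * S) * 2 powr q"
        using gz arg_cong[OF z1, of cmod] mult_mono[OF gz, of "fock_weight p \<alpha> z" "2 powr q"] S0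
        by (simp add: norm_mult M'_def)
      also have "\<dots> \<le> A2 * cmod (z - z')" by (simp add: A2_def algebra_simps)
      finally have "1 / A2 \<le> cmod (z - z')" using A20 by (simp add: pos_divide_le_eq mult.commute)
      then show ?thesis using small by (simp add: s_def max_def)
    qed
  qed
  show ?thesis by (rule that[OF s0]) (rule main)
qed

section \<open>Complete interpolating sets\<close>

lemma restriction_op_eq:
  "restriction_op p \<alpha> \<Lambda> f z = (if z \<in> \<Lambda> then f z * of_real (fock_weight p \<alpha> z) else 0)"
  by (simp add: restriction_op_def fock_weight_def)

lemma gauss_nodes_enumeration:
  fixes l :: "nat \<Rightarrow> complex"
  assumes "0 < \<alpha>" "\<beta> = 1 / (4 * \<alpha>)" "inj l" "\<And>k. l k \<noteq> 0" "\<And>k. cmod (l k) \<le> cmod (l (Suc k))"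
    and "\<omega> = (\<lambda>k. l k * of_real (exp (- 2 * \<beta> * q)))" "\<tau> = (\<lambda>k. 2 * \<alpha> * ln (cmod (l k)) - q)"
  shows "gauss_nodes \<beta> \<omega> \<tau>"
proof
  show "\<beta> > 0" using assms by simp
  have ab: "4 * \<alpha> * \<beta> = 1" using assms by simp
  show "cmod (\<omega> k) = exp (2 * \<beta> * \<tau> k)" for k
  proof -
    have "2 * \<beta> * \<tau> k = (4 * \<alpha> * \<beta>) * ln (cmod (l k)) + - 2 * \<beta> * q"
      unfolding assms(7) by (simp add: algebra_simps)
    then have "exp (2 * \<beta> * \<tau> k) = exp (ln (cmod (l k))) * exp (- 2 * \<beta> * q)"
      unfolding ab by (simp only: exp_add mult_1)
    then show ?thesis unfolding assms(6) using assms(4)[of k] by (simp add: norm_mult)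
  qed
  show "inj \<omega>" unfolding assms(6) using assms(3) by (auto simp: inj_def)
  show "\<tau> i \<le> \<tau> j" if "i \<le> j" for i j
  proof -
    have "cmod (l i) \<le> cmod (l j)" using that assms(5) by (rule lift_Suc_mono_le[rotated])
    then have "ln (cmod (l i)) \<le> ln (cmod (l j))" using assms(4) by simp
    then show ?thesis unfolding assms(7) using assms(1) by simp
  qed
qed

lemma restriction_op_gauss_series:
  assumes "0 < \<alpha>" "\<beta> = 1 / (4 * \<alpha>)" "q = enn2real (2 / p)" "l k \<in> \<Lambda>" "l k \<noteq> 0" "\<And>j. cmod (b j) \<le> M"
    and "gauss_nodes \<beta> \<omega> \<tau>"
    and "\<omega> = (\<lambda>k. l k * of_real (exp (- 2 * \<beta> * q)))" "\<tau> = (\<lambda>k. 2 * \<alpha> * ln (cmod (l k)) - q)"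
  shows "restriction_op p \<alpha> \<Lambda> (gauss_series \<beta> q b) (l k) = of_real (weight_ratio p \<alpha> (l k)) * gauss_nodes.val \<beta> \<omega> \<tau> b k"
  unfolding restriction_op_eq gauss_nodes.val_def[OF assms(7)]
  using assms(4) gauss_series_weight(1)[OF assms(1,2,3,5,6) refl] by (simp add: assms(8,9) exp_of_real[symmetric])

lemma (in gauss_nodes) val_lp_bound:
  assumes "0 < p" "spread \<tau>"
  obtains C where "0 < C" "\<And>b M. \<lbrakk>lp_bound p M (\<lambda>l. cmod (b l)); 0 \<le> M\<rbrakk> \<Longrightarrow> lp_bound p (C * M) (\<lambda>k. cmod (val b k))"
proof -
  obtain CK where CK: "0 < CK" and kern: "\<And>u v M \<eta>. \<lbrakk>lp_bound p M u; \<And>k. 0 \<le> u k; \<And>k. 0 \<le> v k; 0 \<le> M; 0 \<le> \<eta>;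
     \<And>k. v k \<le> \<eta> * (\<Sum>l. exp (- 1 * \<bar>\<tau> k - real l\<bar>) * u l)\<rbrakk> \<Longrightarrow> lp_bound p (\<eta> * CK * M) v"
    using lp_bound_exp_kernel[OF assms spread_real zero_less_one] by blast
  define G where "G = exp (1\<^sup>2 / (4*\<beta>))"
  have main: "lp_bound p (G * CK * M) (\<lambda>k. cmod (val b k))"
    if b: "lp_bound p M (\<lambda>l. cmod (b l))" "0 \<le> M" for b M
  proof (rule kern[OF b(1)])
    fix k
    have bM: "cmod (b l) \<le> M" for l using lp_bound_component[OF assms(1) b] by simp
    have s: "summable (\<lambda>l. exp (- 1 * \<bar>\<tau> k - real l\<bar>) * cmod (b l))"
    proof (rule summable_comparison_test_ev[OF always_eventually, OF allI])
      show "summable (\<lambda>l. exp (- 1 * \<bar>real l - \<tau> k\<bar>) * M)"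
        by (intro summable_mult2 spread_exp_summable spread_real) simp
      show "norm (exp (- 1 * \<bar>\<tau> k - real l\<bar>) * cmod (b l)) \<le> exp (- 1 * \<bar>real l - \<tau> k\<bar>) * M" for l
        using bM[of l] by (simp add: abs_minus_commute)
    qed
    have "cmod (val b k) \<le> (\<Sum>l. exp (- \<beta> * (real l - \<tau> k)\<^sup>2) * cmod (b l))" by (rule val_le[OF bM])
    also have "\<dots> \<le> (\<Sum>l. G * (exp (- 1 * \<bar>\<tau> k - real l\<bar>) * cmod (b l)))"
    proof (rule suminf_le[OF _ val_summable[OF bM] summable_mult[OF s]])
      fix l
      have "exp (- \<beta> * (real l - \<tau> k)\<^sup>2) \<le> G * exp (- 1 * \<bar>real l - \<tau> k\<bar>)"
        unfolding G_def by (rule gauss_le[OF \<beta>_pos])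
      then have "exp (- \<beta> * (real l - \<tau> k)\<^sup>2) * cmod (b l) \<le> (G * exp (- 1 * \<bar>real l - \<tau> k\<bar>)) * cmod (b l)"
        by (intro mult_right_mono) auto
      then show "exp (- \<beta> * (real l - \<tau> k)\<^sup>2) * cmod (b l) \<le> G * (exp (- 1 * \<bar>\<tau> k - real l\<bar>) * cmod (b l))"
        by (simp only: mult.assoc abs_minus_commute)
    qed
    also have "\<dots> = G * (\<Sum>l. exp (- 1 * \<bar>\<tau> k - real l\<bar>) * cmod (b l))" by (rule suminf_mult[OF s])
    finally show "cmod (val b k) \<le> G * (\<Sum>l. exp (- 1 * \<bar>\<tau> k - real l\<bar>) * cmod (b l))" .
  qed (use b in \<open>auto simp: G_def\<close>)
  show ?thesis by (rule that[OF _ main]) (use CK in \<open>simp add: G_def\<close>)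
qed

text \<open>Whole windows of length \<open>N\<close> are peeled off from the left; fewer than
  \<open>N\<close> terms remain, each at most \<open>K\<close> in modulus.\<close>

lemma window_sum_bound:
  fixes \<delta> :: "nat \<Rightarrow> real"
  assumes "1 \<le> N" "\<And>n. \<bar>\<Sum>k=n..<n+N. \<delta> k\<bar> \<le> real N * c" "\<And>k. \<bar>\<delta> k\<bar> \<le> K" "0 \<le> c"
  shows "i \<le> j \<Longrightarrow> \<bar>\<Sum>k=i..<j. \<delta> k\<bar> \<le> c * (real j - real i) + real N * K"
proof (induction "j - i" arbitrary: i rule: less_induct)
  case less
  have K: "K \<ge> 0" using assms(3)[of 0] by linarith
  show ?case
  proof (cases "j - i < N")
    case True
    have "\<bar>\<Sum>k=i..<j. \<delta> k\<bar> \<le> (\<Sum>k=i..<j. K)" by (rule order_trans[OF sum_abs sum_mono[OF assms(3)]])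
    also have "\<dots> = real (j - i) * K" by simp
    also have "\<dots> \<le> real N * K" using True K by (intro mult_right_mono) auto
    finally have "\<bar>\<Sum>k=i..<j. \<delta> k\<bar> \<le> real N * K" .
    moreover have "0 \<le> c * (real j - real i)" using assms(4) less by simp
    ultimately show ?thesis by linarith
  next
    case False
    have "(\<Sum>k=i..<j. \<delta> k) = (\<Sum>k=i..<i+N. \<delta> k) + (\<Sum>k=i+N..<j. \<delta> k)"
      using False less by (intro sum.atLeastLessThan_concat[symmetric]) auto
    then have "\<bar>\<Sum>k=i..<j. \<delta> k\<bar> \<le> \<bar>\<Sum>k=i..<i+N. \<delta> k\<bar> + \<bar>\<Sum>k=i+N..<j. \<delta> k\<bar>" by simp
    also have "\<dots> \<le> real N * c + (c * (real j - real (i + N)) + real N * K)"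
      using False less assms(1) by (intro add_mono assms(2) less.hyps) auto
    finally show ?thesis by (simp add: algebra_simps)
  qed
qed

text \<open>In terms of the coefficients the operator is \<open>val\<close> followed by
  multiplication with the factors \<open>weight_ratio\<close>, which are bounded above and below.
  Boundedness, injectivity and a bounded right inverse are therefore inherited from the estimates
  for \<open>val\<close>.\<close>

lemma complete_interpolating_sufficient:
  assumes p: "0 < p" and \<alpha>: "0 < \<alpha>" and \<Lambda>: "\<Lambda> \<subseteq> UNIV - {0}" and sep: "d_log_plus_separated \<Lambda>"
    and bij: "bij_betw l UNIV \<Lambda>" and mono: "\<And>k. cmod (l k) \<le> cmod (l (Suc k))"
    and repr: "\<And>k. l k = of_real (exp ((real k + enn2real (2 / p) + \<delta> k) / (2 * \<alpha>))) * exp (\<i> * of_real (\<theta> k))"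
    and K: "\<And>k. \<bar>\<delta> k\<bar> \<le> K"
    and N: "1 \<le> N" "0 < \<epsilon>" "\<And>n. \<bar>\<Sum>k=n..<n+N. \<delta> k\<bar> \<le> real N * (1/2 - \<epsilon>)"
  shows "complete_interpolating p \<alpha> \<Lambda>"
proof -
  define \<beta> where "\<beta> = 1 / (4 * \<alpha>)"
  define q where "q = enn2real (2 / p)"
  define \<omega> where "\<omega> = (\<lambda>k. l k * of_real (exp (- 2 * \<beta> * q)))"
  define \<tau> where "\<tau> = (\<lambda>k. 2 * \<alpha> * ln (cmod (l k)) - q)"
  have \<beta>: "\<beta> > 0" using \<alpha> by (simp add: \<beta>_def)
  have range: "range l = \<Lambda>" and inj: "inj l" using bij by (auto simp: bij_betw_def)
  have l0: "l k \<noteq> 0" for k using range \<Lambda> by auto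
  have lin: "l k \<in> \<Lambda>" for k using range by auto
  have ln: "ln (cmod (l k)) = (real k + q + \<delta> k) / (2 * \<alpha>)" for k
    unfolding repr[of k] q_def[symmetric] by (simp add: norm_mult)
  have \<tau>: "\<tau> k = real k + \<delta> k" for k unfolding \<tau>_def ln using \<alpha> by simp
  have gn: "gauss_nodes \<beta> \<omega> \<tau>"
    by (rule gauss_nodes_enumeration[OF \<alpha> \<beta>_def inj l0 mono \<omega>_def \<tau>_def])
  define \<rho> where "\<rho> = cmod (l 0)"
  have \<rho>: "\<rho> > 0" using l0 by (simp add: \<rho>_def)
  have l\<rho>: "\<rho> \<le> cmod (l k)" for k unfolding \<rho>_def using mono by (rule lift_Suc_mono_le) simp
  have "l k \<notin> ball 0 \<rho>" for k using l\<rho>[of k] by simp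
  \<comment> \<open>The open disc whose boundary passes through the first node contains no node, so
    \<open>d_log\<close>-separation outside it covers the whole set.\<close>
  then have "\<Lambda> - ball 0 \<rho> = \<Lambda>" unfolding range[symmetric] by auto
  then have "separated_wrt d_log \<Lambda>" using sep \<rho> unfolding d_log_plus_separated_def by metis
  then obtain e where e: "e > 0" "\<And>x y. x \<in> \<Lambda> \<Longrightarrow> y \<in> \<Lambda> \<Longrightarrow> x \<noteq> y \<Longrightarrow> e \<le> d_log x y"
    unfolding separated_wrt_def by blast
  define s where "s = min (1/2) (e/4)"
  have s: "0 < s" "s \<le> 1" using e by (auto simp: s_def)
  have sepl: "s * max (cmod (l i)) (cmod (l k)) \<le> cmod (l i - l k)" if "i \<noteq> k" for i k
    unfolding s_def using that inj by (intro d_log_ge l0 e lin) (auto dest: injD)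
  have c0: "0 \<le> 1/2 - \<epsilon>"
  proof -
    have "0 \<le> real N * (1/2 - \<epsilon>)" using order_trans[OF abs_ge_zero N(3)] .
    then show ?thesis using N(1) by (simp add: zero_le_mult_iff)
  qed
  interpret gauss_nodes \<beta> \<omega> \<tau> by (rule gn)
  interpret good_nodes \<beta> \<omega> \<tau> K s \<epsilon> "real N * K"
  proof
    show "\<bar>\<tau> k - real k\<bar> \<le> K" for k using K[of k] by (simp add: \<tau>)
    show "0 < s" "s \<le> 1" "0 < \<epsilon>" using s N by auto
    show "s * max (cmod (\<omega> i)) (cmod (\<omega> k)) \<le> cmod (\<omega> i - \<omega> k)" if "i \<noteq> k" for i k
    proof -
      have "cmod (\<omega> i - \<omega> k) = cmod (l i - l k) * exp (- 2 * \<beta> * q)"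
        unfolding \<omega>_def left_diff_distrib[symmetric] by (simp add: norm_mult)
      moreover have "max (cmod (\<omega> i)) (cmod (\<omega> k)) = max (cmod (l i)) (cmod (l k)) * exp (- 2 * \<beta> * q)"
        unfolding \<omega>_def by (simp add: norm_mult max_def)
      ultimately show ?thesis using sepl[OF that] by (simp add: mult.assoc[symmetric])
    qed
    show "\<bar>\<Sum>m=i..<j. (\<tau> m - real m)\<bar> \<le> (1/2 - \<epsilon>) * (real j - real i) + real N * K" if "i \<le> j" for i j
      using window_sum_bound[OF N(1,3) K c0 that] by (simp add: \<tau>)
  qed
  define R where "R = restriction_op p \<alpha> \<Lambda>"
  define Dm where "Dm = (1 + 1/\<rho>) powr enn2real (2 / p) * exp (\<alpha> * (ln \<rho>)\<^sup>2)"
  have D1: "1 \<le> weight_ratio p \<alpha> (l k)" for k by (rule weight_ratio_ge_1[OF \<alpha> l0])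
  have D2: "weight_ratio p \<alpha> (l k) \<le> Dm" for k unfolding Dm_def by (rule weight_ratio_le[OF \<alpha> \<rho> l\<rho>])
  have Dm: "Dm \<ge> 1" using D1[of 0] D2[of 0] by linarith
  have Rb: "R (gauss_series \<beta> q b) (l k) = of_real (weight_ratio p \<alpha> (l k)) * val b k"
    if "\<And>j. cmod (b j) \<le> M" for b M k
    unfolding R_def by (rule restriction_op_gauss_series[OF \<alpha> \<beta>_def q_def lin l0 that gn \<omega>_def \<tau>_def])
  have R0: "R f z = 0" if "z \<notin> \<Lambda>" for f z using that by (simp add: R_def restriction_op_eq)
  obtain C1 where C1: "0 < C1" "\<And>f. f \<in> fock_space p \<alpha> \<Longrightarrow>
    lp_bound p (C1 * fock_norm p \<alpha> f) (\<lambda>k. cmod ((deriv ^^ k) f 0 / fact k * exp (\<beta> * (real k + q)\<^sup>2)))"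
    using fock_coefficients[OF p \<alpha> \<beta>_def q_def] by blast
  obtain C2 where C2: "0 < C2" "\<And>b M. \<lbrakk>lp_bound p M (\<lambda>k. cmod (b k)); 0 \<le> M\<rbrakk> \<Longrightarrow>
    gauss_series \<beta> q b \<in> fock_space p \<alpha> \<and> fock_norm p \<alpha> (gauss_series \<beta> q b) \<le> C2 * M"
    using gauss_series_in_fock[OF p \<alpha> \<beta>_def q_def] by blast
  obtain C3 where C3: "0 < C3" "\<And>b M. \<lbrakk>lp_bound p M (\<lambda>l. cmod (b l)); 0 \<le> M\<rbrakk> \<Longrightarrow> lp_bound p (C3 * M) (\<lambda>k. cmod (val b k))"
    using val_lp_bound[OF p spread_\<tau>] by blast
  obtain C4 where C4: "0 < C4" "\<And>b M j. (\<And>l. cmod (b l) \<le> M) \<Longrightarrow>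
    cmod (b j) \<le> C4 * (\<Sum>k. exp (- (2 * \<sigma>) * \<bar>real j - real k\<bar>) * cmod (val b k))"
    using val_lower_bound by blast
  obtain C5 where C5: "0 < C5" "\<And>c M. (\<And>k. cmod (c k) \<le> M) \<Longrightarrow> \<exists>b. (\<forall>k. val b k = c k) \<and>
    (\<forall>j. cmod (b j) \<le> C5 * (\<Sum>k. exp (- (2 * \<sigma>) * \<bar>real j - real k\<bar>) * cmod (c k)))"
    using val_surjective by blast
  have \<sigma>2: "2 * \<sigma> > 0" using \<sigma>_pos by simp
  obtain CK where CK: "0 < CK" and kern: "\<And>u v M \<eta>. \<lbrakk>lp_bound p M u; \<And>k. 0 \<le> u k; \<And>k. 0 \<le> v k; 0 \<le> M; 0 \<le> \<eta>;
     \<And>k. v k \<le> \<eta> * (\<Sum>l. exp (- (2 * \<sigma>) * \<bar>real k - real l\<bar>) * u l)\<rbrakk> \<Longrightarrow> lp_bound p (\<eta> * CK * M) v"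
    using lp_bound_exp_kernel[OF p spread_real spread_real \<sigma>2] by blast
  have expand: "\<exists>b. f = gauss_series \<beta> q b \<and> lp_bound p (C1 * fock_norm p \<alpha> f) (\<lambda>k. cmod (b k)) \<and>
      (\<forall>k. cmod (b k) \<le> C1 * fock_norm p \<alpha> f)" if f: "f \<in> fock_space p \<alpha>" for f
  proof (intro exI conjI allI)
    have "f holomorphic_on UNIV" using f by (simp add: fock_space_def)
    then show "f = gauss_series \<beta> q (\<lambda>k. (deriv ^^ k) f 0 / fact k * exp (\<beta> * (real k + q)\<^sup>2))"
      using entire_gauss_series[OF _ \<beta>] by blast
    show "lp_bound p (C1 * fock_norm p \<alpha> f) (\<lambda>k. cmod ((deriv ^^ k) f 0 / fact k * exp (\<beta> * (real k + q)\<^sup>2)))"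
      by (rule C1(2)[OF f])
    have nn: "0 \<le> C1 * fock_norm p \<alpha> f" using C1(1) fock_norm_nonneg[OF f] by simp
    show "cmod ((deriv ^^ k) f 0 / fact k * exp (\<beta> * (real k + q)\<^sup>2)) \<le> C1 * fock_norm p \<alpha> f" for k
      by (rule lp_bound_component[OF p C1(2)[OF f] nn norm_ge_zero])
  qed
  have bound: "R f \<in> lp_space p \<Lambda> \<and> lp_norm p \<Lambda> (R f) \<le> Dm * (C3 * C1) * fock_norm p \<alpha> f"
    if f: "f \<in> fock_space p \<alpha>" for f
  proof -
    obtain b where b: "f = gauss_series \<beta> q b" "lp_bound p (C1 * fock_norm p \<alpha> f) (\<lambda>k. cmod (b k))"
      "\<And>k. cmod (b k) \<le> C1 * fock_norm p \<alpha> f" using expand[OF f] by blast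
    have nn: "0 \<le> C1 * fock_norm p \<alpha> f" using C1(1) fock_norm_nonneg[OF f] by simp
    have v: "lp_bound p (C3 * (C1 * fock_norm p \<alpha> f)) (\<lambda>k. cmod (val b k))" by (rule C3(2)[OF b(2) nn])
    have nn2: "0 \<le> C3 * (C1 * fock_norm p \<alpha> f)" using nn C3(1) by simp
    have "lp_bound p (Dm * (C3 * (C1 * fock_norm p \<alpha> f))) (\<lambda>k. Dm * cmod (val b k))"
      by (rule lp_bound_scale[OF p v]) (use Dm nn2 in auto)
    then have "lp_bound p (Dm * (C3 * (C1 * fock_norm p \<alpha> f))) (\<lambda>k. cmod (R f (l k)))"
    proof (rule lp_bound_mono[OF p])
      fix k
      have "cmod (R f (l k)) = weight_ratio p \<alpha> (l k) * cmod (val b k)"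
        unfolding b(1) using Rb[of b _ k, OF b(3)] D1[of k] by (simp add: norm_mult)
      then show "cmod (R f (l k)) \<le> Dm * cmod (val b k)" using D2[of k] by (simp add: mult_right_mono)
    qed (use Dm nn2 in auto)
    then have "(\<lambda>k. R f (l k)) \<in> lp_space p UNIV \<and> lp_norm p UNIV (\<lambda>k. R f (l k)) \<le> Dm * (C3 * (C1 * fock_norm p \<alpha> f))"
      using lp_bound_iff[OF p, of "Dm * (C3 * (C1 * fock_norm p \<alpha> f))" "\<lambda>k. R f (l k)"] Dm nn2 by simp
    then show ?thesis using lp_reindex[OF bij, of "R f" p] R0 by (simp add: mult.assoc)
  qed
  have inj_R: "inj_on R (fock_space p \<alpha>)"
  proof (rule inj_onI)
    fix f g assume fg: "f \<in> fock_space p \<alpha>" "g \<in> fock_space p \<alpha>" "R f = R g"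
    obtain b where b: "f = gauss_series \<beta> q b" "\<And>k. cmod (b k) \<le> C1 * fock_norm p \<alpha> f" using expand[OF fg(1)] by blast
    obtain c where c: "g = gauss_series \<beta> q c" "\<And>k. cmod (c k) \<le> C1 * fock_norm p \<alpha> g" using expand[OF fg(2)] by blast
    have "val b k = val c k" for k
    proof -
      have "of_real (weight_ratio p \<alpha> (l k)) * val b k = of_real (weight_ratio p \<alpha> (l k)) * val c k"
        using Rb[of b _ k, OF b(2)] Rb[of c _ k, OF c(2)] fg(3)
        unfolding b(1)[symmetric] c(1)[symmetric] by metis
      then show ?thesis using D1[of k] by simp
    qed
    then have vd: "val (\<lambda>l. b l - c l) k = 0" for k using val_diff[of b _ c _ k, OF b(2) c(2)] by simp
    have db: "cmod (b l - c l) \<le> C1 * fock_norm p \<alpha> f + C1 * fock_norm p \<alpha> g" for l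
      using norm_triangle_ineq4[of "b l" "c l"] b(2)[of l] c(2)[of l] by linarith
    have "cmod (b j - c j) \<le> 0" for j using C4(2)[of "\<lambda>l. b l - c l", OF db, of j] by (simp add: vd)
    then have "b = c" by (intro ext) simp
    then show "f = g" by (simp add: b(1) c(1))
  qed
  have surj: "\<exists>f\<in>fock_space p \<alpha>. R f = c \<and> fock_norm p \<alpha> f \<le> C2 * (C5 * CK) * lp_norm p \<Lambda> c"
    if c: "c \<in> lp_space p \<Lambda>" for c
  proof -
    have c0: "c z = 0" if "z \<notin> \<Lambda>" for z using c that by (simp add: lp_space_def)
    have cl: "(\<lambda>k. c (l k)) \<in> lp_space p UNIV" using lp_reindex(1)[OF bij c0] c by simp
    define nc where "nc = lp_norm p \<Lambda> c"
    have nc: "nc = lp_norm p UNIV (\<lambda>k. c (l k))" unfolding nc_def by (rule lp_reindex(2)[OF bij c0])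
    have nc0: "nc \<ge> 0" unfolding nc by (rule lp_norm_nonneg[OF cl])
    have clb: "lp_bound p nc (\<lambda>k. cmod (c (l k)))" unfolding nc by (rule lp_boundI[OF p cl])
    \<comment> \<open>\<open>weight_ratio\<close> is at least 1, so dividing by it does not enlarge
      the norm.\<close>
    define c' where "c' k = c (l k) / of_real (weight_ratio p \<alpha> (l k))" for k
    have c'le: "cmod (c' k) \<le> cmod (c (l k))" for k
      unfolding c'_def using D1[of k] by (simp add: norm_divide divide_le_eq mult_le_cancel_left1)
    have c'b: "lp_bound p nc (\<lambda>k. cmod (c' k))" by (rule lp_bound_mono[OF p clb]) (use c'le nc0 in auto)
    have c'M: "cmod (c' k) \<le> nc" for k using lp_bound_component[OF p c'b nc0] by simp
    obtain b where b: "\<And>k. val b k = c' k"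
      "\<And>j. cmod (b j) \<le> C5 * (\<Sum>k. exp (- (2 * \<sigma>) * \<bar>real j - real k\<bar>) * cmod (c' k))"
      using C5(2)[of c' nc, OF c'M] by blast
    have bb: "lp_bound p (C5 * CK * nc) (\<lambda>k. cmod (b k))"
      by (rule kern[OF c'b _ _ nc0 _ b(2)]) (use C5 in auto)
    have nn: "0 \<le> C5 * CK * nc" using C5 CK nc0 by simp
    have bM: "cmod (b k) \<le> C5 * CK * nc" for k using lp_bound_component[OF p bb nn] by simp
    have "R (gauss_series \<beta> q b) = c"
    proof
      fix z
      show "R (gauss_series \<beta> q b) z = c z"
      proof (cases "z \<in> \<Lambda>")
        case True
        then obtain k where z: "z = l k" using range by auto
        show ?thesis unfolding z Rb[of b _ k, OF bM] b(1) c'_def using D1[of k] by simp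
      qed (simp add: R0 c0)
    qed
    then show ?thesis using C2(2)[OF bb nn] by (intro bexI[of _ "gauss_series \<beta> q b"]) (auto simp: nc_def mult.assoc)
  qed
  have bijR: "bij_betw R (fock_space p \<alpha>) (lp_space p \<Lambda>)"
    unfolding bij_betw_def
  proof (intro conjI inj_R equalityI subsetI)
    fix c assume "c \<in> R ` fock_space p \<alpha>"
    then show "c \<in> lp_space p \<Lambda>" using bound by auto
  next
    fix c assume "c \<in> lp_space p \<Lambda>"
    then show "c \<in> R ` fock_space p \<alpha>" using surj by blast
  qed
  have "\<forall>c\<in>lp_space p \<Lambda>. fock_norm p \<alpha> (inv_into (fock_space p \<alpha>) R c) \<le> C2 * (C5 * CK) * lp_norm p \<Lambda> c"
  proof
    fix c assume "c \<in> lp_space p \<Lambda>"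
    then obtain f where f: "f \<in> fock_space p \<alpha>" "R f = c" "fock_norm p \<alpha> f \<le> C2 * (C5 * CK) * lp_norm p \<Lambda> c"
      using surj by blast
    then have "inv_into (fock_space p \<alpha>) R c = f" using inv_into_f_f[OF inj_R f(1)] by simp
    then show "fock_norm p \<alpha> (inv_into (fock_space p \<alpha>) R c) \<le> C2 * (C5 * CK) * lp_norm p \<Lambda> c" using f(3) by simp
  qed
  moreover have "R (\<lambda>x. f x + g x) = (\<lambda>y. R f y + R g y)" "R (\<lambda>x. a * f x) = (\<lambda>y. a * R f y)" for f g a
    unfolding R_def restriction_op_eq by (auto simp: fun_eq_iff distrib_right)
  ultimately show ?thesis
    unfolding complete_interpolating_def bounded_iso_def R_def[symmetric] using bijR bound by blast
qed

lemma separated_imp_d_log_plus_separated: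
  assumes "\<Lambda> \<subseteq> UNIV - {0}" "0 < s" "\<And>x y. \<lbrakk>x \<in> \<Lambda>; y \<in> \<Lambda>; x \<noteq> y\<rbrakk> \<Longrightarrow> s * max 1 (cmod x) \<le> cmod (x - y)"
  shows "d_log_plus_separated \<Lambda>"
proof -
  have log: "s \<le> d_log x y" if xy: "x \<in> \<Lambda>" "y \<in> \<Lambda>" "x \<noteq> y" for x y
  proof -
    have nz: "x \<noteq> 0" "y \<noteq> 0" using xy assms(1) by auto
    have "s * max (cmod x) (cmod y) \<le> cmod (x - y)"
    proof (cases "cmod x \<le> cmod y")
      case True
      have "s * max (cmod x) (cmod y) \<le> s * max 1 (cmod y)" using True assms(2) by (intro mult_left_mono) auto
      also have "\<dots> \<le> cmod (y - x)" using xy by (intro assms(3)) auto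
      finally show ?thesis by (simp add: norm_minus_commute)
    next
      case False
      have "s * max (cmod x) (cmod y) \<le> s * max 1 (cmod x)" using False assms(2) by (intro mult_left_mono) auto
      also have "\<dots> \<le> cmod (x - y)" using xy by (intro assms(3)) auto
      finally show ?thesis .
    qed
    also have "\<dots> \<le> max (cmod x) (cmod y) * d_log x y" by (rule d_log_le[OF nz])
    finally have "max (cmod x) (cmod y) * s \<le> max (cmod x) (cmod y) * d_log x y" by (simp only: mult.commute)
    moreover have "0 < max (cmod x) (cmod y)" using nz by (simp add: less_max_iff_disj)
    ultimately show ?thesis by simp
  qed
  have dist: "s \<le> dist x y" if xy: "x \<in> \<Lambda>" "y \<in> \<Lambda>" "x \<noteq> y" for x y
  proof -
    have "s * 1 \<le> s * max 1 (cmod x)" using assms(2) by (intro mult_left_mono) auto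
    then show ?thesis using assms(3)[OF xy] by (simp add: dist_norm)
  qed
  show ?thesis unfolding d_log_plus_separated_def separated_wrt_def
    using log dist assms(2) by (intro allI impI conjI exI[of _ s] ballI) auto
qed

lemma separated_card_cball:
  assumes "0 < d"
  obtains K :: nat where "0 < K" "\<And>R S. \<lbrakk>0 < R; S \<subseteq> cball (0::complex) R; \<forall>x\<in>S. \<forall>y\<in>S. x \<noteq> y \<longrightarrow> d * R \<le> cmod (x - y)\<rbrakk>
     \<Longrightarrow> finite S \<and> card S \<le> K"
proof -
  obtain K :: nat where K: "0 < K" "\<And>S. \<lbrakk>S \<subseteq> cball (0::complex) 1; \<And>x y. x \<in> S \<Longrightarrow> y \<in> S \<Longrightarrow> x \<noteq> y \<Longrightarrow> d \<le> dist x y\<rbrakk>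
    \<Longrightarrow> finite S \<and> card S \<le> K"
    using pairwise_separated_card[OF assms] by blast
  have "finite S \<and> card S \<le> K"
    if R: "0 < R" and S: "S \<subseteq> cball 0 R" "\<forall>x\<in>S. \<forall>y\<in>S. x \<noteq> y \<longrightarrow> d * R \<le> cmod (x - y)" for R and S :: "complex set"
  proof -
    define f where "f x = x / of_real R" for x :: complex
    have inj: "inj_on f S" using R by (auto simp: inj_on_def f_def)
    have "finite (f ` S) \<and> card (f ` S) \<le> K"
    proof (rule K(2))
      show "f ` S \<subseteq> cball 0 1" using S(1) R by (auto simp: f_def norm_divide)
      fix x y assume "x \<in> f ` S" "y \<in> f ` S" "x \<noteq> y"
      then obtain x' y' where xy: "x' \<in> S" "y' \<in> S" "x' \<noteq> y'" "x = f x'" "y = f y'" by auto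
      have "dist x y = cmod (x' - y') / R"
        unfolding xy f_def dist_norm diff_divide_distrib[symmetric] using R by (simp add: norm_divide)
      then show "d \<le> dist x y" using S(2)[rule_format, OF xy(1,2,3)] R by (simp add: pos_le_divide_eq)
    qed
    then show ?thesis using inj by (simp add: finite_image_iff card_image)
  qed
  then show ?thesis using that K(1) by blast
qed

text \<open>Unit sequences have preimages whose coefficients share one bound, so
  \<open>zero_separation\<close> applies to all of them with the same constant. Separation makes
  \<tau> spread, and only this gives access to the matrix arguments of
  \<open>stable_nodes\<close>.\<close>

lemma complete_interpolating_necessary:
  assumes p: "0 < p" and \<alpha>: "0 < \<alpha>" and \<Lambda>: "\<Lambda> \<subseteq> UNIV - {0}" and ci: "complete_interpolating p \<alpha> \<Lambda>"
  shows "d_log_plus_separated \<Lambda>"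
    "\<exists>(l :: nat \<Rightarrow> complex) \<delta> \<theta> K (N::nat) \<epsilon>. bij_betw l UNIV \<Lambda> \<and> (\<forall>k. cmod (l k) \<le> cmod (l (Suc k))) \<and>
      (\<forall>k. l k = of_real (exp ((real k + enn2real (2 / p) + \<delta> k) / (2 * \<alpha>))) * exp (\<i> * of_real (\<theta> k))) \<and>
      (\<forall>k. \<bar>\<delta> k\<bar> \<le> K) \<and> 1 \<le> N \<and> 0 < \<epsilon> \<and> (\<forall>n. \<bar>\<Sum>k=n..<n+N. \<delta> k\<bar> \<le> real N * (1/2 - \<epsilon>))"
proof -
  define \<beta> where "\<beta> = 1 / (4 * \<alpha>)"
  define q where "q = enn2real (2 / p)"
  have \<beta>: "\<beta> > 0" using \<alpha> by (simp add: \<beta>_def)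
  define R where "R = restriction_op p \<alpha> \<Lambda>"
  have R0: "R f z = 0" if "z \<notin> \<Lambda>" for f z using that by (simp add: R_def restriction_op_eq)
  obtain Ci where bijR: "bij_betw R (fock_space p \<alpha>) (lp_space p \<Lambda>)"
    and Ci: "\<And>c. c \<in> lp_space p \<Lambda> \<Longrightarrow> fock_norm p \<alpha> (inv_into (fock_space p \<alpha>) R c) \<le> Ci * lp_norm p \<Lambda> c"
    using ci unfolding complete_interpolating_def bounded_iso_def R_def[symmetric] by blast
  obtain C1 where C1: "0 < C1" "\<And>f. f \<in> fock_space p \<alpha> \<Longrightarrow>
    lp_bound p (C1 * fock_norm p \<alpha> f) (\<lambda>k. cmod ((deriv ^^ k) f 0 / fact k * exp (\<beta> * (real k + q)\<^sup>2)))"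
    using fock_coefficients[OF p \<alpha> \<beta>_def q_def] by blast
  obtain C2 where C2: "0 < C2" "\<And>b M. \<lbrakk>lp_bound p M (\<lambda>k. cmod (b k)); 0 \<le> M\<rbrakk> \<Longrightarrow>
    gauss_series \<beta> q b \<in> fock_space p \<alpha> \<and> fock_norm p \<alpha> (gauss_series \<beta> q b) \<le> C2 * M"
    using gauss_series_in_fock[OF p \<alpha> \<beta>_def q_def] by blast
  \<comment> \<open>\<open>Ci\<close> may be any real number; the maximum makes the constant
    positive.\<close>
  define CL where "CL = C1 * max Ci 1"
  have CL: "CL > 0" using C1 by (simp add: CL_def)
  have inv_bound: "lp_bound p (CL * lp_norm p \<Lambda> c)
      (\<lambda>k. cmod ((deriv ^^ k) f 0 / fact k * exp (\<beta> * (real k + q)\<^sup>2)))"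
    if f: "f \<in> fock_space p \<alpha>" "R f = c" for f c
  proof -
    have c: "c \<in> lp_space p \<Lambda>" using bijR f by (auto simp: bij_betw_def)
    have "inv_into (fock_space p \<alpha>) R c = f" using bijR f inv_into_f_f by (metis bij_betw_def)
    then have "fock_norm p \<alpha> f \<le> Ci * lp_norm p \<Lambda> c" using Ci[OF c] by simp
    also have "\<dots> \<le> max Ci 1 * lp_norm p \<Lambda> c" using lp_norm_nonneg[OF c] by (intro mult_right_mono) auto
    finally have "C1 * fock_norm p \<alpha> f \<le> CL * lp_norm p \<Lambda> c" unfolding CL_def mult.assoc using C1 by (intro mult_left_mono) auto
    then show ?thesis
      using C1 fock_norm_nonneg[OF f(1)] by (intro lp_bound_mono[OF p C1(2)[OF f(1)]]) auto
  qed
  have lower: "lp_bound p (CL * lp_norm p \<Lambda> (R (gauss_series \<beta> q b))) (\<lambda>k. cmod (b k))"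
    if b: "lp_bound p M (\<lambda>k. cmod (b k))" "0 \<le> M" for b M
  proof -
    have bM: "cmod (b k) \<le> M" for k using lp_bound_component[OF p b] by simp
    have eq: "(deriv ^^ k) (gauss_series \<beta> q b) 0 / fact k * exp (\<beta> * (real k + q)\<^sup>2) = b k" for k
      unfolding gauss_series_entire(2)[of \<beta> b M k q, OF \<beta> bM, symmetric]
      by (simp add: mult.assoc flip: of_real_mult exp_add)
    show ?thesis using inv_bound[OF conjunct1[OF C2(2)[OF b]] refl] unfolding eq .
  qed
  have onto: "\<exists>b. R (gauss_series \<beta> q b) = c \<and> lp_bound p (CL * lp_norm p \<Lambda> c) (\<lambda>k. cmod (b k))"
    if c: "c \<in> lp_space p \<Lambda>" for c
  proof -
    obtain f where f: "f \<in> fock_space p \<alpha>" "R f = c" using bijR c unfolding bij_betw_def by (metis imageE)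
    have "f holomorphic_on UNIV" using f by (simp add: fock_space_def)
    then have fb: "f = gauss_series \<beta> q (\<lambda>k. (deriv ^^ k) f 0 / fact k * exp (\<beta> * (real k + q)\<^sup>2))"
      using entire_gauss_series[OF _ \<beta>] by blast
    show ?thesis
      by (intro exI conjI) (rule trans[OF arg_cong[OF fb[symmetric], of R] f(2)], rule inv_bound[OF f])
  qed
  define unit where "unit z = (\<lambda>x. if x = z then 1 else 0 :: complex)" for z :: complex
  have unit: "unit z \<in> lp_space p \<Lambda>" "lp_norm p \<Lambda> (unit z) = 1" if z: "z \<in> \<Lambda>" for z
  proof -
    have eq: "cmod (unit z x) powr P = (if x = z then 1 else 0)" if "P > 0" for x P using that by (simp add: unit_def)
    have im: "(\<lambda>x. cmod (unit z x)) ` \<Lambda> \<subseteq> {0, 1}" "1 \<in> (\<lambda>x. cmod (unit z x)) ` \<Lambda>"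
      using z by (auto simp: unit_def split: if_splits)
    have fin: "((\<lambda>x. if x = z then 1 else 0 :: real) has_sum 1) \<Lambda>"
      using has_sum_finite_neutralI[of "{z}" \<Lambda> "\<lambda>x. if x = z then 1 else 0 :: real" 1] z by simp
    show "unit z \<in> lp_space p \<Lambda>"
    proof (cases "p = \<infinity>")
      case True
      have "bdd_above ((\<lambda>x. cmod (unit z x)) ` \<Lambda>)" using im(1) by (intro bdd_above_mono[OF _ im(1)]) auto
      then show ?thesis using True z by (auto simp: lp_space_def unit_def)
    next
      case False
      then show ?thesis using z has_sum_imp_summable[OF fin] eq[OF enn2real_pos[OF p False]]
        by (auto simp: lp_space_def) (auto simp: unit_def)
    qed
    show "lp_norm p \<Lambda> (unit z) = 1"
    proof (cases "p = \<infinity>")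
      case True
      have "insert 0 ((\<lambda>x. cmod (unit z x)) ` \<Lambda>) = {0, 1}" using im by auto
      then show ?thesis using True by (simp add: lp_norm_def cSup_eq_Max)
    next
      case False
      then show ?thesis using infsumI[OF fin] eq[OF enn2real_pos[OF p False]] by (simp add: lp_norm_def)
    qed
  qed
  obtain s where s: "0 < s" and zs: "\<And>b z z'. \<lbrakk>\<And>l. cmod (b l) \<le> CL; z \<noteq> 0; gauss_series \<beta> q b z * fock_weight p \<alpha> z = 1;
     gauss_series \<beta> q b z' = 0\<rbrakk> \<Longrightarrow> s * max 1 (cmod z) \<le> cmod (z - z')"
    using zero_separation[OF \<alpha> \<beta>_def q_def, of CL] by blast
  have fw: "fock_weight p \<alpha> z > 0" for z
  proof -
    have "1 + cmod z \<noteq> 0" using norm_ge_zero[of z] by linarith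
    then show ?thesis unfolding fock_weight_def by (intro mult_pos_pos) auto
  qed
  have sep: "s * max 1 (cmod x) \<le> cmod (x - y)" if xy: "x \<in> \<Lambda>" "y \<in> \<Lambda>" "x \<noteq> y" for x y
  proof -
    obtain b where b: "R (gauss_series \<beta> q b) = unit x" "lp_bound p (CL * lp_norm p \<Lambda> (unit x)) (\<lambda>k. cmod (b k))"
      using onto[OF unit(1)[OF xy(1)]] by blast
    have bl: "cmod (b k) \<le> CL" for k
      using lp_bound_component[OF p b(2), of k] CL by (simp add: unit(2)[OF xy(1)])
    show ?thesis
    proof (rule zs[OF bl])
      show "x \<noteq> 0" using xy \<Lambda> by auto
      show "gauss_series \<beta> q b x * fock_weight p \<alpha> x = 1"
        using fun_cong[OF b(1), of x] xy by (simp add: R_def restriction_op_eq unit_def)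
      show "gauss_series \<beta> q b y = 0"
        using fun_cong[OF b(1), of y] xy fw[of y] by (simp add: R_def restriction_op_eq unit_def)
    qed
  qed
  show "d_log_plus_separated \<Lambda>" by (rule separated_imp_d_log_plus_separated[OF \<Lambda> s sep])
  have finR: "finite (\<Lambda> \<inter> cball 0 r)" for r
  proof (cases "r > 0")
    case True
    then have "s / r > 0" using s by simp
    then obtain K :: nat where "\<And>R S. \<lbrakk>0 < R; S \<subseteq> cball (0::complex) R; \<forall>x\<in>S. \<forall>y\<in>S. x \<noteq> y \<longrightarrow> (s/r) * R \<le> cmod (x - y)\<rbrakk>
       \<Longrightarrow> finite S \<and> card S \<le> K" using separated_card_cball by metis
    note K = this[OF True, of "\<Lambda> \<inter> cball 0 r"]
    show ?thesis
    proof (rule conjunct1[OF K], simp, intro ballI impI)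
      fix x y assume "x \<in> \<Lambda> \<inter> cball 0 r" "y \<in> \<Lambda> \<inter> cball 0 r" "x \<noteq> y"
      then have "s * max 1 (cmod x) \<le> cmod (x - y)" by (intro sep) auto
      moreover have "s * 1 \<le> s * max 1 (cmod x)" using s by (intro mult_left_mono) auto
      ultimately show "s / r * r \<le> cmod (x - y)" using True by simp
    qed
  next
    case False
    \<comment> \<open>For r \<le> 0 the disc is at most the origin, which \<Lambda> avoids.\<close>
    then have "\<Lambda> \<inter> cball 0 r \<subseteq> {}" using \<Lambda> by (auto simp: not_less) (metis Diff_iff insertI1 norm_le_zero_iff order_trans subsetD)
    then show ?thesis by simp
  qed
  have inf: "infinite \<Lambda>"
  proof
    assume fin: "finite \<Lambda>"
    \<comment> \<open>For finite \<Lambda> this polynomial would restrict to 0, although it lies in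
      the space and is not 0; the lower bound excludes that.\<close>
    define Q where "Q = (\<Prod>z\<in>\<Lambda>. [:- z, 1:])"
    have Q0: "Q \<noteq> 0" using fin by (simp add: Q_def)
    define b where "b k = coeff Q k * exp (\<beta> * (real k + q)\<^sup>2)" for k
    have fs: "cmod (b k) = 0" if "k \<ge> Suc (degree Q)" for k using that by (simp add: b_def coeff_eq_0)
    obtain M where M: "M \<ge> 0" "lp_bound p M (\<lambda>k. cmod (b k))"
      using lp_bound_finite_support[of p "\<lambda>k. cmod (b k)" "Suc (degree Q)", OF p norm_ge_zero fs] by blast
    have bM: "cmod (b k) \<le> M" for k using lp_bound_component[OF p M(2,1)] by simp
    have bt: "b l * exp (- \<beta> * (real l + q)\<^sup>2) * z ^ l = coeff Q l * z ^ l" for l z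
      unfolding b_def by (simp add: mult.assoc flip: of_real_mult exp_add)
    have "gauss_series \<beta> q b z = poly Q z" for z
      unfolding gauss_series_def bt
      using suminf_finite[of "{..degree Q}" "\<lambda>l. coeff Q l * z ^ l"] by (simp add: poly_altdef coeff_eq_0)
    then have "R (gauss_series \<beta> q b) z = 0" for z
      using fin by (auto simp: R_def restriction_op_eq Q_def poly_prod)
    then have "R (gauss_series \<beta> q b) = (\<lambda>_. 0)" by blast
    moreover have "lp_norm p \<Lambda> (\<lambda>_. 0) = 0"
      using enn2real_pos[OF p] by (cases "p = \<infinity>") (auto simp: lp_norm_def image_constant_conv)
    ultimately have "lp_bound p 0 (\<lambda>k. cmod (b k))" using lower[OF M(2,1)] by simp
    then have "cmod (b (degree Q)) \<le> 0" by (rule lp_bound_component[OF p]) auto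
    then show False using Q0 by (simp add: b_def)
  qed
  obtain l :: "nat \<Rightarrow> complex" where bij: "bij_betw l UNIV \<Lambda>" and mono: "\<And>k. cmod (l k) \<le> cmod (l (Suc k))"
    using enumerate_by_modulus[OF inf finR] by blast
  have range: "range l = \<Lambda>" and inj: "inj l" using bij by (auto simp: bij_betw_def)
  have l0: "l k \<noteq> 0" for k using range \<Lambda> by auto
  have lin: "l k \<in> \<Lambda>" for k using range by auto
  have monol: "cmod (l i) \<le> cmod (l j)" if "i \<le> j" for i j using mono that by (rule lift_Suc_mono_le)
  define \<omega> where "\<omega> = (\<lambda>k. l k * of_real (exp (- 2 * \<beta> * q)))"
  define \<tau> where "\<tau> = (\<lambda>k. 2 * \<alpha> * ln (cmod (l k)) - q)"
  have gn: "gauss_nodes \<beta> \<omega> \<tau>"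
    by (rule gauss_nodes_enumeration[OF \<alpha> \<beta>_def inj l0 mono \<omega>_def \<tau>_def])
  interpret gauss_nodes \<beta> \<omega> \<tau> by (rule gn)
  have spr: "spread \<tau>"
  proof -
    \<comment> \<open>If the moduli of the nodes i, ..., i + K differed by less than the factor e,
      these would be K + 1 points in a disc of radius e |l i| at mutual distances at least s |l i|.
      Hence ln |l| grows by at least 1, and \<tau> by at least 2\<alpha>, every K steps.\<close>
    have "s / exp 1 > 0" using s by simp
    then obtain K :: nat where K: "0 < K" "\<And>R S. \<lbrakk>0 < R; S \<subseteq> cball (0::complex) R; \<forall>x\<in>S. \<forall>y\<in>S. x \<noteq> y \<longrightarrow> (s / exp 1) * R \<le> cmod (x - y)\<rbrakk>
       \<Longrightarrow> finite S \<and> card S \<le> K" using separated_card_cball by metis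
    have step: "\<tau> i + 2 * \<alpha> \<le> \<tau> (i + K)" for i
    proof (rule ccontr)
      assume "\<not> \<tau> i + 2 * \<alpha> \<le> \<tau> (i + K)"
      then have "2 * \<alpha> * ln (cmod (l (i + K))) < 2 * \<alpha> * (ln (cmod (l i)) + 1)" by (simp add: \<tau>_def algebra_simps)
      then have "ln (cmod (l (i + K))) < ln (cmod (l i)) + 1" using \<alpha> by simp
      then have "exp (ln (cmod (l (i + K)))) < exp (ln (cmod (l i)) + 1)" by simp
      then have top: "cmod (l (i + K)) \<le> exp 1 * cmod (l i)" using l0 by (simp add: exp_add mult.commute)
      define S where "S = l ` {i..i+K}"
      have "finite S \<and> card S \<le> K"
      proof (rule K(2))
        show "0 < exp 1 * cmod (l i)" using l0 by simp
        show "S \<subseteq> cball 0 (exp 1 * cmod (l i))"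
          unfolding S_def
        proof (intro image_subsetI)
          fix j assume "j \<in> {i..i+K}"
          then show "l j \<in> cball 0 (exp 1 * cmod (l i))" using order_trans[OF monol[of j "i+K"] top] by simp
        qed
        show "\<forall>x\<in>S. \<forall>y\<in>S. x \<noteq> y \<longrightarrow> s / exp 1 * (exp 1 * cmod (l i)) \<le> cmod (x - y)"
        proof (intro ballI impI)
          fix x y assume xy: "x \<in> S" "y \<in> S" "x \<noteq> y"
          then obtain j where j: "j \<ge> i" "x = l j" by (auto simp: S_def)
          have "s / exp 1 * (exp 1 * cmod (l i)) = s * cmod (l i)" by simp
          also have "\<dots> \<le> s * max 1 (cmod x)"
            using s monol[OF j(1)] j(2) by (intro mult_left_mono) auto
          also have "\<dots> \<le> cmod (x - y)" using xy lin by (intro sep) (auto simp: S_def)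
          finally show "s / exp 1 * (exp 1 * cmod (l i)) \<le> cmod (x - y)" .
        qed
      qed
      moreover have "card S = Suc K" unfolding S_def using inj by (subst card_image) (auto simp: inj_on_def inj_def)
      ultimately show False by simp
    qed
    have steps: "\<tau> i + 2 * \<alpha> * real n \<le> \<tau> (i + K * n)" for i n
    proof (induction n)
      case (Suc n)
      then show ?case using step[of "i + K * n"] by (simp add: algebra_simps)
    qed simp
    have \<kappa>: "2 * \<alpha> / real K > 0" using \<alpha> K(1) by simp
    show ?thesis unfolding spread_def
    proof (rule exI, rule conjI[OF \<kappa>], rule exI[of _ "2 * \<alpha>"], intro allI impI)
      fix i j :: nat assume ij: "i \<le> j"
      \<comment> \<open>Only complete blocks of \<open>K\<close> steps are counted; the incomplete
        one costs the constant 2\<alpha>.\<close>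
      define n where "n = (j - i) div K"
      have "K * n \<le> j - i" by (simp add: n_def)
      then have "\<tau> (i + K * n) \<le> \<tau> j" using ij by (intro mono_\<tau>) auto
      then have 1: "2 * \<alpha> * real n \<le> \<tau> j - \<tau> i" using steps[of i n] by linarith
      have "j - i < K * Suc n" unfolding n_def using K(1) dividend_less_times_div[of K "j - i"] by simp
      then have "real (j - i) < real K * (real n + 1)" by (metis of_nat_Suc of_nat_less_iff of_nat_mult add.commute)
      then have "(real j - real i) / real K \<le> real n + 1" using ij K(1) by (simp add: of_nat_diff divide_le_eq mult.commute)
      then have "2 * \<alpha> * ((real j - real i) / real K) \<le> 2 * \<alpha> * (real n + 1)" using \<alpha> by (intro mult_left_mono) auto
      then show "2 * \<alpha> / real K * (real j - real i) - 2 * \<alpha> \<le> \<tau> j - \<tau> i" using 1 by (simp add: algebra_simps)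
    qed
  qed
  define \<rho> where "\<rho> = cmod (l 0)"
  have \<rho>: "\<rho> > 0" using l0 by (simp add: \<rho>_def)
  have l\<rho>: "\<rho> \<le> cmod (l k)" for k unfolding \<rho>_def by (rule monol) simp
  define Dm where "Dm = (1 + 1/\<rho>) powr enn2real (2 / p) * exp (\<alpha> * (ln \<rho>)\<^sup>2)"
  have D1: "1 \<le> weight_ratio p \<alpha> (l k)" for k by (rule weight_ratio_ge_1[OF \<alpha> l0])
  have D2: "weight_ratio p \<alpha> (l k) \<le> Dm" for k unfolding Dm_def by (rule weight_ratio_le[OF \<alpha> \<rho> l\<rho>])
  have Dm: "Dm \<ge> 1" using D1[of 0] D2[of 0] by linarith
  have Rb: "R (gauss_series \<beta> q b) (l k) = of_real (weight_ratio p \<alpha> (l k)) * val b k"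
    if "\<And>j. cmod (b j) \<le> M" for b M k
    unfolding R_def by (rule restriction_op_gauss_series[OF \<alpha> \<beta>_def q_def lin l0 that gn \<omega>_def \<tau>_def])
  interpret stable_nodes \<beta> \<omega> \<tau> p "CL * Dm"
  proof
    show "0 < p" by (rule p)
    show "spread \<tau>" by (rule spr)
    show "0 < CL * Dm" using CL Dm by simp
    fix b M N assume b: "lp_bound p M (\<lambda>l. cmod (b l))" "0 \<le> M" and v: "lp_bound p N (\<lambda>k. cmod (val b k))" "0 \<le> N"
    have bM: "cmod (b k) \<le> M" for k using lp_bound_component[OF p b] by simp
    define c where "c = R (gauss_series \<beta> q b)"
    have "lp_bound p (Dm * N) (\<lambda>k. Dm * cmod (val b k))"
      by (rule lp_bound_scale[OF p v(1)]) (use Dm v in auto)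
    then have "lp_bound p (Dm * N) (\<lambda>k. cmod (c (l k)))"
    proof (rule lp_bound_mono[OF p])
      fix k
      have "cmod (c (l k)) = weight_ratio p \<alpha> (l k) * cmod (val b k)"
        unfolding c_def using Rb[of b _ k, OF bM] D1[of k] by (simp add: norm_mult)
      then show "cmod (c (l k)) \<le> Dm * cmod (val b k)" using D2[of k] by (simp add: mult_right_mono)
    qed (use Dm v in auto)
    then have "lp_norm p UNIV (\<lambda>k. c (l k)) \<le> Dm * N"
      using lp_bound_iff[OF p, of "Dm * N" "\<lambda>k. c (l k)"] Dm v by simp
    then have cN: "lp_norm p \<Lambda> c \<le> Dm * N" using lp_reindex(2)[OF bij, of c p] R0 by (simp add: c_def)
    have "c \<in> lp_space p \<Lambda>" unfolding c_def using conjunct1[OF C2(2)[OF b]] bijR by (auto simp: bij_betw_def)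
    then have c0: "0 \<le> lp_norm p \<Lambda> c" by (rule lp_norm_nonneg)
    have "lp_bound p (CL * lp_norm p \<Lambda> c) (\<lambda>k. cmod (b k))" unfolding c_def by (rule lower[OF b])
    then show "lp_bound p (CL * Dm * N) (\<lambda>l. cmod (b l))"
    proof (rule lp_bound_mono[OF p])
      show "CL * lp_norm p \<Lambda> c \<le> CL * Dm * N" unfolding mult.assoc using cN CL by (intro mult_left_mono) auto
    qed (use CL c0 in auto)
  next
    fix k
    \<comment> \<open>Scaled in advance by the row factor at node \<open>k\<close>, so that
      \<open>val\<close> takes the value 1 there.\<close>
    define c where "c z = of_real (weight_ratio p \<alpha> (l k)) * unit (l k) z" for z
    have u: "unit (l k) \<in> lp_space p \<Lambda>" by (rule unit(1)[OF lin])
    have "c \<in> lp_space p \<Lambda>"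
    proof -
      have c0: "c z = 0" if "z \<notin> \<Lambda>" for z using that lin by (auto simp: c_def unit_def)
      have u0: "unit (l k) z = 0" if "z \<notin> \<Lambda>" for z using that lin by (auto simp: unit_def)
      have "(\<lambda>j. unit (l k) (l j)) \<in> lp_space p UNIV" using lp_reindex(1)[of l \<Lambda> "unit (l k)" p, OF bij u0] u by blast
      from lp_bound_scale[OF p lp_boundI[OF p this] _ _ lp_norm_nonneg[OF this], of "weight_ratio p \<alpha> (l k)"]
      have "lp_bound p (weight_ratio p \<alpha> (l k) * lp_norm p UNIV (\<lambda>j. unit (l k) (l j))) (\<lambda>j. cmod (c (l j)))"
        using D1[of k] by (simp add: c_def norm_mult)
      moreover have "0 \<le> weight_ratio p \<alpha> (l k) * lp_norm p UNIV (\<lambda>j. unit (l k) (l j))"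
        using D1[of k] lp_norm_nonneg[OF \<open>(\<lambda>j. unit (l k) (l j)) \<in> lp_space p UNIV\<close>] by simp
      ultimately have "(\<lambda>j. c (l j)) \<in> lp_space p UNIV" using lp_bound_iff[OF p] by blast
      then show ?thesis using lp_reindex(1)[of l \<Lambda> c p, OF bij c0] by blast
    qed
    from onto[OF this] obtain b where b: "R (gauss_series \<beta> q b) = c" "lp_bound p (CL * lp_norm p \<Lambda> c) (\<lambda>k. cmod (b k))" by blast
    have M: "0 \<le> CL * lp_norm p \<Lambda> c" using CL lp_norm_nonneg[OF \<open>c \<in> lp_space p \<Lambda>\<close>] by simp
    have bM: "cmod (b j) \<le> CL * lp_norm p \<Lambda> c" for j using lp_bound_component[OF p b(2) M] by simp
    have "val b i = (if i = k then 1 else 0)" for i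
    proof -
      have "of_real (weight_ratio p \<alpha> (l i)) * val b i = c (l i)" using Rb[of b _ i, OF bM] b(1) by simp
      then show ?thesis using D1[of i] by (auto simp: c_def unit_def inj_eq[OF inj])
    qed
    then show "\<exists>b M. 0 \<le> M \<and> lp_bound p M (\<lambda>l. cmod (b l)) \<and> (\<forall>i. val b i = (if i = k then 1 else 0))"
      using M b(2) by blast
  qed
  obtain K where K: "\<And>n. \<bar>\<tau> n - real n\<bar> \<le> K" using deviation_bounded by blast
  obtain e1 B1 where e1: "e1 > 0" "\<And>j m. j \<le> m \<Longrightarrow> (\<Sum>i=j..<m. \<tau> i - real i) \<le> (1/2 - e1) * (real m - real j) + B1"
    using upper_average by blast
  obtain e2 B2 where e2: "e2 > 0" "\<And>j m. j \<le> m \<Longrightarrow> - (\<Sum>i=j..<m. \<tau> i - real i) \<le> (1/2 - e2) * (real m - real j) + B2"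
    using lower_average by blast
  define e where "e = min e1 e2"
  define B where "B = max 0 (max B1 B2)"
  have e: "e > 0" using e1 e2 by (simp add: e_def)
  \<comment> \<open>So large that the additive constants use up at most half of the margin, namely N
    e/2; the other half becomes \<epsilon>.\<close>
  obtain N :: nat where N: "real N > 2 * B / e + 1" using reals_Archimedean2 by blast
  have B0: "0 \<le> B" by (simp add: B_def)
  have N1: "1 \<le> N"
  proof -
    have "0 \<le> 2 * B / e" using B0 e by simp
    then show ?thesis using N by linarith
  qed
  have BN: "B \<le> real N * (e/2)"
  proof -
    have "2 * B / e \<le> real N" using N by linarith
    then show ?thesis using e by (simp add: pos_divide_le_eq algebra_simps)
  qed
  have win: "\<bar>\<Sum>k=n..<n+N. \<tau> k - real k\<bar> \<le> real N * (1/2 - e/2)" for n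
  proof -
    let ?S = "\<Sum>k=n..<n+N. \<tau> k - real k"
    have d: "real (n + N) - real n = real N" by simp
    have "?S \<le> (1/2 - e1) * real N + B1" using e1(2)[of n "n+N"] unfolding d by simp
    moreover have "(1/2 - e1) * real N \<le> (1/2 - e) * real N" by (intro mult_right_mono) (auto simp: e_def)
    moreover have "- ?S \<le> (1/2 - e2) * real N + B2" using e2(2)[of n "n+N"] unfolding d by simp
    moreover have "(1/2 - e2) * real N \<le> (1/2 - e) * real N" by (intro mult_right_mono) (auto simp: e_def)
    moreover have "B1 \<le> B" "B2 \<le> B" by (auto simp: B_def)
    moreover have "(1/2 - e) * real N + real N * (e/2) = real N * (1/2 - e/2)" by (simp add: algebra_simps)
    ultimately show ?thesis using BN by (intro abs_leI) linarith+
  qed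
  have repr: "l k = of_real (exp ((real k + enn2real (2 / p) + (\<tau> k - real k)) / (2 * \<alpha>))) * exp (\<i> * of_real (Arg (l k)))" for k
  proof -
    have "(real k + enn2real (2 / p) + (\<tau> k - real k)) / (2 * \<alpha>) = ln (cmod (l k))"
      using \<alpha> by (simp add: \<tau>_def q_def)
    then show ?thesis using Arg_eq[OF l0[of k]] l0[of k] by simp
  qed
  have "e / 2 > 0" using e by simp
  then show "\<exists>(l :: nat \<Rightarrow> complex) \<delta> \<theta> K (N::nat) \<epsilon>. bij_betw l UNIV \<Lambda> \<and> (\<forall>k. cmod (l k) \<le> cmod (l (Suc k))) \<and>
      (\<forall>k. l k = of_real (exp ((real k + enn2real (2 / p) + \<delta> k) / (2 * \<alpha>))) * exp (\<i> * of_real (\<theta> k))) \<and>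
      (\<forall>k. \<bar>\<delta> k\<bar> \<le> K) \<and> 1 \<le> N \<and> 0 < \<epsilon> \<and> (\<forall>n. \<bar>\<Sum>k=n..<n+N. \<delta> k\<bar> \<le> real N * (1/2 - \<epsilon>))"
    using bij mono repr K N1 win
    by (intro exI[of _ l] exI[of _ "\<lambda>k. \<tau> k - real k"] exI[of _ "\<lambda>k. Arg (l k)"] exI[of _ K] exI[of _ N] exI[of _ "e/2"]) blast
qed

theorem theorem1:
  fixes p :: ennreal and \<alpha> :: real and \<Lambda> :: "complex set"
  assumes "0 < p" and "0 < \<alpha>" and "\<Lambda> \<subseteq> UNIV - {0}"
  shows "complete_interpolating p \<alpha> \<Lambda> \<longleftrightarrow>
    d_log_plus_separated \<Lambda> \<and>
    (\<exists>(l :: nat \<Rightarrow> complex) (\<delta> :: nat \<Rightarrow> real) (\<theta> :: nat \<Rightarrow> real).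
       bij_betw l UNIV \<Lambda> \<and>
       (\<forall>k. cmod (l k) \<le> cmod (l (Suc k))) \<and>
       (\<forall>k. l k = of_real (exp ((real k + enn2real (2 / p) + \<delta> k) / (2 * \<alpha>))) *
                  exp (\<i> * of_real (\<theta> k))) \<and>
       bounded (range \<delta>) \<and>
       (\<exists>N::nat. \<exists>\<epsilon>::real. 1 \<le> N \<and> 0 < \<epsilon> \<and>
          (SUP n. ereal \<bar>1 / real N * (\<Sum>k=n..n + N - 1. \<delta> k)\<bar>) \<le> ereal (1 / 2 - \<epsilon>)))"
    (is "_ \<longleftrightarrow> ?R")
proof -
  \<comment> \<open>In \<open>ereal\<close> the supremum exists whatever the averages are, so a
    bound for it is a bound for each of them.\<close>
  have average_iff: "(SUP n. ereal \<bar>1 / real N * (\<Sum>k=n..n + N - 1. \<delta> k)\<bar>) \<le> ereal (1 / 2 - \<epsilon>) \<longleftrightarrow>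
      (\<forall>n. \<bar>\<Sum>k=n..<n+N. \<delta> k\<bar> \<le> real N * (1/2 - \<epsilon>))" if N: "1 \<le> N" for N :: nat and \<delta> :: "nat \<Rightarrow> real" and \<epsilon>
  proof -
    \<comment> \<open>The subtraction is truncated: for n = N = 0 the left-hand interval would be
      {0} and not empty.\<close>
    have "{n..n + N - 1} = {n..<n+N}" for n using N by auto
    then have "\<bar>1 / real N * (\<Sum>k=n..n + N - 1. \<delta> k)\<bar> \<le> 1/2 - \<epsilon> \<longleftrightarrow> \<bar>\<Sum>k=n..<n+N. \<delta> k\<bar> \<le> real N * (1/2 - \<epsilon>)" for n
      using N by (simp add: abs_mult pos_divide_le_eq mult.commute)
    then show ?thesis by (simp add: SUP_le_iff)
  qed
  show ?thesis
  proof
    assume ci: "complete_interpolating p \<alpha> \<Lambda>"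
    obtain l :: "nat \<Rightarrow> complex" and \<delta> \<theta> K and N :: nat and \<epsilon> where *: "bij_betw l UNIV \<Lambda>" "\<forall>k. cmod (l k) \<le> cmod (l (Suc k))"
      "\<forall>k. l k = of_real (exp ((real k + enn2real (2 / p) + \<delta> k) / (2 * \<alpha>))) * exp (\<i> * of_real (\<theta> k))"
      "\<forall>k. \<bar>\<delta> k\<bar> \<le> K" "1 \<le> N" "0 < \<epsilon>" "\<forall>n. \<bar>\<Sum>k=n..<n+N. \<delta> k\<bar> \<le> real N * (1/2 - \<epsilon>)"
      using complete_interpolating_necessary(2)[OF assms ci] by (elim exE conjE)
    have "bounded (range \<delta>)" using *(4) by (auto simp: bounded_iff)
    then show ?R using complete_interpolating_necessary(1)[OF assms ci] *(1,2,3,5,6) iffD2[OF average_iff[OF *(5)] *(7)]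
      by blast
  next
    assume R: ?R
    then obtain l :: "nat \<Rightarrow> complex" and \<delta> \<theta> :: "nat \<Rightarrow> real" and N :: nat and \<epsilon> :: real where sep: "d_log_plus_separated \<Lambda>"
      and *: "bij_betw l UNIV \<Lambda>" "\<forall>k. cmod (l k) \<le> cmod (l (Suc k))"
      "\<forall>k. l k = of_real (exp ((real k + enn2real (2 / p) + \<delta> k) / (2 * \<alpha>))) * exp (\<i> * of_real (\<theta> k))"
      "bounded (range \<delta>)" "1 \<le> N" "0 < \<epsilon>"
      "(SUP n. ereal \<bar>1 / real N * (\<Sum>k=n..n + N - 1. \<delta> k)\<bar>) \<le> ereal (1 / 2 - \<epsilon>)"
      by (elim exE conjE)
    obtain K where K: "\<forall>k. \<bar>\<delta> k\<bar> \<le> K" using *(4) by (auto simp: bounded_iff)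
    show "complete_interpolating p \<alpha> \<Lambda>"
      using complete_interpolating_sufficient[OF assms sep *(1), of \<delta> \<theta> K N \<epsilon>] *(2,3,5,6) K
        iffD1[OF average_iff[OF *(5)] *(7)] by blast
  qed
qed

end
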